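(* Let $R\subseteq S$ be a standard extension of degree $n$ of finite valuation rings, where $R$ has residue field of odd size $q$ and uniformizer $\pi$ of nilpotency degree $\ell$. Let $\chi$ be a non-trivial character of $S^\times$ with valuation $\nu(\chi)=k\geq 1$, and let $\chi_{\mathrm{res}}$ be its restriction to $R^\times$. (i) If $\chi_{\mathrm{res}}$ is non-trivial, then $E_0(\chi)=0$, and $|E(\chi)|=q^{(n-1)(\ell-k/2)}$ if $\nu(\chi_{\mathrm{res}})=k$, while $E(\chi)=0$ if $\nu(\chi_{\mathrm{res}})\neq k$. (ii) If $\chi_{\mathrm{res}}$ is trivial, then $|E(\chi)|=q^{(n-1)\ell-n/2}$ if $k=1$ and $E(\chi)=0$ if $k\neq 1$, and $|E_0(\chi)|=(1-q^{-1})\,q^{(n-1)\ell-(n/2-1)k}$. Furthermore, if $k=1$ then $E_0(\chi)=-(q-1)E(\chi)$.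
   Context: Rings are commutative with identity. A finite valuation ring is a finite local principal ring with maximal ideal $(\pi)$; $q=|R/(\pi)|$ and $\ell$ is the smallest positive integer with $\pi^\ell=0$. Standard extension of degree $n$: let $F=R/(\pi)$, let $\bar f\in F[X]$ be monic irreducible of degree $n$, let $f\in R[X]$ be a monic polynomial of degree $n$ reducing to $\bar f$, and set $S=R[X]/(f)=R[\xi]$; then $S$ is a finite valuation ring with uniformizer $\pi$, the same $\ell$, and residue field of size $q^n$. The trace $\mathrm{Tr}:S\to R$ sends $s$ to the trace of the matrix of multiplication by $s$ on the free $R$-module $S$ with basis $1,\xi,\dots,\xi^{n-1}$. For a character $\chi$ of $S^\times$: $E(\chi)=\sum_{y\in S,\,\mathrm{Tr}(y)=1}\chi(y)$ (such $y$ are units) and $E_0(\chi)=\sum_{y\in S^\times,\,\mathrm{Tr}(y)=0}\chi(y)$. Valuation of a multiplicative character $\chi$ of $R^\times$ (resp. $S^\times$): $\nu(\chi)$ is the smallest $k\geq0$ such that $\chi$ is trivial on $1+(\pi^k)$, where $1+(\pi^0)$ means the whole unit group; valuations of $\chi_{\mathrm{res}}$ are with respect to $R$. *)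

theory Defs
  imports Complex_Main "HOL-Algebra.Ring_Divisibility" "HOL-Algebra.UnivPoly"
begin

section \<open>Finite valuation rings\<close>

locale finite_valuation_ring = cring R for R (structure) +
  fixes \<pi> :: 'a
  assumes finite_carrier: "finite (carrier R)"
    and principal: "ideal I R \<Longrightarrow> \<exists>a \<in> carrier R. I = PIdl a"
    and local_ring: "\<exists>!M. maximalideal M R"
    and uniformizer_closed: "\<pi> \<in> carrier R"
    and uniformizer_maximal: "maximalideal (PIdl \<pi>) R"

definition residue_ring_of :: "('a, 'b) ring_scheme \<Rightarrow> 'a \<Rightarrow> 'a set ring"
  where "residue_ring_of R \<pi> = R Quot (PIdl\<^bsub>R\<^esub> \<pi>)"

definition residue_size :: "('a, 'b) ring_scheme \<Rightarrow> 'a \<Rightarrow> nat"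
  where "residue_size R \<pi> = card (carrier (residue_ring_of R \<pi>))"

definition nilpotency_degree :: "('a, 'b) ring_scheme \<Rightarrow> 'a \<Rightarrow> nat"
  where "nilpotency_degree R \<pi> = (LEAST m. 0 < m \<and> \<pi> [^]\<^bsub>R\<^esub> m = \<zero>\<^bsub>R\<^esub>)"


section \<open>Standard extensions\<close>

locale standard_extension = finite_valuation_ring R \<pi> for R (structure) and \<pi> +
  fixes fbar :: "nat \<Rightarrow> 'a set" and f :: "nat \<Rightarrow> 'a" and n :: nat
  assumes fbar_closed: "fbar \<in> carrier (UP (residue_ring_of R \<pi>))"
    and fbar_deg: "deg (residue_ring_of R \<pi>) fbar = n"
    and fbar_monic: "coeff (UP (residue_ring_of R \<pi>)) fbar n = \<one>\<^bsub>residue_ring_of R \<pi>\<^esub>"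
    and fbar_irreducible: "ring_irreducible\<^bsub>UP (residue_ring_of R \<pi>)\<^esub> fbar"
    and f_closed: "f \<in> carrier (UP R)"
    and f_deg: "deg R f = n"
    and f_monic: "coeff (UP R) f n = \<one>"
    and f_reduces: "coeff (UP (residue_ring_of R \<pi>)) fbar i = PIdl \<pi> +> coeff (UP R) f i"

definition ext_ring :: "('a, 'b) ring_scheme \<Rightarrow> (nat \<Rightarrow> 'a) \<Rightarrow> (nat \<Rightarrow> 'a) set ring"
  where "ext_ring R f = UP R Quot (PIdl\<^bsub>UP R\<^esub> f)"

text \<open>The structure map through which \<open>R\<close> is regarded as a subring of \<open>S = R[X]/(f)\<close>,
  and the class \<open>\<xi>\<close> of \<open>X\<close>.\<close>

definition ext_incl :: "('a, 'b) ring_scheme \<Rightarrow> (nat \<Rightarrow> 'a) \<Rightarrow> 'a \<Rightarrow> (nat \<Rightarrow> 'a) set"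
  where "ext_incl R f r = PIdl\<^bsub>UP R\<^esub> f +>\<^bsub>UP R\<^esub> monom (UP R) r 0"

definition ext_gen :: "('a, 'b) ring_scheme \<Rightarrow> (nat \<Rightarrow> 'a) \<Rightarrow> (nat \<Rightarrow> 'a) set"
  where "ext_gen R f = PIdl\<^bsub>UP R\<^esub> f +>\<^bsub>UP R\<^esub> monom (UP R) \<one>\<^bsub>R\<^esub> 1"

definition ext_coords :: "('a, 'b) ring_scheme \<Rightarrow> (nat \<Rightarrow> 'a) \<Rightarrow> (nat \<Rightarrow> 'a) set \<Rightarrow> nat \<Rightarrow> 'a"
  where "ext_coords R f s = (THE c. c \<in> {..<deg R f} \<rightarrow>\<^sub>E carrier R \<and>
    s = (\<Oplus>\<^bsub>ext_ring R f\<^esub>i\<in>{..<deg R f}.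
          ext_incl R f (c i) \<otimes>\<^bsub>ext_ring R f\<^esub> ext_gen R f [^]\<^bsub>ext_ring R f\<^esub> i))"

definition mult_matrix ::
    "('a, 'b) ring_scheme \<Rightarrow> (nat \<Rightarrow> 'a) \<Rightarrow> (nat \<Rightarrow> 'a) set \<Rightarrow> nat \<Rightarrow> nat \<Rightarrow> 'a"
  where "mult_matrix R f s i j =
    ext_coords R f (s \<otimes>\<^bsub>ext_ring R f\<^esub> ext_gen R f [^]\<^bsub>ext_ring R f\<^esub> j) i"

definition ext_trace :: "('a, 'b) ring_scheme \<Rightarrow> (nat \<Rightarrow> 'a) \<Rightarrow> (nat \<Rightarrow> 'a) set \<Rightarrow> 'a"
  where "ext_trace R f s = (\<Oplus>\<^bsub>R\<^esub>i\<in>{..<deg R f}. mult_matrix R f s i i)"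


section \<open>Multiplicative characters and Eisenstein sums\<close>

definition complex_units :: "complex monoid"
  where "complex_units = \<lparr>carrier = - {0}, mult = (*), one = 1\<rparr>"

text \<open>A character is constrained only on the units.\<close>

definition mult_characters :: "('a, 'b) ring_scheme \<Rightarrow> ('a \<Rightarrow> complex) set"
  where "mult_characters A = hom (units_of A) complex_units"

definition trivial_character :: "('a, 'b) ring_scheme \<Rightarrow> ('a \<Rightarrow> complex) \<Rightarrow> bool"
  where "trivial_character A chi \<longleftrightarrow> (\<forall>u \<in> Units A. chi u = 1)"

definition principal_units :: "('a, 'b) ring_scheme \<Rightarrow> 'a \<Rightarrow> nat \<Rightarrow> 'a set"
  where "principal_units A \<pi> k =
    (if k = 0 then Units A else {\<one>\<^bsub>A\<^esub> \<oplus>\<^bsub>A\<^esub> x | x. x \<in> PIdl\<^bsub>A\<^esub> (\<pi> [^]\<^bsub>A\<^esub> k)})"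

definition char_valuation :: "('a, 'b) ring_scheme \<Rightarrow> 'a \<Rightarrow> ('a \<Rightarrow> complex) \<Rightarrow> nat"
  where "char_valuation A \<pi> chi = (LEAST k. \<forall>u \<in> principal_units A \<pi> k. chi u = 1)"

definition char_res ::
    "('a, 'b) ring_scheme \<Rightarrow> (nat \<Rightarrow> 'a) \<Rightarrow> ((nat \<Rightarrow> 'a) set \<Rightarrow> complex) \<Rightarrow> 'a \<Rightarrow> complex"
  where "char_res R f chi r = chi (ext_incl R f r)"

definition eisenstein_sum ::
    "('a, 'b) ring_scheme \<Rightarrow> (nat \<Rightarrow> 'a) \<Rightarrow> ((nat \<Rightarrow> 'a) set \<Rightarrow> complex) \<Rightarrow> complex"
  where "eisenstein_sum R f chi =
    (\<Sum>y \<in> {y \<in> carrier (ext_ring R f). ext_trace R f y = \<one>\<^bsub>R\<^esub>}. chi y)"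

definition eisenstein_sum0 ::
    "('a, 'b) ring_scheme \<Rightarrow> (nat \<Rightarrow> 'a) \<Rightarrow> ((nat \<Rightarrow> 'a) set \<Rightarrow> complex) \<Rightarrow> complex"
  where "eisenstein_sum0 R f chi =
    (\<Sum>y \<in> {y \<in> Units (ext_ring R f). ext_trace R f y = \<zero>\<^bsub>R\<^esub>}. chi y)"

end

theory Submission
  imports Defs "HOL-Algebra.Multiplicative_Group"
begin

text \<open>
  Write \<open>E c\<close> for the sum of \<open>\<chi>(y)\<close> over the units \<open>y\<close> of \<open>S\<close> of trace \<open>c\<close>.
  Scaling \<open>y\<close> by a unit \<open>r\<close> of \<open>R\<close> gives \<open>E (r c) = \<chi>(r) E c\<close>, and \<open>E c\<close> depends only on \<open>c\<close> modulo \<open>\<pi>\<^sup>k\<close>.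
  Scaling \<open>y\<close> by \<open>1 + \<pi>\<^sup>i t\<close> shows that \<open>E\<close> sums to zero over every coset of \<open>(\<pi>\<^sup>i)\<close> in \<open>R\<close> when \<open>i < k\<close>.
  These relations determine all \<open>E c\<close> up to one unknown absolute value, which is then obtained
  from the second moment: the sum of \<open>|E c|\<^sup>2\<close> over \<open>c\<close> in \<open>R\<close> equals the sum of
  \<open>\<chi>(z) |{y. Tr ((z - 1) y) = 0}|\<close> over the units \<open>z\<close>, where the cardinality depends only on the
  valuation of \<open>z - 1\<close>. No additive characters are needed.

  The counting requires the trace to be surjective. By Euler's formula \<open>Tr s\<close> is the last coordinate of
  \<open>f'(\<xi>) s\<close>, and \<open>f'(\<xi>)\<close> is a unit because the residue field extension is separable.
\<close>

section \<open>Chain rings\<close>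

text \<open>A single Eisenstein sum gives no access to its absolute value, so all values of E are
  treated together. If some r in 1 + (\<pi>^(k-1)) has chi(r) different from 1, then r c and c agree
  modulo \<pi>^k for every non-unit c; so E lives on the units, where its absolute value is
  constant. If the restriction is non-trivial of smaller valuation, E is constant on a coset around
  1 whose sum vanishes. If it is trivial, E depends only on the valuation of c, and the coset sums
  leave just the two values E(\<pi>^(k-1)) and E(0), with ratio -(q - 1). In the second moment the
  cardinality is a step function of the valuation of z - 1. Written as a combination of indicators
  of the ideals (\<pi>^i), its pairing with chi sees only the levels i \<ge> k; this is how k enters
  the exponents. Over R the polynomial f has no roots at hand to sum over, so Euler's formula is
  derived inside S from the Horner scheme of f at \<xi>.\<close>

lemma (in cring) cgenideal_mem_iff: "x \<in> PIdl a \<longleftrightarrow> (\<exists>y \<in> carrier R. x = y \<otimes> a)"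
  unfolding cgenideal_def by blast

text \<open>Geometric series: for y = - x the partial sum g of the powers of y satisfies (1 - y) g =
  1 - y^m, and y^m vanishes together with x^m.\<close>

lemma (in cring) one_add_nilpotent_Unit:
  assumes x: "x \<in> carrier R" and z: "x [^] (m::nat) = \<zero>"
  shows "\<one> \<oplus> x \<in> Units R"
proof -
  define y where "y = \<ominus> x"
  have y: "y \<in> carrier R" "\<one> \<oplus> x = \<one> \<ominus> y" using x by (auto simp: y_def a_minus_def)
  have "\<exists>g\<in>carrier R. (\<one> \<ominus> y) \<otimes> g = \<one> \<ominus> y [^] j" for j :: nat
  proof (induction j)
    case 0
    then show ?case using y by (intro bexI[of _ \<zero>]) (auto simp: a_minus_def r_neg)
  next
    case (Suc j)
    then obtain g where g: "g \<in> carrier R" "(\<one> \<ominus> y) \<otimes> g = \<one> \<ominus> y [^] j" by blast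
    have "(\<one> \<ominus> y) \<otimes> (g \<oplus> y [^] j) = (\<one> \<ominus> y [^] j) \<oplus> (y [^] j \<ominus> y [^] Suc j)"
    proof -
      have "(\<one> \<ominus> y) \<otimes> y [^] j = y [^] j \<ominus> y [^] Suc j"
        using y(1) m_comm[of y "y [^] j"] by (simp add: a_minus_def l_distr l_minus)
      then show ?thesis using g y(1) by (simp add: r_distr)
    qed
    also have "\<dots> = \<one> \<oplus> (\<ominus> (y [^] j) \<oplus> y [^] j) \<oplus> \<ominus> (y [^] Suc j)"
      using y(1) by (simp only: a_minus_def a_assoc a_closed a_inv_closed one_closed nat_pow_closed)
    also have "\<dots> = \<one> \<ominus> y [^] Suc j" using y(1) by (simp add: a_minus_def l_neg)
    finally show ?case using g y(1) by (intro bexI[of _ "g \<oplus> y [^] j"]) auto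
  qed
  then obtain g where g: "g \<in> carrier R" "(\<one> \<ominus> y) \<otimes> g = \<one> \<ominus> y [^] m" by blast
  have "y [^] j = x [^] j \<or> y [^] j = \<ominus> (x [^] j)" for j :: nat
    using x by (induction j) (auto simp: y_def l_minus r_minus)
  then have "y [^] m = \<zero>" using z by (metis minus_zero)
  then have "(\<one> \<oplus> x) \<otimes> g = \<one>" using g y by (simp add: a_minus_def)
  then show ?thesis using g x m_comm[of "\<one> \<oplus> x" g] unfolding Units_def by auto
qed

section \<open>Cosets and fibres of additive maps\<close>

lemma (in ideal) coset_eq_zero_iff:
  "x \<in> carrier R \<Longrightarrow> I +> x = \<zero>\<^bsub>R Quot I\<^esub> \<longleftrightarrow> x \<in> I"
  using a_coset_join1[OF _ _ a_subgroup] a_coset_join2[OF _ a_subgroup]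
  by (auto simp: FactRing_def)

lemma (in ideal) Quot_carrier_coset: "c \<in> carrier (R Quot I) \<Longrightarrow> \<exists>x\<in>carrier R. c = I +> x"
  by (auto simp: FactRing_def A_RCOSETS_def')

text \<open>Every non-empty fibre is a translate of the kernel, and the hypothesis on
  \<open>J\<close> makes its fibres non-empty. Additivity is asked on \<open>I\<close> only and the
  target is another ring, so that the trace can be applied to ideals of S.\<close>

lemma (in cring) card_additive_preimage:
  fixes B :: "('c, 'd) ring_scheme"
  assumes I: "additive_subgroup I R" and finI: "finite I"
    and B: "abelian_group B"
    and h: "\<And>x. x \<in> I \<Longrightarrow> h x \<in> carrier B"
    and hadd: "\<And>x y. \<lbrakk>x \<in> I; y \<in> I\<rbrakk> \<Longrightarrow> h (x \<oplus> y) = h x \<oplus>\<^bsub>B\<^esub> h y"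
    and J: "J \<subseteq> h ` I"
  shows "card {x \<in> I. h x \<in> J} = card J * card {x \<in> I. h x = \<zero>\<^bsub>B\<^esub>}"
proof -
  interpret I: additive_subgroup I R by fact
  interpret B: abelian_group B by fact
  have IR: "x \<in> carrier R" if "x \<in> I" for x using that I.a_subset by blast
  have fib: "card {x \<in> I. h x = b} = card {x \<in> I. h x = \<zero>\<^bsub>B\<^esub>}" if b: "b \<in> h ` I" for b
  proof -
    obtain a where a: "a \<in> I" "b = h a" using b by blast
    have "bij_betw (\<lambda>x. x \<oplus> a) {x \<in> I. h x = \<zero>\<^bsub>B\<^esub>} {x \<in> I. h x = b}"
    proof (rule bij_betwI[where g = "\<lambda>x. x \<ominus> a"])
      show "(\<lambda>x. x \<oplus> a) \<in> {x \<in> I. h x = \<zero>\<^bsub>B\<^esub>} \<rightarrow> {x \<in> I. h x = b}"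
      proof
        fix x assume x: "x \<in> {x \<in> I. h x = \<zero>\<^bsub>B\<^esub>}"
        then have "h (x \<oplus> a) = \<zero>\<^bsub>B\<^esub> \<oplus>\<^bsub>B\<^esub> h a" using hadd[OF _ a(1), of x] by simp
        then show "x \<oplus> a \<in> {x \<in> I. h x = b}"
          using x a B.l_zero[OF h[OF a(1)]] I.a_closed[of x a] by simp
      qed
      show "(\<lambda>x. x \<ominus> a) \<in> {x \<in> I. h x = b} \<rightarrow> {x \<in> I. h x = \<zero>\<^bsub>B\<^esub>}"
      proof
        fix x assume x: "x \<in> {x \<in> I. h x = b}"
        have xa: "x \<ominus> a \<in> I" using x a by (simp add: a_minus_def)
        have "x = (x \<ominus> a) \<oplus> a" using IR[OF a(1)] IR[of x] x by (simp add: a_minus_def a_assoc l_neg)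
        then have "h x = h (x \<ominus> a) \<oplus>\<^bsub>B\<^esub> h a" using hadd[OF xa a(1)] by simp
        then have "h (x \<ominus> a) = \<zero>\<^bsub>B\<^esub>" using x a B.add.l_cancel_one'[OF h[OF a(1)] h[OF xa]] B.a_comm[OF h[OF a(1)] h[OF xa]] by simp
        then show "x \<ominus> a \<in> {x \<in> I. h x = \<zero>\<^bsub>B\<^esub>}" using xa by simp
      qed
    next
      fix x assume "x \<in> {x \<in> I. h x = \<zero>\<^bsub>B\<^esub>}"
      then have "x \<in> carrier R" using IR by blast
      then show "x \<oplus> a \<ominus> a = x" using IR[OF a(1)] by (simp add: a_minus_def a_assoc r_neg)
    next
      fix x assume "x \<in> {x \<in> I. h x = b}"
      then have "x \<in> carrier R" using IR by blast
      then show "x \<ominus> a \<oplus> a = x" using IR[OF a(1)] by (simp add: a_minus_def a_assoc l_neg)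
    qed
    then show ?thesis by (rule bij_betw_same_card[symmetric])
  qed
  have finJ: "finite J" using J finI by (meson finite_imageI finite_subset)
  have "{x \<in> I. h x \<in> J} = (\<Union>b\<in>J. {x \<in> I. h x = b})" by auto
  then have "card {x \<in> I. h x \<in> J} = (\<Sum>b\<in>J. card {x \<in> I. h x = b})"
    using finJ finI by (simp only: card_UN_disjoint) (subst card_UN_disjoint; auto)
  also have "\<dots> = (\<Sum>b\<in>J. card {x \<in> I. h x = \<zero>\<^bsub>B\<^esub>})" using J by (intro sum.cong refl fib) blast
  finally show ?thesis by simp
qed

lemma (in cring) card_additive_image:
  fixes B :: "('c, 'd) ring_scheme"
  assumes "additive_subgroup I R" and "finite I" and "abelian_group B"
    and "\<And>x. x \<in> I \<Longrightarrow> h x \<in> carrier B"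
    and "\<And>x y. \<lbrakk>x \<in> I; y \<in> I\<rbrakk> \<Longrightarrow> h (x \<oplus> y) = h x \<oplus>\<^bsub>B\<^esub> h y"
  shows "card I = card (h ` I) * card {x \<in> I. h x = \<zero>\<^bsub>B\<^esub>}"
proof -
  have "{x \<in> I. h x \<in> h ` I} = I" by auto
  then show ?thesis using card_additive_preimage[OF assms, of "h ` I"] by simp
qed

text \<open>The common abstraction of R and S, used with the uniformizer or its image as
  \<open>p\<close> and with the same \<open>m\<close>. For S only these axioms are established:
  non-units are the multiples of \<open>p\<close>, and \<open>p\<close> is nilpotent of exact order
  \<open>m\<close>.\<close>

locale chain_ring = cring A for A (structure) +
  fixes p :: 'a and m :: nat
  assumes finite_carrier: "finite (carrier A)"
    and p_closed [simp, intro]: "p \<in> carrier A"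
    and Units_eq: "Units A = carrier A - PIdl p"
    and p_pow_m: "p [^] m = \<zero>"
    and m_pos: "0 < m"
    and p_pow_less: "p [^] (m - 1) \<noteq> \<zero>"
begin

section \<open>The filtration by powers of the uniformizer\<close>

definition Ip :: "nat \<Rightarrow> 'a set" where "Ip i = PIdl (p [^] i)"

lemma Ip_ideal: "ideal (Ip i) A" by (simp add: Ip_def cgenideal_ideal)

lemma Ip_mem: "x \<in> carrier A \<Longrightarrow> p [^] i \<otimes> x \<in> Ip i"
  by (auto simp: Ip_def cgenideal_mem_iff m_comm)

lemma Ip_memE:
  assumes "x \<in> Ip i" obtains y where "y \<in> carrier A" "x = p [^] i \<otimes> y"
  using assms unfolding Ip_def by (metis cgenideal_mem_iff m_comm nat_pow_closed p_closed)

lemma Ip_closed: "x \<in> Ip i \<Longrightarrow> x \<in> carrier A"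
  by (elim Ip_memE) auto

lemma Ip_finite: "finite (Ip i)"
  using finite_carrier Ip_closed by (meson finite_subset subsetI)

lemma Ip_0: "Ip 0 = carrier A"
  by (auto simp: Ip_def cgenideal_mem_iff)

lemma Ip_1: "Ip 1 = PIdl p" by (simp add: Ip_def)

lemma Ip_m: "Ip m = {\<zero>}"
  using p_pow_m by (auto simp: Ip_def cgenideal_mem_iff intro!: exI[of _ \<zero>])

lemma Ip_antimono: "i \<le> j \<Longrightarrow> Ip j \<subseteq> Ip i"
proof
  fix x assume ij: "i \<le> j" and "x \<in> Ip j"
  then obtain y where y: "y \<in> carrier A" "x = p [^] j \<otimes> y" by (elim Ip_memE)
  have "p [^] j = p [^] i \<otimes> p [^] (j - i)" using ij by (simp add: nat_pow_mult)
  then show "x \<in> Ip i" using y Ip_mem[of "p [^] (j - i) \<otimes> y" i] by (simp add: m_assoc)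
qed

lemma Ip_mult: "x \<in> Ip i \<Longrightarrow> y \<in> carrier A \<Longrightarrow> x \<otimes> y \<in> Ip i"
  using ideal.I_r_closed[OF Ip_ideal] by blast

lemma Ip_add: "x \<in> Ip i \<Longrightarrow> y \<in> Ip i \<Longrightarrow> x \<oplus> y \<in> Ip i"
  using additive_subgroup.a_closed[OF ideal.axioms(1)[OF Ip_ideal]] by blast

lemma Ip_minus: "x \<in> Ip i \<Longrightarrow> \<ominus> x \<in> Ip i"
  using additive_subgroup.a_inv_closed[OF ideal.axioms(1)[OF Ip_ideal]] by blast

lemma zero_in_Ip: "\<zero> \<in> Ip i"
  using additive_subgroup.zero_closed[OF ideal.axioms(1)[OF Ip_ideal]] by blast

lemma Unit_add_Ip:
  assumes u: "u \<in> Units A" and x: "x \<in> Ip i" and i: "1 \<le> i"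
  shows "u \<oplus> x \<in> Units A"
proof -
  have x1: "x \<in> Ip 1" using x i Ip_antimono by blast
  have uc: "u \<in> carrier A" and xc: "x \<in> carrier A" using u x Ip_closed by auto
  have "u \<oplus> x \<notin> Ip 1"
  proof
    assume "u \<oplus> x \<in> Ip 1"
    then have "(u \<oplus> x) \<oplus> \<ominus> x \<in> Ip 1" using x1 Ip_add Ip_minus by blast
    then have "u \<in> Ip 1" using uc xc by (simp add: a_assoc r_neg)
    then show False using u Units_eq Ip_1 by auto
  qed
  then show ?thesis using Units_eq uc xc Ip_1 by auto
qed

lemma one_add_Ip_Unit: "x \<in> Ip i \<Longrightarrow> 1 \<le> i \<Longrightarrow> \<one> \<oplus> x \<in> Units A"
  by (rule Unit_add_Ip) auto

lemma pow_unit_decomp: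
  assumes x: "x \<in> carrier A"
  obtains i u where "i \<le> m" "u \<in> Units A" "x = p [^] i \<otimes> u"
proof (cases "x = \<zero>")
  case True
  then show ?thesis using that[of m \<one>] p_pow_m by simp
next
  case False
  \<comment> \<open>The largest exponent with x in (p^i): were the cofactor a multiple of p, the
    exponent could be raised by one. Zero received the exponent m above.\<close>
  define i where "i = Max {i. i \<le> m \<and> x \<in> Ip i}"
  have "0 \<in> {i. i \<le> m \<and> x \<in> Ip i}" using x by (simp add: Ip_0)
  then have "i \<in> {i. i \<le> m \<and> x \<in> Ip i}" and mx: "\<And>j. j \<in> {i. i \<le> m \<and> x \<in> Ip i} \<Longrightarrow> j \<le> i"
    unfolding i_def by (intro Max_in; force) (intro Max_ge; force)
  then have i: "i \<le> m" "x \<in> Ip i" by auto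
  have im: "i \<noteq> m" using i False Ip_m by auto
  obtain u where u: "u \<in> carrier A" "x = p [^] i \<otimes> u" using i by (elim Ip_memE)
  have "u \<notin> PIdl p"
  proof
    assume "u \<in> PIdl p"
    then obtain v where v: "v \<in> carrier A" "u = v \<otimes> p" by (auto simp: cgenideal_mem_iff)
    have "x = p [^] Suc i \<otimes> v" using u v by (simp add: m_ac)
    then have "Suc i \<in> {i. i \<le> m \<and> x \<in> Ip i}" using Ip_mem[OF v(1), of "Suc i"] i im by auto
    then show False using mx by force
  qed
  then show ?thesis using that[OF i(1) _ u(2)] u Units_eq by auto
qed

lemma p_pow_eq_zero_iff: "p [^] i = \<zero> \<longleftrightarrow> m \<le> i"
proof
  assume "m \<le> i"
  then have "p [^] i = p [^] m \<otimes> p [^] (i - m)" by (simp add: nat_pow_mult)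
  then show "p [^] i = \<zero>" using p_pow_m by simp
next
  assume z: "p [^] i = \<zero>"
  show "m \<le> i"
  proof (rule ccontr)
    assume "\<not> m \<le> i"
    then have "p [^] (m - 1) = p [^] i \<otimes> p [^] (m - 1 - i)" by (simp add: nat_pow_mult)
    then show False using z p_pow_less by simp
  qed
qed

lemma mult_Unit_eq_zero:
  assumes "x \<in> carrier A" "u \<in> Units A" "x \<otimes> u = \<zero>" shows "x = \<zero>"
proof -
  have "x = (x \<otimes> u) \<otimes> inv u" using assms(1,2) by (simp add: m_assoc Units_closed)
  then show ?thesis using assms by (simp add: Units_closed)
qed

text \<open>For x = p^j u with u a unit, p^(i+j) u vanishes exactly when m \<le> i + j. Later this
  turns an equation Tr (w y) = 0 into membership in an ideal.\<close>

lemma annihilator_pow: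
  assumes x: "x \<in> carrier A" and i: "i \<le> m"
  shows "p [^] i \<otimes> x = \<zero> \<longleftrightarrow> x \<in> Ip (m - i)"
proof
  assume "x \<in> Ip (m - i)"
  then obtain y where y: "y \<in> carrier A" "x = p [^] (m - i) \<otimes> y" by (elim Ip_memE)
  have "p [^] i \<otimes> x = (p [^] i \<otimes> p [^] (m - i)) \<otimes> y" using y by (simp add: m_assoc)
  then show "p [^] i \<otimes> x = \<zero>" using i y p_pow_m by (simp add: nat_pow_mult)
next
  assume z: "p [^] i \<otimes> x = \<zero>"
  obtain j u where ju: "j \<le> m" "u \<in> Units A" "x = p [^] j \<otimes> u" using pow_unit_decomp[OF x] .
  have "p [^] (i + j) \<otimes> u = \<zero>" using z ju by (simp add: nat_pow_mult[symmetric] m_assoc Units_closed)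
  then have "p [^] (i + j) = \<zero>" using mult_Unit_eq_zero[OF _ ju(2)] by simp
  then have "m - i \<le> j" using p_pow_eq_zero_iff by simp
  then show "x \<in> Ip (m - i)" using Ip_antimono Ip_mem[of u j] ju by (auto simp: Units_closed)
qed

text \<open>Multiplication by p maps (p^i) onto (p^(i+1)) with kernel (p^(m-1)), so all layers of
  the filtration have the same index.\<close>

lemma card_Ip_Suc:
  assumes "i < m"
  shows "card (Ip i) = card (Ip (Suc i)) * card (Ip (m - 1))"
proof -
  have img: "(\<lambda>x. p \<otimes> x) ` Ip i = Ip (Suc i)"
  proof -
    have "x \<in> Ip (Suc i) \<longleftrightarrow> (\<exists>y\<in>carrier A. x = p \<otimes> (p [^] i \<otimes> y))" for x
      using Ip_mem[of _ "Suc i"] by (metis Ip_memE m_assoc m_comm nat_pow_Suc nat_pow_closed p_closed)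
    moreover have "x \<in> Ip i \<longleftrightarrow> (\<exists>y\<in>carrier A. x = p [^] i \<otimes> y)" for x
      using Ip_mem[of _ i] by (auto elim!: Ip_memE)
    ultimately show ?thesis by auto
  qed
  have ker: "{x \<in> Ip i. p \<otimes> x = \<zero>} = Ip (m - 1)"
    using annihilator_pow[of _ 1] m_pos Ip_closed subsetD[OF Ip_antimono[of i "m - 1"]] assms by auto
  have "card (Ip i) = card ((\<lambda>x. p \<otimes> x) ` Ip i) * card {x \<in> Ip i. p \<otimes> x = \<zero>}"
    by (rule card_additive_image)
      (use Ip_ideal ideal.axioms(1) Ip_finite Ip_closed is_abelian_group in \<open>auto simp: r_distr\<close>)
  then show ?thesis using img ker by simp
qed

lemma card_Ip: "i \<le> m \<Longrightarrow> card (Ip i) = card (Ip (m - 1)) ^ (m - i)"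
proof (induction "m - i" arbitrary: i)
  case 0
  then have "i = m" by simp
  then show ?case by (simp add: Ip_m)
next
  case (Suc d)
  then have "card (Ip (Suc i)) = card (Ip (m - 1)) ^ (m - Suc i)" by auto
  moreover have "m - i = Suc (m - Suc i)" using Suc by simp
  ultimately show ?case using card_Ip_Suc[of i] Suc by simp
qed

text \<open>Lagrange gives |A/(p)| |(p)| = |A|, the first layer gives |A| = |(p)| |(p^(m-1))|, and
  |(p)| cancels.\<close>

lemma residue_card: "card (carrier (A Quot PIdl p)) = card (Ip (m - 1))"
proof -
  have "card (a_rcosets (PIdl p)) * card (PIdl p) = order A"
    using a_lagrange[OF finite_carrier ideal.axioms(1)[OF cgenideal_ideal[OF p_closed]]] .
  then have "card (carrier (A Quot PIdl p)) * card (Ip 1) = card (Ip 1) * card (Ip (m - 1))"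
    using card_Ip_Suc[of 0] m_pos by (simp add: FactRing_def order_def Ip_0 flip: Ip_1)
  moreover have "card (Ip 1) \<noteq> 0" using Ip_finite zero_in_Ip[of 1] by (auto simp: card_eq_0_iff)
  ultimately show ?thesis by simp
qed

lemma card_carrier: "card (carrier A) = card (Ip (m - 1)) ^ m"
  using card_Ip[of 0] by (simp add: Ip_0)

section \<open>The residue field\<close>

lemma one_not_zero: "\<one> \<noteq> \<zero>"
  using p_pow_less by (metis nat_pow_closed p_closed r_null r_one)

text \<open>Lagrange in the additive group and in the unit group, where non-zero classes are classes
  of units of A. With Q the residue size, the two facts rule out non-zero derivations: x = x^Q would
  have derivative Q x^(Q-1) dx = 0.\<close>

lemma residue_pow_card:
  fixes K defines "K \<equiv> A Quot PIdl p"
  assumes x: "x \<in> carrier K"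
  shows "[card (carrier K)] \<cdot>\<^bsub>K\<^esub> x = \<zero>\<^bsub>K\<^esub>"
    and "x [^]\<^bsub>K\<^esub> card (carrier K) = x"
proof -
  interpret I: ideal "PIdl p" A using cgenideal_ideal[OF p_closed] .
  interpret K: cring K unfolding K_def by (rule I.quotient_is_cring[OF is_cring])
  note hom = I.rcos_ring_hom[folded K_def]
  note hom_closed = ring_hom_closed[OF hom] and hom_mult = ring_hom_mult[OF hom] and hom_one = ring_hom_one[OF hom]
  have surj: "\<exists>s\<in>carrier A. x = PIdl p +> s" if "x \<in> carrier K" for x
    using that by (auto simp: K_def FactRing_def A_RCOSETS_def')
  have "carrier K \<subseteq> (+>) (PIdl p) ` carrier A" using surj by blast
  then have fin: "finite (carrier K)" using finite_carrier finite_surj by blast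
  show "[card (carrier K)] \<cdot>\<^bsub>K\<^esub> x = \<zero>\<^bsub>K\<^esub>"
    using group.pow_order_eq_1[OF K.a_group, of x] x by (simp add: order_def add_pow_def)
  show "x [^]\<^bsub>K\<^esub> card (carrier K) = x"
  proof (cases "x = \<zero>\<^bsub>K\<^esub>")
    case True
    have "card (carrier K) \<noteq> 0" using fin x by auto
    then show ?thesis using True by (simp add: K.nat_pow_zero)
  next
    case False
    have U: "Units K = carrier K - {\<zero>\<^bsub>K\<^esub>}"
    proof
      have "\<one> \<notin> PIdl p" using Units_eq Units_one_closed by blast
      then have "\<one>\<^bsub>K\<^esub> \<noteq> \<zero>\<^bsub>K\<^esub>" using I.coset_eq_zero_iff[of "\<one>"] hom_one K_def by auto
      then have "\<zero>\<^bsub>K\<^esub> \<notin> Units K" using K.Units_r_inv_ex[of "\<zero>\<^bsub>K\<^esub>"] by auto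
      then show "Units K \<subseteq> carrier K - {\<zero>\<^bsub>K\<^esub>}" by (auto simp: K.Units_closed)
      show "carrier K - {\<zero>\<^bsub>K\<^esub>} \<subseteq> Units K"
      proof
        fix y assume y: "y \<in> carrier K - {\<zero>\<^bsub>K\<^esub>}"
        then obtain s where s: "s \<in> carrier A" "y = PIdl p +> s" using surj by blast
        then have "s \<notin> PIdl p" using y I.coset_eq_zero_iff[of s] K_def by auto
        then have u: "s \<in> Units A" using s Units_eq by blast
        let ?t = "PIdl p +> inv s"
        have "y \<otimes>\<^bsub>K\<^esub> ?t = \<one>\<^bsub>K\<^esub>" "?t \<in> carrier K"
          using u s hom_mult[of s "inv s"] hom_one hom_closed[of "inv s"] by auto
        then show "y \<in> Units K" using y K.m_comm[of y ?t] unfolding Units_def by blast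
      qed
    qed
    then have xu: "x \<in> Units K" using x False by blast
    have "x [^]\<^bsub>K\<^esub> card (Units K) = \<one>\<^bsub>K\<^esub>"
      using group.pow_order_eq_1[OF K.units_group, of x] xu
      by (simp add: order_def units_of_carrier units_of_one K.units_of_pow)
    moreover have "card (carrier K) = Suc (card (Units K))"
      unfolding U by (rule card.remove[OF fin K.zero_closed])
    ultimately show ?thesis using x by simp
  qed
qed

section \<open>Principal units and valuations\<close>

lemma Ip_mult_Ip: "x \<in> Ip i \<Longrightarrow> y \<in> Ip j \<Longrightarrow> x \<otimes> y \<in> Ip (i + j)"
proof -
  assume "x \<in> Ip i" "y \<in> Ip j"
  then obtain u v where "u \<in> carrier A" "x = p [^] i \<otimes> u" "v \<in> carrier A" "y = p [^] j \<otimes> v"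
    by (elim Ip_memE)
  then have "x \<otimes> y = p [^] (i + j) \<otimes> (u \<otimes> v)"
    by (simp add: nat_pow_mult[symmetric] m_ac)
  then show ?thesis using Ip_mem \<open>u \<in> carrier A\<close> \<open>v \<in> carrier A\<close> by simp
qed

text \<open>One description for all levels: at level 0 the congruence is void and only invertibility
  remains, while for i \<ge> 1 invertibility is automatic.\<close>

lemma principal_units_eq: "principal_units A p i = {u \<in> Units A. u \<ominus> \<one> \<in> Ip i}"
proof (cases "i = 0")
  case True
  then show ?thesis by (auto simp: principal_units_def Ip_0 Units_closed)
next
  case False
  have "{\<one> \<oplus> x |x. x \<in> Ip i} = {u \<in> Units A. u \<ominus> \<one> \<in> Ip i}"
  proof (intro equalityI subsetI)
    fix u assume "u \<in> {\<one> \<oplus> x |x. x \<in> Ip i}"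
    then obtain x where x: "x \<in> Ip i" "u = \<one> \<oplus> x" by blast
    then have "u \<ominus> \<one> = x" using Ip_closed[OF x(1)] by (simp add: a_minus_def a_ac r_neg)
    then show "u \<in> {u \<in> Units A. u \<ominus> \<one> \<in> Ip i}" using x one_add_Ip_Unit[OF x(1)] False by simp
  next
    fix u assume u: "u \<in> {u \<in> Units A. u \<ominus> \<one> \<in> Ip i}"
    then have "u = \<one> \<oplus> (u \<ominus> \<one>)" by (simp add: a_minus_def a_ac r_neg Units_closed)
    then show "u \<in> {\<one> \<oplus> x |x. x \<in> Ip i}" using u by blast
  qed
  then show ?thesis using False by (simp add: principal_units_def Ip_def)
qed

lemma principal_unitsE:
  assumes "u \<in> principal_units A p i"
  obtains x where "u \<in> Units A" "x \<in> Ip i" "u = \<one> \<oplus> x"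
proof (rule that)
  show u: "u \<in> Units A" "u \<ominus> \<one> \<in> Ip i" using assms by (auto simp: principal_units_eq)
  show "u = \<one> \<oplus> (u \<ominus> \<one>)" using u by (simp add: a_minus_def a_ac r_neg Units_closed)
qed

lemma principal_unitsI:
  assumes "1 \<le> i" "x \<in> Ip i"
  shows "\<one> \<oplus> x \<in> principal_units A p i"
  using assms by (auto simp: principal_units_def Ip_def)

text \<open>The exponent of a decomposition is a genuine valuation. Multiplying by p^(m-i) turns
  membership in (p^i) into the vanishing of p^(m-i+j) v.\<close>

lemma p_pow_Unit_mem_Ip:
  assumes v: "v \<in> Units A" and "i \<le> m" "j \<le> m"
  shows "p [^] j \<otimes> v \<in> Ip i \<longleftrightarrow> i \<le> j"
proof
  assume "i \<le> j"
  then show "p [^] j \<otimes> v \<in> Ip i" using Ip_antimono Ip_mem[of v j] v by (auto simp: Units_closed)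
next
  assume "p [^] j \<otimes> v \<in> Ip i"
  then have "p [^] (m - i) \<otimes> (p [^] j \<otimes> v) = \<zero>"
    using annihilator_pow[of "p [^] j \<otimes> v" "m - i"] assms by (simp add: Units_closed)
  then have "p [^] (m - i + j) \<otimes> v = \<zero>"
    using v by (simp add: nat_pow_mult[symmetric] m_assoc Units_closed)
  then have "p [^] (m - i + j) = \<zero>" using mult_Unit_eq_zero[OF _ v] by simp
  then have "m \<le> m - i + j" by (simp only: p_pow_eq_zero_iff)
  then show "i \<le> j" using assms by simp
qed

end

section \<open>The trace in a power basis\<close>

text \<open>The theory of the trace only needs S to be free over R on 1, ..., \<xi>^(n-1), with a
  monic relation for \<xi>; the quotient of the polynomial ring enters at the instantiation.\<close>

locale power_basis = ring_hom_cring R S \<iota> for R (structure) and S (structure) and \<iota> +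
  fixes \<xi> and n :: nat and a :: "nat \<Rightarrow> 'a"
  assumes xi_closed [simp, intro]: "\<xi> \<in> carrier S"
    and n_pos: "0 < n"
    and a_closed [simp, intro]: "\<And>i. a i \<in> carrier R"
    and xi_pow_n: "\<xi> [^]\<^bsub>S\<^esub> n \<oplus>\<^bsub>S\<^esub> (\<Oplus>\<^bsub>S\<^esub>i\<in>{..<n}. \<iota> (a i) \<otimes>\<^bsub>S\<^esub> \<xi> [^]\<^bsub>S\<^esub> i) = \<zero>\<^bsub>S\<^esub>"
    and unique_coords: "s \<in> carrier S \<Longrightarrow> \<exists>!c. c \<in> {..<n} \<rightarrow>\<^sub>E carrier R \<and>
      s = (\<Oplus>\<^bsub>S\<^esub>i\<in>{..<n}. \<iota> (c i) \<otimes>\<^bsub>S\<^esub> \<xi> [^]\<^bsub>S\<^esub> i)"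
begin

definition comb :: "(nat \<Rightarrow> 'a) \<Rightarrow> 'c"
  where "comb c = (\<Oplus>\<^bsub>S\<^esub>i\<in>{..<n}. \<iota> (c i) \<otimes>\<^bsub>S\<^esub> \<xi> [^]\<^bsub>S\<^esub> i)"

definition coords :: "'c \<Rightarrow> nat \<Rightarrow> 'a"
  where "coords s = (THE c. c \<in> {..<n} \<rightarrow>\<^sub>E carrier R \<and>
      s = (\<Oplus>\<^bsub>S\<^esub>i\<in>{..<n}. \<iota> (c i) \<otimes>\<^bsub>S\<^esub> \<xi> [^]\<^bsub>S\<^esub> i))"

definition Tr :: "'c \<Rightarrow> 'a"
  where "Tr s = (\<Oplus>i\<in>{..<n}. coords (s \<otimes>\<^bsub>S\<^esub> \<xi> [^]\<^bsub>S\<^esub> i) i)"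

section \<open>Coordinates and multiplication by the generator\<close>

lemma coords_comb:
  assumes s: "s \<in> carrier S"
  shows "coords s \<in> {..<n} \<rightarrow>\<^sub>E carrier R" "s = comb (coords s)"
  using theI'[OF unique_coords[OF s]] unfolding coords_def comb_def by auto

lemma coords_closed [simp]: "s \<in> carrier S \<Longrightarrow> i < n \<Longrightarrow> coords s i \<in> carrier R"
  using coords_comb(1) by blast

lemma comb_cong: "(\<And>i. i < n \<Longrightarrow> c i = c' i) \<Longrightarrow> (\<And>i. i < n \<Longrightarrow> c i \<in> carrier R) \<Longrightarrow> comb c = comb c'"
  unfolding comb_def by (rule S.finsum_cong') auto

lemma comb_closed [simp]: "(\<And>i. i < n \<Longrightarrow> c i \<in> carrier R) \<Longrightarrow> comb c \<in> carrier S"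
  unfolding comb_def by (auto intro!: S.finsum_closed)

lemma coords_eqI:
  assumes c: "\<And>i. i < n \<Longrightarrow> c i \<in> carrier R" and s: "s = comb c" and i: "i < n"
  shows "coords s i = c i"
proof -
  have sc: "s \<in> carrier S" using s c by simp
  \<comment> \<open>Uniqueness of coordinates holds among extensional families, so \<open>c\<close>
    is first cut down to the index range.\<close>
  have "comb (restrict c {..<n}) = comb c" using c by (intro comb_cong) auto
  then have "restrict c {..<n} \<in> {..<n} \<rightarrow>\<^sub>E carrier R \<and> s = comb (restrict c {..<n})"
    using c s by auto
  moreover have "coords s \<in> {..<n} \<rightarrow>\<^sub>E carrier R \<and> s = comb (coords s)" using coords_comb[OF sc] by simp
  ultimately have "coords s = restrict c {..<n}"
    using unique_coords[OF sc] unfolding comb_def by blast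
  then show ?thesis using i by simp
qed

lemma comb_add:
  assumes "\<And>i. i < n \<Longrightarrow> c i \<in> carrier R" "\<And>i. i < n \<Longrightarrow> d i \<in> carrier R"
  shows "comb c \<oplus>\<^bsub>S\<^esub> comb d = comb (\<lambda>i. c i \<oplus> d i)"
proof -
  have "comb (\<lambda>i. c i \<oplus> d i) =
    (\<Oplus>\<^bsub>S\<^esub>i\<in>{..<n}. \<iota> (c i) \<otimes>\<^bsub>S\<^esub> \<xi> [^]\<^bsub>S\<^esub> i \<oplus>\<^bsub>S\<^esub> \<iota> (d i) \<otimes>\<^bsub>S\<^esub> \<xi> [^]\<^bsub>S\<^esub> i)"
    unfolding comb_def using assms by (intro S.finsum_cong') (auto simp: S.l_distr)
  also have "\<dots> = comb c \<oplus>\<^bsub>S\<^esub> comb d"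
    unfolding comb_def using assms by (intro S.finsum_addf) auto
  finally show ?thesis by simp
qed

lemma comb_smult:
  assumes "\<And>i. i < n \<Longrightarrow> c i \<in> carrier R" "r \<in> carrier R"
  shows "\<iota> r \<otimes>\<^bsub>S\<^esub> comb c = comb (\<lambda>i. r \<otimes> c i)"
proof -
  have "\<iota> r \<otimes>\<^bsub>S\<^esub> comb c = (\<Oplus>\<^bsub>S\<^esub>i\<in>{..<n}. \<iota> r \<otimes>\<^bsub>S\<^esub> (\<iota> (c i) \<otimes>\<^bsub>S\<^esub> \<xi> [^]\<^bsub>S\<^esub> i))"
    unfolding comb_def using assms by (intro S.finsum_rdistr) auto
  also have "\<dots> = comb (\<lambda>i. r \<otimes> c i)"
    unfolding comb_def using assms by (intro S.finsum_cong') (auto simp: S.m_assoc)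
  finally show ?thesis .
qed

lemma coords_add:
  assumes "s \<in> carrier S" "t \<in> carrier S" "i < n"
  shows "coords (s \<oplus>\<^bsub>S\<^esub> t) i = coords s i \<oplus> coords t i"
proof -
  have "s \<oplus>\<^bsub>S\<^esub> t = comb (coords s) \<oplus>\<^bsub>S\<^esub> comb (coords t)" using coords_comb(2) assms by simp
  also have "\<dots> = comb (\<lambda>i. coords s i \<oplus> coords t i)" using assms by (intro comb_add) auto
  finally show ?thesis using assms by (intro coords_eqI) auto
qed

lemma coords_smult:
  assumes "s \<in> carrier S" "r \<in> carrier R" "i < n"
  shows "coords (\<iota> r \<otimes>\<^bsub>S\<^esub> s) i = r \<otimes> coords s i"
proof -
  have "\<iota> r \<otimes>\<^bsub>S\<^esub> s = \<iota> r \<otimes>\<^bsub>S\<^esub> comb (coords s)" using coords_comb(2) assms by simp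
  also have "\<dots> = comb (\<lambda>i. r \<otimes> coords s i)" using assms by (intro comb_smult) auto
  finally show ?thesis using assms by (intro coords_eqI) auto
qed

lemma coords_monom:
  assumes "r \<in> carrier R" "m < n" "i < n"
  shows "coords (\<iota> r \<otimes>\<^bsub>S\<^esub> \<xi> [^]\<^bsub>S\<^esub> m) i = (if i = m then r else \<zero>)"
proof -
  have "comb (\<lambda>i. if i = m then r else \<zero>) =
    (\<Oplus>\<^bsub>S\<^esub>i\<in>{..<n}. if m = i then \<iota> r \<otimes>\<^bsub>S\<^esub> \<xi> [^]\<^bsub>S\<^esub> i else \<zero>\<^bsub>S\<^esub>)"
    unfolding comb_def using assms by (intro S.finsum_cong') auto
  also have "\<dots> = \<iota> r \<otimes>\<^bsub>S\<^esub> \<xi> [^]\<^bsub>S\<^esub> m"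
    using assms by (intro S.finsum_singleton) auto
  finally show ?thesis using assms by (intro coords_eqI) auto
qed

lemma coords_zero: "i < n \<Longrightarrow> coords \<zero>\<^bsub>S\<^esub> i = \<zero>"
  using coords_smult[of "\<zero>\<^bsub>S\<^esub>" \<zero> i] by simp

lemma coords_minus:
  assumes "s \<in> carrier S" "i < n"
  shows "coords (\<ominus>\<^bsub>S\<^esub> s) i = \<ominus> coords s i"
proof -
  have "\<ominus>\<^bsub>S\<^esub> s = \<iota> (\<ominus> \<one>) \<otimes>\<^bsub>S\<^esub> s" using assms by (simp add: S.l_minus)
  then show ?thesis using coords_smult[of s "\<ominus> \<one>" i] assms by (simp add: R.l_minus)
qed

text \<open>Reduces identities that are R-linear in \<open>s\<close> to multiples of the basis
  elements.\<close>

lemma span_induct [consumes 1, case_names zero add monom]: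
  assumes s: "s \<in> carrier S"
    and zero: "P \<zero>\<^bsub>S\<^esub>"
    and add: "\<And>x y. \<lbrakk>x \<in> carrier S; y \<in> carrier S; P x; P y\<rbrakk> \<Longrightarrow> P (x \<oplus>\<^bsub>S\<^esub> y)"
    and monom: "\<And>r i. \<lbrakk>r \<in> carrier R; i < n\<rbrakk> \<Longrightarrow> P (\<iota> r \<otimes>\<^bsub>S\<^esub> \<xi> [^]\<^bsub>S\<^esub> i)"
  shows "P s"
proof -
  let ?g = "\<lambda>i. \<iota> (coords s i) \<otimes>\<^bsub>S\<^esub> \<xi> [^]\<^bsub>S\<^esub> i"
  have "P (\<Oplus>\<^bsub>S\<^esub>i\<in>B. ?g i)" if "finite B" "B \<subseteq> {..<n}" for B
    using that
  proof (induction B rule: finite_induct)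
    case empty
    then show ?case using zero by simp
  next
    case (insert x B)
    have g: "?g i \<in> carrier S" if "i \<in> insert x B" for i using that insert.prems s by auto
    have "(\<Oplus>\<^bsub>S\<^esub>i\<in>insert x B. ?g i) = ?g x \<oplus>\<^bsub>S\<^esub> (\<Oplus>\<^bsub>S\<^esub>i\<in>B. ?g i)"
      using insert.hyps g by (intro S.finsum_insert) auto
    moreover have "(\<Oplus>\<^bsub>S\<^esub>i\<in>B. ?g i) \<in> carrier S" using g by (intro S.finsum_closed) auto
    ultimately show ?case using insert s by (auto intro!: add monom)
  qed
  then show ?thesis using coords_comb(2)[OF s] unfolding comb_def by (metis finite_lessThan order_refl)
qed

lemma coords_xi_pow_n: "i < n \<Longrightarrow> coords (\<xi> [^]\<^bsub>S\<^esub> n) i = \<ominus> a i"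
proof -
  assume i: "i < n"
  have "\<xi> [^]\<^bsub>S\<^esub> n \<oplus>\<^bsub>S\<^esub> comb a = \<zero>\<^bsub>S\<^esub>" using xi_pow_n by (simp add: comb_def)
  then have "\<xi> [^]\<^bsub>S\<^esub> n = \<ominus>\<^bsub>S\<^esub> comb a" by (intro S.minus_equality[symmetric]) auto
  then show ?thesis using i by (simp add: coords_minus coords_eqI[of a])
qed

text \<open>The companion matrix: coordinates shift up by one, and the top one is fed back through
  the relation for \<xi>^n.\<close>

lemma coords_xi_mult:
  assumes s: "s \<in> carrier S" and i: "i < n"
  shows "coords (\<xi> \<otimes>\<^bsub>S\<^esub> s) i = (if i = 0 then \<zero> else coords s (i - 1)) \<ominus> a i \<otimes> coords s (n - 1)"
  using s
proof (induction s rule: span_induct)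
  case zero
  then show ?case using i by (simp add: coords_zero a_minus_def)
next
  case (add x y)
  have "coords (\<xi> \<otimes>\<^bsub>S\<^esub> (x \<oplus>\<^bsub>S\<^esub> y)) i = coords (\<xi> \<otimes>\<^bsub>S\<^esub> x) i \<oplus> coords (\<xi> \<otimes>\<^bsub>S\<^esub> y) i"
    using add i by (simp add: S.r_distr coords_add)
  then show ?case using add i
    by (auto simp: coords_add a_minus_def R.r_distr R.minus_add R.a_ac)
next
  case (monom r m)
  have "\<xi> \<otimes>\<^bsub>S\<^esub> (\<iota> r \<otimes>\<^bsub>S\<^esub> \<xi> [^]\<^bsub>S\<^esub> m) = \<iota> r \<otimes>\<^bsub>S\<^esub> \<xi> [^]\<^bsub>S\<^esub> Suc m"
    using monom by (simp add: S.m_ac)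
  moreover have "coords (\<iota> r \<otimes>\<^bsub>S\<^esub> \<xi> [^]\<^bsub>S\<^esub> Suc m) i = (if Suc m < n then if i = Suc m then r else \<zero> else \<ominus> (r \<otimes> a i))"
  proof (cases "Suc m < n")
    case True
    then show ?thesis using monom i coords_monom[of r "Suc m" i] by simp
  next
    case False
    then have "Suc m = n" using monom by simp
    then show ?thesis using monom i coords_xi_pow_n[of i] coords_smult[of "\<xi> [^]\<^bsub>S\<^esub> n" r i]
      by (simp add: R.r_minus)
  qed
  ultimately show ?case using monom i n_pos
    by (auto simp: coords_monom a_minus_def R.m_comm)
qed

section \<open>The top coordinate and Euler's formula\<close>

definition tau :: "'c \<Rightarrow> 'a" where "tau s = coords s (n - 1)"

lemma tau_closed [simp]: "s \<in> carrier S \<Longrightarrow> tau s \<in> carrier R"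
  using n_pos by (simp add: tau_def)

lemma tau_add: "s \<in> carrier S \<Longrightarrow> t \<in> carrier S \<Longrightarrow> tau (s \<oplus>\<^bsub>S\<^esub> t) = tau s \<oplus> tau t"
  using n_pos by (simp add: tau_def coords_add)

lemma tau_smult: "s \<in> carrier S \<Longrightarrow> r \<in> carrier R \<Longrightarrow> tau (\<iota> r \<otimes>\<^bsub>S\<^esub> s) = r \<otimes> tau s"
  using n_pos by (simp add: tau_def coords_smult)

text \<open>The Horner partial evaluations of the defining polynomial at \<open>\<xi>\<close>: up to reversal
  they form the basis dual to the powers of \<open>\<xi>\<close> with respect to the pairing \<open>(x, y) \<mapsto> tau (x y)\<close>.\<close>

primrec horner :: "nat \<Rightarrow> 'c" where
  "horner 0 = \<one>\<^bsub>S\<^esub>"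
| "horner (Suc d) = \<xi> \<otimes>\<^bsub>S\<^esub> horner d \<oplus>\<^bsub>S\<^esub> \<iota> (a (n - 1 - d))"

text \<open>The formal derivative of the Horner recursion: constants drop out, and the product rule
  applied to X times the previous stage leaves two terms.\<close>

primrec dhorner :: "nat \<Rightarrow> 'c" where
  "dhorner 0 = \<zero>\<^bsub>S\<^esub>"
| "dhorner (Suc d) = horner d \<oplus>\<^bsub>S\<^esub> \<xi> \<otimes>\<^bsub>S\<^esub> dhorner d"

lemma horner_closed [simp]: "horner d \<in> carrier S"
  by (induction d) auto

lemma dhorner_closed [simp]: "dhorner d \<in> carrier S"
  by (induction d) auto

text \<open>The recursion unrolled. For d = n this is the sum that arises when the diagonal entries
  of the multiplication matrix are added.\<close>

lemma dhorner_sum: "dhorner d = (\<Oplus>\<^bsub>S\<^esub>i\<in>{..<d}. horner i \<otimes>\<^bsub>S\<^esub> \<xi> [^]\<^bsub>S\<^esub> (d - 1 - i))"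
proof (induction d)
  case 0
  then show ?case by simp
next
  case (Suc d)
  have "\<xi> \<otimes>\<^bsub>S\<^esub> dhorner d = (\<Oplus>\<^bsub>S\<^esub>i\<in>{..<d}. \<xi> \<otimes>\<^bsub>S\<^esub> (horner i \<otimes>\<^bsub>S\<^esub> \<xi> [^]\<^bsub>S\<^esub> (d - 1 - i)))"
    unfolding Suc.IH by (intro S.finsum_rdistr) auto
  also have "\<dots> = (\<Oplus>\<^bsub>S\<^esub>i\<in>{..<d}. horner i \<otimes>\<^bsub>S\<^esub> \<xi> [^]\<^bsub>S\<^esub> (d - i))"
  proof (intro S.finsum_cong')
    fix i assume "i \<in> {..<d}"
    then have "d - i = Suc (d - 1 - i)" by auto
    then show "\<xi> \<otimes>\<^bsub>S\<^esub> (horner i \<otimes>\<^bsub>S\<^esub> \<xi> [^]\<^bsub>S\<^esub> (d - 1 - i)) = horner i \<otimes>\<^bsub>S\<^esub> \<xi> [^]\<^bsub>S\<^esub> (d - i)"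
      by (simp add: S.m_ac)
  qed auto
  finally show ?case by (simp add: lessThan_Suc S.finsum_insert)
qed

text \<open>Induction along the companion matrix: the summand \<iota>(a_i) in the next Horner stage
  exactly cancels the feedback term of \<open>coords_xi_mult\<close>, so each stage reads off the
  next lower coordinate.\<close>

lemma coords_eq_tau_horner:
  assumes "d < n" and "s \<in> carrier S"
  shows "coords s (n - 1 - d) = tau (horner d \<otimes>\<^bsub>S\<^esub> s)"
  using assms
proof (induction d arbitrary: s)
  case 0
  then show ?case by (simp add: tau_def)
next
  case (Suc d)
  let ?i = "n - 1 - d"
  have i: "?i < n" "?i \<noteq> 0" "?i - 1 = n - 1 - Suc d" using Suc by auto
  have "horner (Suc d) \<otimes>\<^bsub>S\<^esub> s = horner d \<otimes>\<^bsub>S\<^esub> (\<xi> \<otimes>\<^bsub>S\<^esub> s) \<oplus>\<^bsub>S\<^esub> \<iota> (a ?i) \<otimes>\<^bsub>S\<^esub> s"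
    using Suc.prems by (simp add: S.l_distr S.r_distr S.m_ac)
  then have "tau (horner (Suc d) \<otimes>\<^bsub>S\<^esub> s) = coords (\<xi> \<otimes>\<^bsub>S\<^esub> s) ?i \<oplus> a ?i \<otimes> tau s"
    using Suc by (simp add: tau_add tau_smult)
  also have "\<dots> = coords s (?i - 1) \<ominus> a ?i \<otimes> tau s \<oplus> a ?i \<otimes> tau s"
    using coords_xi_mult[OF Suc.prems(2) i(1)] i by (simp add: tau_def)
  also have "\<dots> = coords s (?i - 1)"
    using Suc i by (simp add: a_minus_def R.a_assoc R.l_neg)
  finally show ?case using i by simp
qed

text \<open>The diagonal entry with index i is the top coordinate of
  \<open>horner (n - 1 - i)\<close> times \<xi>^i s. After reversing the order of summation the
  factors in front of s add up to \<open>dhorner n\<close>.\<close>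

lemma Tr_eq_tau:
  assumes s: "s \<in> carrier S"
  shows "Tr s = tau (dhorner n \<otimes>\<^bsub>S\<^esub> s)"
proof -
  let ?g = "\<lambda>i. tau (horner i \<otimes>\<^bsub>S\<^esub> \<xi> [^]\<^bsub>S\<^esub> (n - 1 - i) \<otimes>\<^bsub>S\<^esub> s)"
  have tau_sum: "tau (\<Oplus>\<^bsub>S\<^esub>i\<in>B. h i) = (\<Oplus>i\<in>B. tau (h i))"
    if "finite B" "\<And>i. i \<in> B \<Longrightarrow> h i \<in> carrier S" for B :: "nat set" and h
    using that
  proof (induction B rule: finite_induct)
    case empty
    then show ?case using n_pos by (simp add: tau_def coords_zero)
  next
    case (insert x B)
    then have "(\<Oplus>\<^bsub>S\<^esub>i\<in>insert x B. h i) = h x \<oplus>\<^bsub>S\<^esub> (\<Oplus>\<^bsub>S\<^esub>i\<in>B. h i)"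
      "(\<Oplus>i\<in>insert x B. tau (h i)) = tau (h x) \<oplus> (\<Oplus>i\<in>B. tau (h i))"
      by (auto intro!: S.finsum_insert R.finsum_insert)
    moreover have "(\<Oplus>\<^bsub>S\<^esub>i\<in>B. h i) \<in> carrier S" using insert by (intro S.finsum_closed) auto
    ultimately show ?case using insert by (simp add: tau_add)
  qed
  have "dhorner n \<otimes>\<^bsub>S\<^esub> s = (\<Oplus>\<^bsub>S\<^esub>i\<in>{..<n}. horner i \<otimes>\<^bsub>S\<^esub> \<xi> [^]\<^bsub>S\<^esub> (n - 1 - i) \<otimes>\<^bsub>S\<^esub> s)"
    unfolding dhorner_sum using s by (intro S.finsum_ldistr) auto
  then have "tau (dhorner n \<otimes>\<^bsub>S\<^esub> s) = (\<Oplus>i\<in>{..<n}. ?g i)"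
    using s by (simp add: tau_sum)
  also have "\<dots> = (\<Oplus>i\<in>(\<lambda>i. n - 1 - i) ` {..<n}. ?g i)"
  proof -
    have "(\<lambda>i. n - 1 - i) ` {..<n} = {..<n}"
    proof -
      have "i \<in> (\<lambda>i. n - 1 - i) ` {..<n}" if "i < n" for i
        using that by (intro image_eqI[of _ _ "n - 1 - i"]) auto
      then show ?thesis using n_pos by auto
    qed
    then show ?thesis by simp
  qed
  also have "\<dots> = (\<Oplus>i\<in>{..<n}. ?g (n - 1 - i))"
    using s by (intro R.finsum_reindex) (auto simp: inj_on_def)
  also have "\<dots> = Tr s"
    unfolding Tr_def
  proof (intro R.finsum_cong')
    fix i assume i: "i \<in> {..<n}"
    then have e: "n - 1 - (n - 1 - i) = i" by auto
    have "coords (s \<otimes>\<^bsub>S\<^esub> \<xi> [^]\<^bsub>S\<^esub> i) (n - 1 - (n - 1 - i)) =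
        tau (horner (n - 1 - i) \<otimes>\<^bsub>S\<^esub> (s \<otimes>\<^bsub>S\<^esub> \<xi> [^]\<^bsub>S\<^esub> i))"
      using i s by (intro coords_eq_tau_horner) auto
    then show "?g (n - 1 - i) = coords (s \<otimes>\<^bsub>S\<^esub> \<xi> [^]\<^bsub>S\<^esub> i) i"
      using s unfolding e by (simp add: S.m_ac)
  qed (use s in auto)
  finally show ?thesis ..
qed

lemma Tr_closed [simp]: "s \<in> carrier S \<Longrightarrow> Tr s \<in> carrier R"
  by (simp add: Tr_eq_tau)

lemma Tr_add: "s \<in> carrier S \<Longrightarrow> t \<in> carrier S \<Longrightarrow> Tr (s \<oplus>\<^bsub>S\<^esub> t) = Tr s \<oplus> Tr t"
  by (simp add: Tr_eq_tau S.r_distr tau_add)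

lemma Tr_smult: "s \<in> carrier S \<Longrightarrow> r \<in> carrier R \<Longrightarrow> Tr (\<iota> r \<otimes>\<^bsub>S\<^esub> s) = r \<otimes> Tr s"
  by (simp add: Tr_eq_tau S.m_lcomm tau_smult)

text \<open>A derivation modulo the ideal generated by \<open>dhorner n\<close>, which is the derivative of the
  defining polynomial at \<open>\<xi>\<close>; \<open>defect\<close> measures the deviation.\<close>

definition delta :: "'c \<Rightarrow> 'c"
  where "delta s = (\<Oplus>\<^bsub>S\<^esub>i\<in>{..<n}. \<iota> (coords s i) \<otimes>\<^bsub>S\<^esub> ([i] \<cdot>\<^bsub>S\<^esub> (\<xi> [^]\<^bsub>S\<^esub> (i - 1))))"

lemma delta_closed [simp]: "s \<in> carrier S \<Longrightarrow> delta s \<in> carrier S"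
  unfolding delta_def by (intro S.finsum_closed) auto

lemma delta_add:
  assumes "s \<in> carrier S" "t \<in> carrier S"
  shows "delta (s \<oplus>\<^bsub>S\<^esub> t) = delta s \<oplus>\<^bsub>S\<^esub> delta t"
proof -
  have "delta (s \<oplus>\<^bsub>S\<^esub> t) = (\<Oplus>\<^bsub>S\<^esub>i\<in>{..<n}. \<iota> (coords s i) \<otimes>\<^bsub>S\<^esub> ([i] \<cdot>\<^bsub>S\<^esub> (\<xi> [^]\<^bsub>S\<^esub> (i - 1)))
      \<oplus>\<^bsub>S\<^esub> \<iota> (coords t i) \<otimes>\<^bsub>S\<^esub> ([i] \<cdot>\<^bsub>S\<^esub> (\<xi> [^]\<^bsub>S\<^esub> (i - 1))))"
    unfolding delta_def using assms by (intro S.finsum_cong') (auto simp: coords_add S.l_distr)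
  then show ?thesis unfolding delta_def using assms by (subst (asm) S.finsum_addf) auto
qed

lemma delta_smult:
  assumes "s \<in> carrier S" "r \<in> carrier R"
  shows "delta (\<iota> r \<otimes>\<^bsub>S\<^esub> s) = \<iota> r \<otimes>\<^bsub>S\<^esub> delta s"
proof -
  have "delta (\<iota> r \<otimes>\<^bsub>S\<^esub> s) = (\<Oplus>\<^bsub>S\<^esub>i\<in>{..<n}. \<iota> r \<otimes>\<^bsub>S\<^esub> (\<iota> (coords s i) \<otimes>\<^bsub>S\<^esub> ([i] \<cdot>\<^bsub>S\<^esub> (\<xi> [^]\<^bsub>S\<^esub> (i - 1)))))"
    unfolding delta_def using assms by (intro S.finsum_cong') (auto simp: coords_smult S.m_assoc)
  then show ?thesis unfolding delta_def using assms by (subst S.finsum_rdistr) auto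
qed

lemma delta_xi_pow:
  assumes m: "m < n"
  shows "delta (\<xi> [^]\<^bsub>S\<^esub> m) = [m] \<cdot>\<^bsub>S\<^esub> (\<xi> [^]\<^bsub>S\<^esub> (m - 1))"
proof -
  have "delta (\<xi> [^]\<^bsub>S\<^esub> m) = (\<Oplus>\<^bsub>S\<^esub>i\<in>{..<n}. if m = i then [i] \<cdot>\<^bsub>S\<^esub> (\<xi> [^]\<^bsub>S\<^esub> (i - 1)) else \<zero>\<^bsub>S\<^esub>)"
    unfolding delta_def using coords_monom[of \<one> m] m by (intro S.finsum_cong') auto
  also have "\<dots> = [m] \<cdot>\<^bsub>S\<^esub> (\<xi> [^]\<^bsub>S\<^esub> (m - 1))"
    using m by (intro S.finsum_singleton) auto
  finally show ?thesis .
qed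

lemma delta_iota: "r \<in> carrier R \<Longrightarrow> delta (\<iota> r) = \<zero>\<^bsub>S\<^esub>"
  using delta_smult[of "\<one>\<^bsub>S\<^esub>" r] delta_xi_pow[of 0] n_pos by simp

section \<open>Failure of the product rule for \<open>delta\<close>\<close>

definition defect :: "'c \<Rightarrow> 'c"
  where "defect s = s \<oplus>\<^bsub>S\<^esub> \<xi> \<otimes>\<^bsub>S\<^esub> delta s \<ominus>\<^bsub>S\<^esub> delta (\<xi> \<otimes>\<^bsub>S\<^esub> s)"

lemma defect_closed [simp]: "s \<in> carrier S \<Longrightarrow> defect s \<in> carrier S"
  by (simp add: defect_def)

lemma delta_xi_mult:
  assumes "s \<in> carrier S" "defect s = \<zero>\<^bsub>S\<^esub>"
  shows "delta (\<xi> \<otimes>\<^bsub>S\<^esub> s) = s \<oplus>\<^bsub>S\<^esub> \<xi> \<otimes>\<^bsub>S\<^esub> delta s"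
  using assms unfolding defect_def by (metis S.m_closed S.a_closed S.r_right_minus_eq delta_closed xi_closed)

lemma defect_add:
  assumes "s \<in> carrier S" "t \<in> carrier S"
  shows "defect (s \<oplus>\<^bsub>S\<^esub> t) = defect s \<oplus>\<^bsub>S\<^esub> defect t"
  using assms by (simp add: defect_def delta_add S.r_distr a_minus_def S.minus_add S.a_ac)

lemma defect_smult:
  assumes "s \<in> carrier S" "r \<in> carrier R"
  shows "defect (\<iota> r \<otimes>\<^bsub>S\<^esub> s) = \<iota> r \<otimes>\<^bsub>S\<^esub> defect s"
proof -
  have "\<xi> \<otimes>\<^bsub>S\<^esub> (\<iota> r \<otimes>\<^bsub>S\<^esub> s) = \<iota> r \<otimes>\<^bsub>S\<^esub> (\<xi> \<otimes>\<^bsub>S\<^esub> s)" using assms by (simp add: S.m_lcomm)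
  then have "delta (\<xi> \<otimes>\<^bsub>S\<^esub> (\<iota> r \<otimes>\<^bsub>S\<^esub> s)) = \<iota> r \<otimes>\<^bsub>S\<^esub> delta (\<xi> \<otimes>\<^bsub>S\<^esub> s)"
    using assms by (simp add: delta_smult)
  then show ?thesis using assms
    by (simp add: defect_def delta_smult S.r_distr a_minus_def S.r_minus S.m_lcomm)
qed

lemma defect_xi_pow:
  assumes "Suc m < n"
  shows "defect (\<xi> [^]\<^bsub>S\<^esub> m) = \<zero>\<^bsub>S\<^esub>"
proof -
  have "\<xi> \<otimes>\<^bsub>S\<^esub> \<xi> [^]\<^bsub>S\<^esub> m = \<xi> [^]\<^bsub>S\<^esub> Suc m" by (simp add: S.m_comm)
  then have d: "delta (\<xi> \<otimes>\<^bsub>S\<^esub> \<xi> [^]\<^bsub>S\<^esub> m) = [Suc m] \<cdot>\<^bsub>S\<^esub> (\<xi> [^]\<^bsub>S\<^esub> m)"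
    using delta_xi_pow[OF assms] by simp
  have "\<xi> \<otimes>\<^bsub>S\<^esub> ([m] \<cdot>\<^bsub>S\<^esub> (\<xi> [^]\<^bsub>S\<^esub> (m - 1))) = [m] \<cdot>\<^bsub>S\<^esub> (\<xi> [^]\<^bsub>S\<^esub> m)"
    by (cases m) (simp_all add: S.add_pow_rdistr S.m_comm S.r_distr S.l_distr)
  then show ?thesis using d delta_xi_pow[of m] assms
    by (simp add: defect_def S.a_comm a_minus_def S.r_neg)
qed

text \<open>Both sides are R-linear, so powers of \<xi> suffice. The product rule is exact as long
  as multiplication by \<xi> does not wrap around, which happens only at the top power.\<close>

lemma defect_eq:
  assumes "s \<in> carrier S"
  shows "defect s = \<iota> (tau s) \<otimes>\<^bsub>S\<^esub> defect (\<xi> [^]\<^bsub>S\<^esub> (n - 1))"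
  using assms
proof (induction s rule: span_induct)
  case zero
  have "defect \<zero>\<^bsub>S\<^esub> = \<zero>\<^bsub>S\<^esub>" using defect_smult[of "\<zero>\<^bsub>S\<^esub>" \<zero>] by simp
  then show ?case using n_pos by (simp add: tau_def coords_zero)
next
  case (add x y)
  then show ?case by (simp add: defect_add tau_add S.l_distr)
next
  case (monom r i)
  show ?case
  proof (cases "Suc i < n")
    case True
    then have "tau (\<iota> r \<otimes>\<^bsub>S\<^esub> \<xi> [^]\<^bsub>S\<^esub> i) = \<zero>" using monom by (auto simp: tau_def coords_monom)
    then show ?thesis using monom True by (simp add: defect_smult defect_xi_pow)
  next
    case False
    then have "i = n - 1" using monom by simp
    moreover have "tau (\<iota> r \<otimes>\<^bsub>S\<^esub> \<xi> [^]\<^bsub>S\<^esub> (n - 1)) = r" using monom n_pos by (auto simp: tau_def coords_monom)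
    ultimately show ?thesis using monom by (simp add: defect_smult)
  qed
qed

text \<open>\<open>horner d\<close> is monic of degree d in \<xi>. In particular its top coordinate
  vanishes for d < n - 1, so \<open>delta\<close> differentiates the Horner stages without
  defect.\<close>

lemma coords_horner: "d < n \<Longrightarrow> i < n \<Longrightarrow> d \<le> i \<Longrightarrow> coords (horner d) i = (if i = d then \<one> else \<zero>)"
proof (induction d arbitrary: i)
  case 0
  then show ?case using coords_monom[of \<one> 0 i] by simp
next
  case (Suc d)
  have "coords (horner d) (n - 1) = \<zero>" using Suc by auto
  moreover have "coords (horner d) (i - 1) = (if i = Suc d then \<one> else \<zero>)" using Suc by auto
  moreover have "coords (\<iota> (a (n - 1 - d))) i = \<zero>" using coords_monom[of "a (n - 1 - d)" 0 i] Suc by simp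
  ultimately show ?case using Suc by (auto simp: coords_add coords_xi_mult a_minus_def)
qed

lemma delta_horner: "d < n \<Longrightarrow> delta (horner d) = dhorner d"
proof (induction d)
  case 0
  then show ?case using delta_iota[of \<one>] by simp
next
  case (Suc d)
  have "tau (horner d) = \<zero>" using Suc coords_horner[of d "n - 1"] by (auto simp: tau_def)
  then have "defect (horner d) = \<zero>\<^bsub>S\<^esub>" using defect_eq[of "horner d"] by simp
  then have "delta (\<xi> \<otimes>\<^bsub>S\<^esub> horner d) = horner d \<oplus>\<^bsub>S\<^esub> \<xi> \<otimes>\<^bsub>S\<^esub> dhorner d"
    using delta_xi_mult[of "horner d"] Suc by simp
  then show ?case by (simp add: delta_add delta_iota)
qed

lemma horner_n: "horner n = \<zero>\<^bsub>S\<^esub>"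
proof -
  \<comment> \<open>Stage d consists of the top d + 1 coefficients of the defining polynomial,
    divided by the common power; the last stage is its value at \<xi>.\<close>
  have "horner d = \<xi> [^]\<^bsub>S\<^esub> d \<oplus>\<^bsub>S\<^esub> (\<Oplus>\<^bsub>S\<^esub>i\<in>{..<d}. \<iota> (a (n - d + i)) \<otimes>\<^bsub>S\<^esub> \<xi> [^]\<^bsub>S\<^esub> i)" if "d \<le> n" for d
    using that
  proof (induction d)
    case 0
    then show ?case by simp
  next
    case (Suc d)
    let ?s = "(\<Oplus>\<^bsub>S\<^esub>i\<in>{..<d}. \<iota> (a (n - d + i)) \<otimes>\<^bsub>S\<^esub> \<xi> [^]\<^bsub>S\<^esub> i)"
    have sc: "?s \<in> carrier S" by (intro S.finsum_closed) auto
    have "\<xi> \<otimes>\<^bsub>S\<^esub> ?s = (\<Oplus>\<^bsub>S\<^esub>i\<in>{..<d}. \<xi> \<otimes>\<^bsub>S\<^esub> (\<iota> (a (n - d + i)) \<otimes>\<^bsub>S\<^esub> \<xi> [^]\<^bsub>S\<^esub> i))"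
      by (intro S.finsum_rdistr) auto
    also have "\<dots> = (\<Oplus>\<^bsub>S\<^esub>i\<in>{..<d}. \<iota> (a (n - Suc d + Suc i)) \<otimes>\<^bsub>S\<^esub> \<xi> [^]\<^bsub>S\<^esub> Suc i)"
      using Suc by (intro S.finsum_cong') (auto simp: S.m_ac Suc_diff_Suc)
    also have "\<dots> = (\<Oplus>\<^bsub>S\<^esub>i\<in>Suc ` {..<d}. \<iota> (a (n - Suc d + i)) \<otimes>\<^bsub>S\<^esub> \<xi> [^]\<^bsub>S\<^esub> i)"
      by (intro S.finsum_reindex[symmetric]) auto
    finally have "\<xi> \<otimes>\<^bsub>S\<^esub> ?s \<oplus>\<^bsub>S\<^esub> \<iota> (a (n - 1 - d)) =
      (\<Oplus>\<^bsub>S\<^esub>i\<in>insert 0 (Suc ` {..<d}). \<iota> (a (n - Suc d + i)) \<otimes>\<^bsub>S\<^esub> \<xi> [^]\<^bsub>S\<^esub> i)"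
      by (subst S.finsum_insert) (auto simp: S.a_comm S.finsum_closed)
    then have e: "\<xi> \<otimes>\<^bsub>S\<^esub> ?s \<oplus>\<^bsub>S\<^esub> \<iota> (a (n - 1 - d)) =
      (\<Oplus>\<^bsub>S\<^esub>i\<in>{..<Suc d}. \<iota> (a (n - Suc d + i)) \<otimes>\<^bsub>S\<^esub> \<xi> [^]\<^bsub>S\<^esub> i)"
      by (simp add: lessThan_Suc_eq_insert_0)
    have "horner (Suc d) = \<xi> \<otimes>\<^bsub>S\<^esub> \<xi> [^]\<^bsub>S\<^esub> d \<oplus>\<^bsub>S\<^esub> (\<xi> \<otimes>\<^bsub>S\<^esub> ?s \<oplus>\<^bsub>S\<^esub> \<iota> (a (n - 1 - d)))"
      using Suc sc by (simp add: S.r_distr S.a_assoc)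
    then show ?case unfolding e by (simp add: S.m_comm)
  qed
  from this[of n] show ?thesis using xi_pow_n by simp
qed

text \<open>The defect depends only on the top coordinate, so \<xi>^(n-1) may be replaced by
  \<open>horner (n - 1)\<close>. Multiplied by \<xi>, that element becomes the constant - a_0, whose
  \<open>delta\<close> is zero; the remaining terms form one step of the \<open>dhorner\<close>
  recursion.\<close>

lemma defect_top: "defect (\<xi> [^]\<^bsub>S\<^esub> (n - 1)) = dhorner n"
proof -
  define d where "d = n - 1"
  have d: "Suc d = n" "d < n" using n_pos by (auto simp: d_def)
  have "tau (horner d) = \<one>" using coords_horner[of d d] d unfolding tau_def d_def by simp
  then have "defect (\<xi> [^]\<^bsub>S\<^esub> (n - 1)) = defect (horner d)" using defect_eq[of "horner d"] by simp
  moreover have "\<xi> \<otimes>\<^bsub>S\<^esub> horner d \<oplus>\<^bsub>S\<^esub> \<iota> (a 0) = \<zero>\<^bsub>S\<^esub>"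
    using horner_n horner.simps(2)[of d] unfolding d(1) by (simp add: d_def)
  then have "\<xi> \<otimes>\<^bsub>S\<^esub> horner d = \<ominus>\<^bsub>S\<^esub> \<iota> (a 0)" by (intro S.minus_equality[symmetric]) auto
  then have "\<xi> \<otimes>\<^bsub>S\<^esub> horner d = \<iota> (\<ominus> a 0)" by simp
  then have "delta (\<xi> \<otimes>\<^bsub>S\<^esub> horner d) = \<zero>\<^bsub>S\<^esub>" using delta_iota[of "\<ominus> a 0"] by simp
  ultimately show ?thesis
    using delta_horner[OF d(2)] dhorner.simps(2)[of d] unfolding d(1) by (simp add: defect_def a_minus_def)
qed

end

section \<open>Extensions of chain rings and surjectivity of the trace\<close>

locale chain_extension = power_basis R S \<iota> \<xi> n a + RC: chain_ring R \<pi> l + SC: chain_ring S "\<iota> \<pi>" l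
  for R (structure) and S (structure) and \<iota> \<xi> n a \<pi> l
begin

text \<open>Otherwise \<open>delta\<close> would induce a derivation of the residue field of \<open>S\<close> sending the class
  of \<open>\<xi>\<close> to 1, which is absurd since \<open>\<xi>\<close> is fixed by a power of the Frobenius map.\<close>

lemma dhorner_Unit: "dhorner n \<in> Units S"
proof (rule ccontr)
  define K where "K = S Quot PIdl\<^bsub>S\<^esub> (\<iota> \<pi>)"
  define \<phi> where "\<phi> = (+>\<^bsub>S\<^esub>) (PIdl\<^bsub>S\<^esub> (\<iota> \<pi>))"
  interpret I: ideal "PIdl\<^bsub>S\<^esub> (\<iota> \<pi>)" S using S.cgenideal_ideal[OF SC.p_closed] .
  interpret \<phi>: ring_hom_cring S K \<phi>
    unfolding K_def \<phi>_def by (rule I.rcos_ring_hom_cring[OF S.is_cring])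
  have \<phi>0: "x \<in> carrier S \<Longrightarrow> \<phi> x = \<zero>\<^bsub>K\<^esub> \<longleftrightarrow> x \<in> PIdl\<^bsub>S\<^esub> (\<iota> \<pi>)" for x
    unfolding K_def \<phi>_def by (rule I.coset_eq_zero_iff)
  assume "dhorner n \<notin> Units S"
  then have D0: "\<phi> (dhorner n) = \<zero>\<^bsub>K\<^esub>" using SC.Units_eq \<phi>0 by auto
  have \<pi>0: "\<phi> (\<iota> \<pi>) = \<zero>\<^bsub>K\<^esub>" using \<phi>0[of "\<iota> \<pi>"] S.cgenideal_self by auto
  define d where "d s = \<phi> (delta s)" for s
  \<comment> \<open>Every defect is a multiple of \<open>dhorner n\<close>, which is now assumed to
    vanish in the residue ring; there the product rule is exact.\<close>
  have d_xi: "d (\<xi> \<otimes>\<^bsub>S\<^esub> s) = \<phi> s \<oplus>\<^bsub>K\<^esub> \<phi> \<xi> \<otimes>\<^bsub>K\<^esub> d s" if s: "s \<in> carrier S" for s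
  proof -
    have "\<phi> (defect s) = \<zero>\<^bsub>K\<^esub>"
      using defect_eq[OF s, unfolded defect_top] D0 s by simp
    then have "\<phi> s \<oplus>\<^bsub>K\<^esub> \<phi> \<xi> \<otimes>\<^bsub>K\<^esub> d s \<ominus>\<^bsub>K\<^esub> d (\<xi> \<otimes>\<^bsub>S\<^esub> s) = \<zero>\<^bsub>K\<^esub>"
      using s by (simp add: defect_def d_def a_minus_def)
    then show ?thesis using s by (simp add: d_def)
  qed
  have d_pow: "d (\<xi> [^]\<^bsub>S\<^esub> Suc m) = [Suc m] \<cdot>\<^bsub>K\<^esub> (\<phi> \<xi> [^]\<^bsub>K\<^esub> m)" for m
  proof (induction m)
    case 0
    have "d \<one>\<^bsub>S\<^esub> = \<zero>\<^bsub>K\<^esub>" using delta_iota[of \<one>] by (simp add: d_def)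
    then show ?case using d_xi[of "\<one>\<^bsub>S\<^esub>"] by simp
  next
    case (Suc m)
    have "\<xi> [^]\<^bsub>S\<^esub> Suc (Suc m) = \<xi> \<otimes>\<^bsub>S\<^esub> \<xi> [^]\<^bsub>S\<^esub> Suc m"
      by (metis S.nat_pow_Suc2 xi_closed)
    then have "d (\<xi> [^]\<^bsub>S\<^esub> Suc (Suc m)) = \<phi> \<xi> [^]\<^bsub>K\<^esub> Suc m \<oplus>\<^bsub>K\<^esub> \<phi> \<xi> \<otimes>\<^bsub>K\<^esub> ([Suc m] \<cdot>\<^bsub>K\<^esub> (\<phi> \<xi> [^]\<^bsub>K\<^esub> m))"
      using d_xi[of "\<xi> [^]\<^bsub>S\<^esub> Suc m"] Suc.IH by simp
    also have "\<phi> \<xi> \<otimes>\<^bsub>K\<^esub> ([Suc m] \<cdot>\<^bsub>K\<^esub> (\<phi> \<xi> [^]\<^bsub>K\<^esub> m)) = [Suc m] \<cdot>\<^bsub>K\<^esub> (\<phi> \<xi> [^]\<^bsub>K\<^esub> Suc m)"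
      by (subst \<phi>.S.add_pow_rdistr) (auto simp: \<phi>.S.m_comm)
    finally show ?case by (simp add: \<phi>.S.a_comm)
  qed
  have xiK: "\<phi> \<xi> \<in> carrier K" by simp
  \<comment> \<open>In the residue ring \<xi>^Q = \<xi>, so the two differ in S by a multiple of
    \<pi>, which \<open>d\<close> kills by linearity. Hence d(\<xi>^Q) = d(\<xi>) = 1, whereas the
    power rule gives Q times \<xi>^(Q-1), which is 0.\<close>
  define Q where "Q = card (carrier K)"
  have "\<phi> \<xi> [^]\<^bsub>K\<^esub> Q = \<phi> \<xi>"
    unfolding Q_def using SC.residue_pow_card(2) xiK K_def by blast
  then have "\<phi> (\<xi> [^]\<^bsub>S\<^esub> Q \<ominus>\<^bsub>S\<^esub> \<xi>) = \<zero>\<^bsub>K\<^esub>" by (simp add: a_minus_def \<phi>.S.r_neg)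
  then obtain t where t: "t \<in> carrier S" "\<xi> [^]\<^bsub>S\<^esub> Q \<ominus>\<^bsub>S\<^esub> \<xi> = t \<otimes>\<^bsub>S\<^esub> \<iota> \<pi>"
    using \<phi>0[of "\<xi> [^]\<^bsub>S\<^esub> Q \<ominus>\<^bsub>S\<^esub> \<xi>"] by (auto simp: S.cgenideal_mem_iff)
  have "\<xi> [^]\<^bsub>S\<^esub> Q = (\<xi> [^]\<^bsub>S\<^esub> Q \<ominus>\<^bsub>S\<^esub> \<xi>) \<oplus>\<^bsub>S\<^esub> \<xi>"
    by (simp add: a_minus_def S.a_assoc S.l_neg)
  then have "d (\<xi> [^]\<^bsub>S\<^esub> Q) = d (\<iota> \<pi> \<otimes>\<^bsub>S\<^esub> t \<oplus>\<^bsub>S\<^esub> \<xi>)" using t by (simp add: S.m_comm)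
  also have "\<dots> = d \<xi>" using t \<pi>0 by (simp add: d_def delta_add delta_smult)
  also have "\<dots> = \<one>\<^bsub>K\<^esub>" using d_pow[of 0] by simp
  finally have dQ: "d (\<xi> [^]\<^bsub>S\<^esub> Q) = \<one>\<^bsub>K\<^esub>" .
  have one: "\<one>\<^bsub>K\<^esub> \<noteq> \<zero>\<^bsub>K\<^esub>" using \<phi>0[of "\<one>\<^bsub>S\<^esub>"] SC.Units_eq S.Units_one_closed by auto
  have "d \<one>\<^bsub>S\<^esub> = \<zero>\<^bsub>K\<^esub>" using delta_iota[of \<one>] by (simp add: d_def)
  then have "Q \<noteq> 0" using dQ one by (metis S.nat_pow_0)
  then obtain m where m: "Q = Suc m" using not0_implies_Suc by blast
  have "d (\<xi> [^]\<^bsub>S\<^esub> Q) = [Q] \<cdot>\<^bsub>K\<^esub> (\<phi> \<xi> [^]\<^bsub>K\<^esub> m)" using d_pow[of m] m by simp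
  also have "\<dots> = \<zero>\<^bsub>K\<^esub>"
    unfolding Q_def by (rule SC.residue_pow_card(1)[folded K_def]) simp
  finally show False using dQ one by simp
qed

lemma Tr_surj:
  assumes r: "r \<in> carrier R"
  shows "\<exists>s\<in>carrier S. Tr s = r"
proof -
  \<comment> \<open>By Euler's formula it suffices that \<open>dhorner n\<close> times the witness
    has top coordinate r; the element r \<xi>^(n-1) has it.\<close>
  let ?s = "inv\<^bsub>S\<^esub> (dhorner n) \<otimes>\<^bsub>S\<^esub> (\<iota> r \<otimes>\<^bsub>S\<^esub> \<xi> [^]\<^bsub>S\<^esub> (n - 1))"
  have "dhorner n \<otimes>\<^bsub>S\<^esub> ?s = (dhorner n \<otimes>\<^bsub>S\<^esub> inv\<^bsub>S\<^esub> (dhorner n)) \<otimes>\<^bsub>S\<^esub> (\<iota> r \<otimes>\<^bsub>S\<^esub> \<xi> [^]\<^bsub>S\<^esub> (n - 1))"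
    using r dhorner_Unit by (subst S.m_assoc) auto
  also have "\<dots> = \<iota> r \<otimes>\<^bsub>S\<^esub> \<xi> [^]\<^bsub>S\<^esub> (n - 1)"
    using r dhorner_Unit by (subst S.Units_r_inv) auto
  finally have "dhorner n \<otimes>\<^bsub>S\<^esub> ?s = \<iota> r \<otimes>\<^bsub>S\<^esub> \<xi> [^]\<^bsub>S\<^esub> (n - 1)" .
  then have "Tr ?s = r" using r dhorner_Unit n_pos by (simp add: Tr_eq_tau tau_def coords_monom)
  then show ?thesis using r dhorner_Unit by (intro bexI[of _ ?s]) auto
qed

lemma card_S: "card (carrier S) = card (carrier R) ^ n"
proof -
  have "bij_betw coords (carrier S) ({..<n} \<rightarrow>\<^sub>E carrier R)"
  proof (rule bij_betwI[where g = comb])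
    show "coords \<in> carrier S \<rightarrow> ({..<n} \<rightarrow>\<^sub>E carrier R)" using coords_comb(1) by blast
    show "comb \<in> ({..<n} \<rightarrow>\<^sub>E carrier R) \<rightarrow> carrier S" by (auto intro!: comb_closed)
    show "comb (coords s) = s" if "s \<in> carrier S" for s using coords_comb(2)[OF that] by simp
    show "coords (comb c) = c" if c: "c \<in> {..<n} \<rightarrow>\<^sub>E carrier R" for c
    proof (rule PiE_ext)
      have "comb c \<in> carrier S" using c by (auto intro!: comb_closed)
      then show "coords (comb c) \<in> {..<n} \<rightarrow>\<^sub>E carrier R" by (rule coords_comb(1))
      show "coords (comb c) i = c i" if "i \<in> {..<n}" for i
        using c that by (intro coords_eqI) auto
    qed (rule c)
  qed
  then have "card (carrier S) = card ({..<n} \<rightarrow>\<^sub>E carrier R)" by (rule bij_betw_same_card)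
  then show ?thesis by (simp add: card_PiE)
qed

end

section \<open>Eisenstein sums\<close>

text \<open>The induction step of the weighted sum of trace counts, with x = q, y = q^(n-1) and l =
  j + b + 1. Splitting all powers into independent factors leaves a polynomial identity.\<close>

lemma telescope_power:
  fixes x y :: real
  shows "(x - 1) * x ^ j * (y ^ (j + Suc b) - y ^ (j + b)) * (x * y) ^ Suc b
    = (x - 1) * (x * y) ^ (j + Suc b) * y ^ Suc b - (x - 1) * (x * y) ^ (j + Suc b) * y ^ b"
proof -
  have "(x - 1) * X * (Y * (y * Z) - Y * Z) * (x * y * (W * Z)) =
      (x - 1) * (X * Y * (x * y * (W * Z))) * (y * Z) - (x - 1) * (X * Y * (x * y * (W * Z))) * Z" for X Y Z W :: real
    by (simp add: left_diff_distrib right_diff_distrib mult_ac)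
  then show ?thesis unfolding power_mult_distrib power_add power_Suc .
qed

text \<open>\<open>chi_k\<close> and \<open>chi_less_k\<close> together express that the valuation
  is k without a least element; the latter at level 0 also contains non-triviality.\<close>

locale eisenstein = chain_extension R S \<iota> \<xi> n a \<pi> l
  for R (structure) and S (structure) and \<iota> \<xi> n a \<pi> l +
  fixes chi :: "'c \<Rightarrow> complex" and k q :: nat
  assumes chi_hom: "chi \<in> mult_characters S"
    and k_pos: "1 \<le> k"
    and chi_k: "\<And>u. u \<in> principal_units S (\<iota> \<pi>) k \<Longrightarrow> chi u = 1"
    and chi_less_k: "\<And>i. i < k \<Longrightarrow> \<exists>u \<in> principal_units S (\<iota> \<pi>) i. chi u \<noteq> 1"
    and q_def: "q = card (carrier (R Quot PIdl \<pi>))"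
begin

section \<open>Sizes of the ideals and values of the character\<close>

lemma q_pos: "0 < q"
proof -
  have "card (RC.Ip (l - 1)) \<noteq> 0" using RC.Ip_finite RC.zero_in_Ip[of "l - 1"] by (auto simp: card_eq_0_iff)
  then show ?thesis using q_def RC.residue_card by simp
qed

lemma q_gt_1: "1 < q"
proof (rule ccontr)
  assume "\<not> 1 < q"
  then have "q = 1" using q_pos by simp
  then have "card (carrier R) = 1" using RC.card_carrier RC.residue_card q_def by simp
  then show False using RC.one_not_zero by (metis R.one_closed R.zero_closed card_1_singletonE singletonD)
qed

lemma card_RIp: "i \<le> l \<Longrightarrow> card (RC.Ip i) = q ^ (l - i)"
  unfolding q_def RC.residue_card by (rule RC.card_Ip)

text \<open>|S| = |R|^n, and both sides are l-th powers of residue sizes; taking l-th roots shows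
  that the residue size of S is q^n.\<close>

lemma card_SIp: "i \<le> l \<Longrightarrow> card (SC.Ip i) = (q ^ n) ^ (l - i)"
proof -
  assume i: "i \<le> l"
  have "card (SC.Ip (l - 1)) ^ l = (q ^ n) ^ l"
    using card_S SC.card_carrier RC.card_carrier RC.residue_card q_def
    by (simp add: power_mult[symmetric] mult.commute)
  then have "card (SC.Ip (l - 1)) = q ^ n" using RC.m_pos by (simp add: power_eq_iff_eq_base)
  then show ?thesis using SC.card_Ip[OF i] by simp
qed

text \<open>At level l the only principal unit is 1, so chi cannot be non-trivial there.\<close>

lemma k_le_l: "k \<le> l"
proof (rule ccontr)
  assume "\<not> k \<le> l"
  then obtain u where u: "u \<in> principal_units S (\<iota> \<pi>) l" "chi u \<noteq> 1" using chi_less_k[of l] by auto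
  have "u \<in> principal_units S (\<iota> \<pi>) k"
    using u(1) by (elim SC.principal_unitsE) (auto simp: SC.principal_units_eq SC.Ip_m SC.zero_in_Ip a_minus_def S.r_neg)
  then show False using chi_k u by blast
qed

lemma finite_Units: "finite (Units S)" "finite (Units R)"
  using SC.finite_carrier RC.finite_carrier by (auto simp: Units_def)

lemma chi_mult: "x \<in> Units S \<Longrightarrow> y \<in> Units S \<Longrightarrow> chi (x \<otimes>\<^bsub>S\<^esub> y) = chi x * chi y"
  using chi_hom unfolding mult_characters_def hom_def
  by (auto simp: units_of_def complex_units_def)

lemma chi_nonzero: "x \<in> Units S \<Longrightarrow> chi x \<noteq> 0"
  using chi_hom unfolding mult_characters_def hom_def
  by (auto simp: units_of_def complex_units_def)

lemma chi_one: "chi \<one>\<^bsub>S\<^esub> = 1"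
  using chi_mult[of "\<one>\<^bsub>S\<^esub>" "\<one>\<^bsub>S\<^esub>"] chi_nonzero[of "\<one>\<^bsub>S\<^esub>"] by simp

lemma chi_pow: "x \<in> Units S \<Longrightarrow> chi (x [^]\<^bsub>S\<^esub> (i::nat)) = chi x ^ i"
proof (induction i)
  case (Suc i)
  then show ?case using chi_mult[of "x [^]\<^bsub>S\<^esub> i" x] S.Units_pow_closed by simp
qed (simp add: chi_one)

lemma cmod_chi:
  assumes x: "x \<in> Units S"
  shows "cmod (chi x) = 1"
proof -
  have "x [^]\<^bsub>S\<^esub> card (Units S) = \<one>\<^bsub>S\<^esub>"
    using group.pow_order_eq_1[OF S.units_group, of x] x
    by (simp add: order_def units_of_carrier units_of_one S.units_of_pow)
  then have "chi x ^ card (Units S) = 1" using chi_pow[OF x, of "card (Units S)"] chi_one by simp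
  moreover have "0 < card (Units S)" using finite_Units x by (auto simp: card_gt_0_iff)
  ultimately show ?thesis by (metis norm_one norm_power power_eq_1_iff norm_ge_zero less_numeral_extra(3))
qed

lemma sum_shift:
  assumes T: "T \<subseteq> Units S" and u: "u \<in> Units S"
    and bij: "bij_betw (\<lambda>y. u \<otimes>\<^bsub>S\<^esub> y) T T'"
  shows "(\<Sum>y\<in>T'. chi y) = chi u * (\<Sum>y\<in>T. chi y)"
proof -
  have "(\<Sum>y\<in>T'. chi y) = (\<Sum>y\<in>T. chi (u \<otimes>\<^bsub>S\<^esub> y))"
    by (rule sum.reindex_bij_betw[OF bij, symmetric])
  also have "\<dots> = (\<Sum>y\<in>T. chi u * chi y)" using T u chi_mult by (intro sum.cong) auto
  finally show ?thesis by (simp add: sum_distrib_left)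
qed

lemma inj_on_Unit_mult: "u \<in> Units S \<Longrightarrow> T \<subseteq> carrier S \<Longrightarrow> inj_on (\<lambda>y. u \<otimes>\<^bsub>S\<^esub> y) T"
  by (intro inj_onI) (metis S.Units_l_cancel subsetD)

text \<open>Multiplication by u permutes the finite set T, so the sum equals \<open>chi u\<close>
  times itself.\<close>

lemma sum_invariant_zero:
  assumes T: "T \<subseteq> Units S" and u: "u \<in> Units S" "chi u \<noteq> 1"
    and inv: "\<And>y. y \<in> T \<Longrightarrow> u \<otimes>\<^bsub>S\<^esub> y \<in> T"
  shows "(\<Sum>y\<in>T. chi y) = 0"
proof -
  have fin: "finite T" using T finite_Units finite_subset by blast
  have inj: "inj_on (\<lambda>y. u \<otimes>\<^bsub>S\<^esub> y) T"
    using inj_on_Unit_mult[OF u(1)] T S.Units_closed by blast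
  have "bij_betw (\<lambda>y. u \<otimes>\<^bsub>S\<^esub> y) T T"
    unfolding bij_betw_def using inj inv endo_inj_surj[OF fin _ inj] by blast
  then have "(\<Sum>y\<in>T. chi y) = chi u * (\<Sum>y\<in>T. chi y)" using sum_shift T u by blast
  then show ?thesis using u by simp
qed

lemma iota_Unit:
  assumes r: "r \<in> Units R" shows "\<iota> r \<in> Units S"
proof -
  have "\<iota> r \<otimes>\<^bsub>S\<^esub> \<iota> (inv r) = \<one>\<^bsub>S\<^esub>" "\<iota> (inv r) \<otimes>\<^bsub>S\<^esub> \<iota> r = \<one>\<^bsub>S\<^esub>"
    using r by (simp_all add: R.Units_closed flip: hom_mult)
  then show ?thesis using r unfolding Units_def[of S] by (auto simp: R.Units_closed)
qed

lemma iota_Ip: "x \<in> RC.Ip i \<Longrightarrow> \<iota> x \<in> SC.Ip i"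
  by (elim RC.Ip_memE) (auto intro!: SC.Ip_mem)

lemma iota_principal_units: "u \<in> principal_units R \<pi> i \<Longrightarrow> \<iota> u \<in> principal_units S (\<iota> \<pi>) i"
proof -
  assume "u \<in> principal_units R \<pi> i"
  then have u: "u \<in> Units R" "u \<ominus> \<one> \<in> RC.Ip i" by (auto simp: RC.principal_units_eq)
  have "\<iota> (u \<ominus> \<one>) = \<iota> u \<ominus>\<^bsub>S\<^esub> \<one>\<^bsub>S\<^esub>" using u by (simp add: a_minus_def R.Units_closed)
  then show ?thesis using iota_Ip[OF u(2)] iota_Unit[OF u(1)] by (simp add: SC.principal_units_eq)
qed

lemma Tr_Ip: "x \<in> SC.Ip i \<Longrightarrow> Tr x \<in> RC.Ip i"
proof -
  assume "x \<in> SC.Ip i"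
  then obtain y where y: "y \<in> carrier S" "x = \<iota> \<pi> [^]\<^bsub>S\<^esub> i \<otimes>\<^bsub>S\<^esub> y" by (elim SC.Ip_memE)
  have "x = \<iota> (\<pi> [^] i) \<otimes>\<^bsub>S\<^esub> y" using y by simp
  then have "Tr x = \<pi> [^] i \<otimes> Tr y" using y Tr_smult[of y "\<pi> [^] i"] by simp
  then show ?thesis using RC.Ip_mem y by simp
qed

lemma Tr_Ip_surj: "r \<in> RC.Ip i \<Longrightarrow> \<exists>x\<in>SC.Ip i. Tr x = r"
proof -
  assume "r \<in> RC.Ip i"
  then obtain c where c: "c \<in> carrier R" "r = \<pi> [^] i \<otimes> c" by (elim RC.Ip_memE)
  obtain s where s: "s \<in> carrier S" "Tr s = c" using Tr_surj c by blast
  have "Tr (\<iota> (\<pi> [^] i) \<otimes>\<^bsub>S\<^esub> s) = r" using s c Tr_smult[of s "\<pi> [^] i"] by simp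
  moreover have "\<iota> (\<pi> [^] i) \<otimes>\<^bsub>S\<^esub> s \<in> SC.Ip i" using s SC.Ip_mem by simp
  ultimately show ?thesis by blast
qed

section \<open>Relations between the values of E\<close>

definition E :: "'a \<Rightarrow> complex"
  where "E c = (\<Sum>y \<in> {y \<in> Units S. Tr y = c}. chi y)"

lemma E_mult_Unit:
  assumes r: "r \<in> Units R" and c: "c \<in> carrier R"
  shows "E (r \<otimes> c) = chi (\<iota> r) * E c"
proof -
  have ri: "\<iota> r \<in> Units S" "inv r \<in> Units R" "\<iota> (inv r) \<in> Units S" using r iota_Unit by auto
  have cancel: "\<iota> (inv r) \<otimes>\<^bsub>S\<^esub> (\<iota> r \<otimes>\<^bsub>S\<^esub> y) = y" "\<iota> r \<otimes>\<^bsub>S\<^esub> (\<iota> (inv r) \<otimes>\<^bsub>S\<^esub> y) = y" if "y \<in> carrier S" for y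
    using that r by (simp_all add: S.m_assoc[symmetric] R.Units_closed flip: hom_mult)
  have "bij_betw (\<lambda>y. \<iota> r \<otimes>\<^bsub>S\<^esub> y) {y \<in> Units S. Tr y = c} {y \<in> Units S. Tr y = r \<otimes> c}"
  proof (rule bij_betwI[where g = "\<lambda>y. \<iota> (inv r) \<otimes>\<^bsub>S\<^esub> y"])
    show "(\<lambda>y. \<iota> r \<otimes>\<^bsub>S\<^esub> y) \<in> {y \<in> Units S. Tr y = c} \<rightarrow> {y \<in> Units S. Tr y = r \<otimes> c}"
      using ri r by (auto simp: Tr_smult R.Units_closed S.Units_closed)
    show "(\<lambda>y. \<iota> (inv r) \<otimes>\<^bsub>S\<^esub> y) \<in> {y \<in> Units S. Tr y = r \<otimes> c} \<rightarrow> {y \<in> Units S. Tr y = c}"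
      using ri r c by (auto simp: Tr_smult R.Units_closed S.Units_closed R.m_assoc[symmetric])
  qed (auto simp: cancel S.Units_closed)
  then show ?thesis unfolding E_def by (intro sum_shift) (use ri in auto)
qed

text \<open>Surjectivity of the trace provides x in (\<pi>^k) with trace d. Adding x to a unit y is
  multiplication by 1 + x y^(-1), on which chi is 1.\<close>

lemma E_add_Ip:
  assumes c: "c \<in> carrier R" and d: "d \<in> RC.Ip k"
  shows "E (c \<oplus> d) = E c"
proof -
  obtain x where x: "x \<in> SC.Ip k" "Tr x = d" using Tr_Ip_surj[OF d] by blast
  have xc: "x \<in> carrier S" "\<ominus>\<^bsub>S\<^esub> x \<in> carrier S" using x SC.Ip_closed by auto
  have dc: "d \<in> carrier R" using d RC.Ip_closed by blast
  have "Tr x \<oplus> Tr (\<ominus>\<^bsub>S\<^esub> x) = \<zero>" using xc Tr_add[of x "\<ominus>\<^bsub>S\<^esub> x"] Tr_smult[of "\<zero>\<^bsub>S\<^esub>" \<zero>] by (simp add: S.r_neg)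
  then have trm: "d \<oplus> Tr (\<ominus>\<^bsub>S\<^esub> x) = \<zero>" using x by simp
  have bij: "bij_betw (\<lambda>y. y \<oplus>\<^bsub>S\<^esub> x) {y \<in> Units S. Tr y = c} {y \<in> Units S. Tr y = c \<oplus> d}"
  proof (rule bij_betwI[where g = "\<lambda>y. y \<oplus>\<^bsub>S\<^esub> \<ominus>\<^bsub>S\<^esub> x"])
    show "(\<lambda>y. y \<oplus>\<^bsub>S\<^esub> x) \<in> {y \<in> Units S. Tr y = c} \<rightarrow> {y \<in> Units S. Tr y = c \<oplus> d}"
      using x xc k_pos SC.Unit_add_Ip by (auto simp: Tr_add S.Units_closed)
    show "(\<lambda>y. y \<oplus>\<^bsub>S\<^esub> \<ominus>\<^bsub>S\<^esub> x) \<in> {y \<in> Units S. Tr y = c \<oplus> d} \<rightarrow> {y \<in> Units S. Tr y = c}"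
      using x xc k_pos SC.Unit_add_Ip[OF _ SC.Ip_minus[OF x(1)]] c dc trm
      by (auto simp: Tr_add S.Units_closed R.a_assoc)
  qed (use xc in \<open>auto simp: S.a_assoc S.r_neg S.l_neg S.Units_closed\<close>)
  have "E (c \<oplus> d) = (\<Sum>y \<in> {y \<in> Units S. Tr y = c}. chi (y \<oplus>\<^bsub>S\<^esub> x))"
    unfolding E_def by (rule sum.reindex_bij_betw[OF bij, symmetric])
  also have "\<dots> = E c"
    unfolding E_def
  proof (intro sum.cong refl)
    fix y assume "y \<in> {y \<in> Units S. Tr y = c}"
    then have y: "y \<in> Units S" by blast
    have w: "\<one>\<^bsub>S\<^esub> \<oplus>\<^bsub>S\<^esub> x \<otimes>\<^bsub>S\<^esub> inv\<^bsub>S\<^esub> y \<in> principal_units S (\<iota> \<pi>) k"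
      using y x k_pos by (intro SC.principal_unitsI SC.Ip_mult) auto
    have "y \<otimes>\<^bsub>S\<^esub> (\<one>\<^bsub>S\<^esub> \<oplus>\<^bsub>S\<^esub> x \<otimes>\<^bsub>S\<^esub> inv\<^bsub>S\<^esub> y) = y \<oplus>\<^bsub>S\<^esub> x \<otimes>\<^bsub>S\<^esub> (y \<otimes>\<^bsub>S\<^esub> inv\<^bsub>S\<^esub> y)"
      using y xc by (simp add: S.r_distr S.Units_closed S.m_lcomm del: S.Units_r_inv)
    then have "y \<oplus>\<^bsub>S\<^esub> x = y \<otimes>\<^bsub>S\<^esub> (\<one>\<^bsub>S\<^esub> \<oplus>\<^bsub>S\<^esub> x \<otimes>\<^bsub>S\<^esub> inv\<^bsub>S\<^esub> y)"
      using y xc by simp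
    then show "chi (y \<oplus>\<^bsub>S\<^esub> x) = chi y"
      using chi_mult[OF y] w chi_k[OF w] by (auto simp: SC.principal_units_eq)
  qed
  finally show ?thesis .
qed

lemma sum_E: "J \<subseteq> carrier R \<Longrightarrow> (\<Sum>c\<in>J. E c) = (\<Sum>y \<in> {y \<in> Units S. Tr y \<in> J}. chi y)"
proof -
  assume J: "J \<subseteq> carrier R"
  have fin: "finite J" using J RC.finite_carrier finite_subset by blast
  have "{y \<in> Units S. Tr y \<in> J} = (\<Union>c\<in>J. {y \<in> Units S. Tr y = c})" by auto
  then show ?thesis unfolding E_def using fin finite_Units
    by (simp only:) (subst sum.UNION_disjoint; auto)
qed

lemma sum_E_coset:
  assumes c: "c \<in> carrier R" and i: "i < k"
  shows "(\<Sum>d\<in>RC.Ip i. E (c \<oplus> d)) = 0"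
proof -
  have inj: "inj_on (\<lambda>d. c \<oplus> d) (RC.Ip i)"
    using c RC.Ip_closed by (intro inj_onI) (metis R.add.l_cancel)
  let ?J = "(\<lambda>d. c \<oplus> d) ` RC.Ip i"
  have "?J \<subseteq> carrier R" using c RC.Ip_closed by auto
  then have "(\<Sum>d\<in>RC.Ip i. E (c \<oplus> d)) = (\<Sum>y \<in> {y \<in> Units S. Tr y \<in> ?J}. chi y)"
    by (subst sum_E[symmetric]) (simp_all add: sum.reindex[OF inj])
  also have "\<dots> = 0"
  proof -
    \<comment> \<open>Multiplication by u = 1 + x with x in (\<pi>^i) changes the trace of y by Tr
      (x y), an element of (\<pi>^i); the coset is preserved.\<close>
    obtain u where u: "u \<in> principal_units S (\<iota> \<pi>) i" "chi u \<noteq> 1" using chi_less_k[OF i] by blast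
    obtain x where x: "u \<in> Units S" "x \<in> SC.Ip i" "u = \<one>\<^bsub>S\<^esub> \<oplus>\<^bsub>S\<^esub> x" using u by (elim SC.principal_unitsE)
    have xc: "x \<in> carrier S" using x SC.Ip_closed by blast
    have "u \<otimes>\<^bsub>S\<^esub> y \<in> {y \<in> Units S. Tr y \<in> ?J}" if y: "y \<in> {y \<in> Units S. Tr y \<in> ?J}" for y
    proof -
      obtain d where d: "d \<in> RC.Ip i" "Tr y = c \<oplus> d" using y by blast
      have yu: "y \<in> Units S" using y by blast
      have "u \<otimes>\<^bsub>S\<^esub> y = y \<oplus>\<^bsub>S\<^esub> x \<otimes>\<^bsub>S\<^esub> y" using x xc yu by (simp add: S.l_distr S.Units_closed)
      then have "Tr (u \<otimes>\<^bsub>S\<^esub> y) = c \<oplus> (d \<oplus> Tr (x \<otimes>\<^bsub>S\<^esub> y))"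
        using d c RC.Ip_closed[OF d(1)] xc yu by (simp add: Tr_add S.Units_closed R.a_assoc)
      moreover have "d \<oplus> Tr (x \<otimes>\<^bsub>S\<^esub> y) \<in> RC.Ip i"
        using d x yu by (intro RC.Ip_add Tr_Ip SC.Ip_mult) (auto simp: S.Units_closed)
      ultimately show ?thesis using x yu by auto
    qed
    then show ?thesis by (intro sum_invariant_zero[OF _ x(1) u(2)]) blast+
  qed
  finally show ?thesis .
qed

lemma sum_E_Ip: "i < k \<Longrightarrow> (\<Sum>d\<in>RC.Ip i. E d) = 0"
proof -
  assume "i < k"
  then have "(\<Sum>d\<in>RC.Ip i. E (\<zero> \<oplus> d)) = 0" by (rule sum_E_coset[OF R.zero_closed])
  moreover have "(\<Sum>d\<in>RC.Ip i. E (\<zero> \<oplus> d)) = (\<Sum>d\<in>RC.Ip i. E d)"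
    by (intro sum.cong refl) (simp add: RC.Ip_closed)
  ultimately show ?thesis by simp
qed

section \<open>Counting units by the valuation of their trace\<close>

lemma card_Units_R: "q * card (Units R) = (q - 1) * q ^ l"
proof -
  have "Units R = carrier R - RC.Ip 1" using RC.Units_eq RC.Ip_1 by simp
  then have "card (Units R) = q ^ l - q ^ (l - 1)"
    using card_RIp[of 0] card_RIp[of 1] RC.m_pos RC.Ip_finite RC.Ip_closed
    by (simp add: card_Diff_subset RC.Ip_0 subset_iff)
  moreover have "q ^ l = q * q ^ (l - 1)" using RC.m_pos by (simp add: power_eq_if)
  ultimately show ?thesis by (simp add: diff_mult_distrib diff_mult_distrib2)
qed

text \<open>The ideal is the annihilator of \<pi>^j, so this counts the units y with \<pi>^j Tr y =
  0.\<close>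

definition N :: "nat \<Rightarrow> nat" where "N j = card {y \<in> Units S. Tr y \<in> RC.Ip (l - j)}"

lemma card_Units_Tr_Ip:
  "N j + card {y \<in> SC.Ip 1. Tr y \<in> RC.Ip (l - j)} = card {y \<in> carrier S. Tr y \<in> RC.Ip (l - j)}"
proof -
  have "{y \<in> carrier S. Tr y \<in> RC.Ip (l - j)} =
      {y \<in> Units S. Tr y \<in> RC.Ip (l - j)} \<union> {y \<in> SC.Ip 1. Tr y \<in> RC.Ip (l - j)}"
    using SC.Units_eq SC.Ip_closed[of _ 1] SC.Ip_1 by auto
  moreover have "{y \<in> Units S. Tr y \<in> RC.Ip (l - j)} \<inter> {y \<in> SC.Ip 1. Tr y \<in> RC.Ip (l - j)} = {}"
    using SC.Units_eq SC.Ip_1 by auto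
  ultimately show ?thesis
    unfolding N_def using finite_Units SC.Ip_finite by (simp add: card_Un_disjoint)
qed

text \<open>The trace maps (\<pi>^i) in S onto (\<pi>^i) in R. Comparing the sizes q^(n(l-i)) and
  q^(l-i) gives the kernel, hence the common size of all fibres.\<close>

lemma card_Tr_preimage:
  assumes i: "i \<le> l" and j: "i \<le> j" "j \<le> l"
  shows "card {y \<in> SC.Ip i. Tr y \<in> RC.Ip j} = q ^ (l - j) * (q ^ (n - 1)) ^ (l - i)"
proof -
  let ?ker = "card {y \<in> SC.Ip i. Tr y = \<zero>}"
  have sub: "additive_subgroup (SC.Ip i) S" using SC.Ip_ideal ideal.axioms(1) by blast
  have img: "Tr ` SC.Ip i = RC.Ip i" using Tr_Ip Tr_Ip_surj by blast
  have cl: "\<And>x. x \<in> SC.Ip i \<Longrightarrow> Tr x \<in> carrier R" using SC.Ip_closed by simp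
  have ad: "\<And>x y. x \<in> SC.Ip i \<Longrightarrow> y \<in> SC.Ip i \<Longrightarrow> Tr (x \<oplus>\<^bsub>S\<^esub> y) = Tr x \<oplus> Tr y"
    using SC.Ip_closed Tr_add by blast
  have "card (SC.Ip i) = card (RC.Ip i) * ?ker"
    using S.card_additive_image[OF sub SC.Ip_finite R.is_abelian_group cl ad] img by simp
  then have "(q ^ n) ^ (l - i) = q ^ (l - i) * ?ker" using card_SIp card_RIp i by simp
  moreover have "q ^ n = q * q ^ (n - 1)" using n_pos by (simp add: power_eq_if)
  ultimately have "q ^ (l - i) * (q ^ (n - 1)) ^ (l - i) = q ^ (l - i) * ?ker"
    by (simp add: power_mult_distrib)
  then have ker: "?ker = (q ^ (n - 1)) ^ (l - i)" using q_pos by simp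
  have "RC.Ip j \<subseteq> Tr ` SC.Ip i" using img RC.Ip_antimono[OF j(1)] by simp
  then have "card {y \<in> SC.Ip i. Tr y \<in> RC.Ip j} = card (RC.Ip j) * ?ker"
    by (intro S.card_additive_preimage sub SC.Ip_finite R.is_abelian_group cl ad)
  then show ?thesis using ker card_RIp j by simp
qed

lemma N_less: "j < l \<Longrightarrow> real (N j) = real q ^ j * ((real q ^ (n - 1)) ^ l - (real q ^ (n - 1)) ^ (l - 1))"
proof -
  assume j: "j < l"
  have "card {y \<in> SC.Ip 1. Tr y \<in> RC.Ip (l - j)} = q ^ j * (q ^ (n - 1)) ^ (l - 1)"
    using card_Tr_preimage[of 1 "l - j"] j by simp
  moreover have "card {y \<in> carrier S. Tr y \<in> RC.Ip (l - j)} = q ^ j * (q ^ (n - 1)) ^ l"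
    using card_Tr_preimage[of 0 "l - j"] j by (simp add: SC.Ip_0)
  ultimately have "N j + q ^ j * (q ^ (n - 1)) ^ (l - 1) = q ^ j * (q ^ (n - 1)) ^ l"
    using card_Units_Tr_Ip[of j] by simp
  then have "real (N j + q ^ j * (q ^ (n - 1)) ^ (l - 1)) = real (q ^ j * (q ^ (n - 1)) ^ l)"
    by (rule arg_cong)
  then show ?thesis by (simp add: algebra_simps)
qed

text \<open>At j = l the trace condition is void, but traces of non-units still fill only (\<pi>);
  the non-units to be subtracted are therefore counted with target (\<pi>) instead of R, which
  changes the formula.\<close>

lemma N_l: "real (N l) = real q ^ l * (real q ^ (n - 1)) ^ l - real q ^ (l - 1) * (real q ^ (n - 1)) ^ (l - 1)"
proof -
  have e: "{y \<in> SC.Ip i. Tr y \<in> RC.Ip (l - l)} = {y \<in> SC.Ip i. Tr y \<in> RC.Ip i}" for i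
    using SC.Ip_closed Tr_Ip by (auto simp: RC.Ip_0)
  have "N l + card {y \<in> SC.Ip 1. Tr y \<in> RC.Ip 1} = card {y \<in> SC.Ip 0. Tr y \<in> RC.Ip 0}"
    using card_Units_Tr_Ip[of l] e[of 0] e[of 1] by (simp add: SC.Ip_0)
  then have "N l + q ^ (l - 1) * (q ^ (n - 1)) ^ (l - 1) = q ^ l * (q ^ (n - 1)) ^ l"
    using card_Tr_preimage[of 0 0] card_Tr_preimage[of 1 1] RC.m_pos by simp
  then have "real (N l + q ^ (l - 1) * (q ^ (n - 1)) ^ (l - 1)) = real (q ^ l * (q ^ (n - 1)) ^ l)"
    by (rule arg_cong)
  then show ?thesis by simp
qed

text \<open>The increments of N. They rewrite a count depending on a valuation as a combination of
  indicators of the ideals (\<pi>^i).\<close>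

definition dN :: "nat \<Rightarrow> real" where "dN j = (if j = 0 then real (N 0) else real (N j) - real (N (j - 1)))"

lemma sum_dN: "(\<Sum>i\<le>j. dN i) = real (N j)"
  by (induction j) (auto simp: dN_def)

text \<open>The lower limit l - b will be k. The induction lowers it from l, where the exceptional
  value N(l) enters, and each further term telescopes; the bound on b keeps the lower limit
  positive, away from the initial case of \<open>dN\<close>.\<close>

lemma dN_sum:
  assumes "b \<le> l - 1"
  shows "real q * (\<Sum>i=l-b..l. dN i * (real q ^ n) ^ (l - i))
    = (real q - 1) * (real q ^ n) ^ l * (real q ^ (n - 1)) ^ b"
  using assms
proof (induction b)
  case 0
  let ?r = "real q ^ (n - 1)"
  have qn: "real q ^ n = real q * ?r" using n_pos by (simp add: power_eq_if)
  have ql: "real q * real q ^ (l - 1) = real q ^ l" using RC.m_pos by (simp add: power_eq_if)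
  have "dN l = real q ^ l * ?r ^ l - real q ^ (l - 1) * ?r ^ l"
    using N_l N_less[of "l - 1"] RC.m_pos by (simp add: dN_def right_diff_distrib)
  then have "real q * dN l = real q * real q ^ l * ?r ^ l - real q ^ l * ?r ^ l"
    by (simp only: right_diff_distrib ql mult.assoc[symmetric])
  then show ?case unfolding qn by (simp add: power_mult_distrib algebra_simps)
next
  case (Suc b)
  define j where "j = l - Suc b"
  define i where "i = j - 1"
  have j: "l - b = Suc j" "l = j + Suc b" "j = Suc i" "l - j = Suc b" using Suc by (auto simp: j_def i_def)
  have qn: "real q ^ n = real q * real q ^ (n - 1)" using n_pos by (simp add: power_eq_if)
  let ?r = "real q ^ (n - 1)"
  have "{j..l} = insert j {l-b..l}" using j(1,2) by auto
  then have "(\<Sum>i=j..l. dN i * (real q ^ n) ^ (l - i)) = dN j * (real q ^ n) ^ (l - j) + (\<Sum>i=l-b..l. dN i * (real q ^ n) ^ (l - i))"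
    using j(1) by simp
  also have "l - j = Suc b" by (rule j(4))
  finally have "real q * (\<Sum>i=j..l. dN i * (real q ^ n) ^ (l - i))
      = real q * dN j * (real q ^ n) ^ Suc b + real q * (\<Sum>i=l-b..l. dN i * (real q ^ n) ^ (l - i))"
    by (simp only: distrib_left mult.assoc)
  also have "real q * (\<Sum>i=l-b..l. dN i * (real q ^ n) ^ (l - i)) = (real q - 1) * (real q ^ n) ^ l * ?r ^ b"
    using Suc by simp
  also have "real q * dN j = (real q - 1) * real q ^ j * (?r ^ l - ?r ^ (l - 1))"
  proof -
    have "dN j = real (N j) - real (N i)" using j(3) by (simp add: dN_def)
    also have "\<dots> = (real q ^ j - real q ^ i) * (?r ^ l - ?r ^ (l - 1))"
      using N_less[of j] N_less[of i] Suc.prems by (simp add: left_diff_distrib j_def i_def)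
    finally have "real q * dN j = (real q * real q ^ j - real q * real q ^ i) * (?r ^ l - ?r ^ (l - 1))"
      by (simp only: right_diff_distrib mult.assoc[symmetric])
    moreover have "real q * real q ^ i = real q ^ j" using j(3) by simp
    ultimately show ?thesis by (simp only: left_diff_distrib mult_1)
  qed
  also have "(real q - 1) * real q ^ j * (?r ^ l - ?r ^ (l - 1)) * (real q ^ n) ^ Suc b
      = (real q - 1) * (real q ^ n) ^ l * ?r ^ Suc b - (real q - 1) * (real q ^ n) ^ l * ?r ^ b"
  proof -
    have "j + b = l - 1" using j(2) by simp
    then show ?thesis using telescope_power[of "real q" j ?r b] unfolding qn[symmetric] j(2)[symmetric] by (simp only:)
  qed
  finally show ?case by (simp add: j_def)
qed

text \<open>With w = \<pi>^j v and v a unit, substituting v y for y leaves the condition \<pi>^j Tr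
  y = 0, so the count is N(j). The value w = 0 is the case j = l.\<close>

lemma card_Tr_zero:
  assumes w: "w \<in> carrier S"
  shows "real (card {y \<in> Units S. Tr (w \<otimes>\<^bsub>S\<^esub> y) = \<zero>}) = (\<Sum>i\<le>l. if w \<in> SC.Ip i then dN i else 0)"
proof -
  obtain j v where jv: "j \<le> l" "v \<in> Units S" "w = \<iota> \<pi> [^]\<^bsub>S\<^esub> j \<otimes>\<^bsub>S\<^esub> v"
    using SC.pow_unit_decomp[OF w] .
  have vc: "v \<in> carrier S" using jv by (simp add: S.Units_closed)
  have eq: "Tr (w \<otimes>\<^bsub>S\<^esub> y) = \<zero> \<longleftrightarrow> Tr (v \<otimes>\<^bsub>S\<^esub> y) \<in> RC.Ip (l - j)" if y: "y \<in> carrier S" for y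
  proof -
    have "w \<otimes>\<^bsub>S\<^esub> y = \<iota> (\<pi> [^] j) \<otimes>\<^bsub>S\<^esub> (v \<otimes>\<^bsub>S\<^esub> y)" using jv vc y by (simp add: S.m_assoc)
    then have "Tr (w \<otimes>\<^bsub>S\<^esub> y) = \<pi> [^] j \<otimes> Tr (v \<otimes>\<^bsub>S\<^esub> y)"
      using vc y Tr_smult[of "v \<otimes>\<^bsub>S\<^esub> y" "\<pi> [^] j"] by simp
    then show ?thesis using RC.annihilator_pow[of "Tr (v \<otimes>\<^bsub>S\<^esub> y)" j] jv(1) vc y by simp
  qed
  have "bij_betw (\<lambda>y. v \<otimes>\<^bsub>S\<^esub> y) {y \<in> Units S. Tr (w \<otimes>\<^bsub>S\<^esub> y) = \<zero>} {y \<in> Units S. Tr y \<in> RC.Ip (l - j)}"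
  proof (rule bij_betwI[where g = "\<lambda>y. inv\<^bsub>S\<^esub> v \<otimes>\<^bsub>S\<^esub> y"])
    show "(\<lambda>y. v \<otimes>\<^bsub>S\<^esub> y) \<in> {y \<in> Units S. Tr (w \<otimes>\<^bsub>S\<^esub> y) = \<zero>} \<rightarrow> {y \<in> Units S. Tr y \<in> RC.Ip (l - j)}"
      using jv eq by (auto simp: S.Units_closed)
    have "v \<otimes>\<^bsub>S\<^esub> (inv\<^bsub>S\<^esub> v \<otimes>\<^bsub>S\<^esub> y) = y" if "y \<in> carrier S" for y
      using that jv vc by (simp add: S.m_assoc[symmetric])
    then show "(\<lambda>y. inv\<^bsub>S\<^esub> v \<otimes>\<^bsub>S\<^esub> y) \<in> {y \<in> Units S. Tr y \<in> RC.Ip (l - j)} \<rightarrow> {y \<in> Units S. Tr (w \<otimes>\<^bsub>S\<^esub> y) = \<zero>}"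
      using jv eq by (auto simp: S.Units_closed)
  qed (use jv in \<open>auto simp: S.m_assoc[symmetric] S.Units_closed\<close>)
  then have "card {y \<in> Units S. Tr (w \<otimes>\<^bsub>S\<^esub> y) = \<zero>} = N j"
    unfolding N_def by (rule bij_betw_same_card)
  moreover have "(\<Sum>i\<le>l. if w \<in> SC.Ip i then dN i else 0) = (\<Sum>i\<le>j. dN i)"
  proof -
    have "(\<Sum>i\<le>l. if w \<in> SC.Ip i then dN i else 0) = (\<Sum>i\<le>l. if i \<le> j then dN i else 0)"
      using SC.p_pow_Unit_mem_Ip[OF jv(2) _ jv(1)] jv(3) by (intro sum.cong) auto
    also have "\<dots> = (\<Sum>i\<in>{i \<in> {..l}. i \<le> j}. dN i)" by (simp only: sum.inter_filter finite_atMost)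
    also have "{i \<in> {..l}. i \<le> j} = {..j}" using jv(1) by auto
    finally show ?thesis .
  qed
  ultimately show ?thesis using sum_dN by simp
qed

text \<open>Orthogonality on the group of principal units of level i: chi is non-trivial below level
  k and constantly 1 from k on.\<close>

lemma sum_chi_principal_units:
  assumes i: "i \<le> l"
  shows "(\<Sum>z \<in> {z \<in> Units S. z \<ominus>\<^bsub>S\<^esub> \<one>\<^bsub>S\<^esub> \<in> SC.Ip i}. chi z) = (if i < k then 0 else of_nat ((q ^ n) ^ (l - i)))"
proof (cases "i < k")
  case True
  let ?T = "{z \<in> Units S. z \<ominus>\<^bsub>S\<^esub> \<one>\<^bsub>S\<^esub> \<in> SC.Ip i}"
  obtain u where u: "u \<in> principal_units S (\<iota> \<pi>) i" "chi u \<noteq> 1" using chi_less_k[OF True] by blast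
  have uT: "u \<in> Units S" "u \<ominus>\<^bsub>S\<^esub> \<one>\<^bsub>S\<^esub> \<in> SC.Ip i" using u by (auto simp: SC.principal_units_eq)
  have "u \<otimes>\<^bsub>S\<^esub> y \<in> ?T" if y: "y \<in> ?T" for y
  proof -
    have yc: "y \<in> Units S" "y \<in> carrier S" "u \<in> carrier S" using y uT by (auto simp: S.Units_closed)
    have "u \<otimes>\<^bsub>S\<^esub> y \<ominus>\<^bsub>S\<^esub> \<one>\<^bsub>S\<^esub> = (u \<ominus>\<^bsub>S\<^esub> \<one>\<^bsub>S\<^esub>) \<otimes>\<^bsub>S\<^esub> y \<oplus>\<^bsub>S\<^esub> (y \<ominus>\<^bsub>S\<^esub> \<one>\<^bsub>S\<^esub>)"
    proof -
      have "(u \<ominus>\<^bsub>S\<^esub> \<one>\<^bsub>S\<^esub>) \<otimes>\<^bsub>S\<^esub> y \<oplus>\<^bsub>S\<^esub> (y \<ominus>\<^bsub>S\<^esub> \<one>\<^bsub>S\<^esub>) = u \<otimes>\<^bsub>S\<^esub> y \<oplus>\<^bsub>S\<^esub> (\<ominus>\<^bsub>S\<^esub> y \<oplus>\<^bsub>S\<^esub> y) \<oplus>\<^bsub>S\<^esub> \<ominus>\<^bsub>S\<^esub> \<one>\<^bsub>S\<^esub>"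
        using yc by (simp add: a_minus_def S.l_distr S.l_minus S.a_assoc)
      then show ?thesis using yc by (simp add: a_minus_def S.l_neg)
    qed
    moreover have "\<dots> \<in> SC.Ip i" using y uT yc by (intro SC.Ip_add SC.Ip_mult) auto
    ultimately show ?thesis using yc uT by simp
  qed
  then have "(\<Sum>z\<in>?T. chi z) = 0" by (intro sum_invariant_zero[OF _ uT(1) u(2)]) blast+
  then show ?thesis using True by simp
next
  case False
  then have i1: "1 \<le> i" using k_pos by simp
  let ?T = "{z \<in> Units S. z \<ominus>\<^bsub>S\<^esub> \<one>\<^bsub>S\<^esub> \<in> SC.Ip i}"
  have "chi z = 1" if "z \<in> ?T" for z
  proof -
    have "z \<ominus>\<^bsub>S\<^esub> \<one>\<^bsub>S\<^esub> \<in> SC.Ip k" using that SC.Ip_antimono[of k i] False by auto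
    then show ?thesis using that by (intro chi_k) (simp add: SC.principal_units_eq)
  qed
  then have "(\<Sum>z\<in>?T. chi z) = of_nat (card ?T)" by simp
  moreover have "card ?T = card (SC.Ip i)"
  proof (rule bij_betw_same_card[symmetric])
    show "bij_betw (\<lambda>x. \<one>\<^bsub>S\<^esub> \<oplus>\<^bsub>S\<^esub> x) (SC.Ip i) ?T"
    proof (rule bij_betwI[where g = "\<lambda>z. z \<ominus>\<^bsub>S\<^esub> \<one>\<^bsub>S\<^esub>"])
      show "(\<lambda>x. \<one>\<^bsub>S\<^esub> \<oplus>\<^bsub>S\<^esub> x) \<in> SC.Ip i \<rightarrow> ?T"
        using SC.principal_unitsI[OF i1] by (auto simp: SC.principal_units_eq)
      show "\<one>\<^bsub>S\<^esub> \<oplus>\<^bsub>S\<^esub> x \<ominus>\<^bsub>S\<^esub> \<one>\<^bsub>S\<^esub> = x" if "x \<in> SC.Ip i" for x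
        using SC.Ip_closed[OF that] by (simp add: a_minus_def S.a_ac S.r_neg)
      show "\<one>\<^bsub>S\<^esub> \<oplus>\<^bsub>S\<^esub> (z \<ominus>\<^bsub>S\<^esub> \<one>\<^bsub>S\<^esub>) = z" if "z \<in> ?T" for z
        using that by (simp add: a_minus_def S.a_ac S.r_neg S.Units_closed)
    qed auto
  qed
  ultimately show ?thesis using False card_SIp[OF i] by simp
qed

section \<open>The second moment\<close>

lemma second_moment_eq:
  "(\<Sum>c\<in>carrier R. of_real ((cmod (E c))\<^sup>2)) = (\<Sum>z\<in>Units S. chi z * of_nat (card {y \<in> Units S. Tr ((z \<ominus>\<^bsub>S\<^esub> \<one>\<^bsub>S\<^esub>) \<otimes>\<^bsub>S\<^esub> y) = \<zero>}))"
proof -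
  have norm: "of_real ((cmod (E c))\<^sup>2) = (\<Sum>y\<in>{y \<in> Units S. Tr y = c}. \<Sum>x\<in>{x \<in> Units S. Tr x = c}. chi x * cnj (chi y))" for c
  proof -
    have "of_real ((cmod (E c))\<^sup>2) = E c * cnj (E c)" by (rule complex_norm_square)
    also have "\<dots> = (\<Sum>x\<in>{x \<in> Units S. Tr x = c}. \<Sum>y\<in>{y \<in> Units S. Tr y = c}. chi x * cnj (chi y))"
      unfolding E_def cnj_sum by (rule sum_product)
    also have "\<dots> = (\<Sum>y\<in>{y \<in> Units S. Tr y = c}. \<Sum>x\<in>{x \<in> Units S. Tr x = c}. chi x * cnj (chi y))"
      by (rule sum.swap)
    finally show ?thesis .
  qed
  \<comment> \<open>In a pair of units of equal trace put x = z y. Then chi(x) times the conjugate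
    of chi(y) is chi(z), and equality of traces becomes Tr ((z - 1) y) = 0.\<close>
  have inner: "(\<Sum>x\<in>{x \<in> Units S. Tr x = Tr y}. chi x * cnj (chi y)) =
      (\<Sum>z\<in>{z \<in> Units S. Tr ((z \<ominus>\<^bsub>S\<^esub> \<one>\<^bsub>S\<^esub>) \<otimes>\<^bsub>S\<^esub> y) = \<zero>}. chi z)" if y: "y \<in> Units S" for y
  proof -
    have yc: "y \<in> carrier S" using y by (simp add: S.Units_closed)
    have eq: "Tr (z \<otimes>\<^bsub>S\<^esub> y) = Tr y \<longleftrightarrow> Tr ((z \<ominus>\<^bsub>S\<^esub> \<one>\<^bsub>S\<^esub>) \<otimes>\<^bsub>S\<^esub> y) = \<zero>" if z: "z \<in> carrier S" for z
    proof -
      have "z \<otimes>\<^bsub>S\<^esub> y = y \<oplus>\<^bsub>S\<^esub> (z \<ominus>\<^bsub>S\<^esub> \<one>\<^bsub>S\<^esub>) \<otimes>\<^bsub>S\<^esub> y"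
        using z yc by (simp add: a_minus_def S.l_distr S.l_minus S.a_lcomm[of y] S.r_neg)
      then have "Tr (z \<otimes>\<^bsub>S\<^esub> y) = Tr y \<oplus> Tr ((z \<ominus>\<^bsub>S\<^esub> \<one>\<^bsub>S\<^esub>) \<otimes>\<^bsub>S\<^esub> y)"
        using z yc Tr_add[of y "(z \<ominus>\<^bsub>S\<^esub> \<one>\<^bsub>S\<^esub>) \<otimes>\<^bsub>S\<^esub> y"] by simp
      then show ?thesis
        using z yc R.add.l_cancel_one[of "Tr y" "Tr ((z \<ominus>\<^bsub>S\<^esub> \<one>\<^bsub>S\<^esub>) \<otimes>\<^bsub>S\<^esub> y)"] by simp
    qed
    have "bij_betw (\<lambda>z. z \<otimes>\<^bsub>S\<^esub> y) {z \<in> Units S. Tr ((z \<ominus>\<^bsub>S\<^esub> \<one>\<^bsub>S\<^esub>) \<otimes>\<^bsub>S\<^esub> y) = \<zero>} {x \<in> Units S. Tr x = Tr y}"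
    proof (rule bij_betwI[where g = "\<lambda>x. x \<otimes>\<^bsub>S\<^esub> inv\<^bsub>S\<^esub> y"])
      show "(\<lambda>z. z \<otimes>\<^bsub>S\<^esub> y) \<in> {z \<in> Units S. Tr ((z \<ominus>\<^bsub>S\<^esub> \<one>\<^bsub>S\<^esub>) \<otimes>\<^bsub>S\<^esub> y) = \<zero>} \<rightarrow> {x \<in> Units S. Tr x = Tr y}"
        using y eq by (auto simp: S.Units_closed)
      show "(\<lambda>x. x \<otimes>\<^bsub>S\<^esub> inv\<^bsub>S\<^esub> y) \<in> {x \<in> Units S. Tr x = Tr y} \<rightarrow> {z \<in> Units S. Tr ((z \<ominus>\<^bsub>S\<^esub> \<one>\<^bsub>S\<^esub>) \<otimes>\<^bsub>S\<^esub> y) = \<zero>}"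
      proof
        fix x assume x: "x \<in> {x \<in> Units S. Tr x = Tr y}"
        have "(x \<otimes>\<^bsub>S\<^esub> inv\<^bsub>S\<^esub> y) \<otimes>\<^bsub>S\<^esub> y = x" using x y yc by (simp add: S.m_assoc S.Units_closed)
        then show "x \<otimes>\<^bsub>S\<^esub> inv\<^bsub>S\<^esub> y \<in> {z \<in> Units S. Tr ((z \<ominus>\<^bsub>S\<^esub> \<one>\<^bsub>S\<^esub>) \<otimes>\<^bsub>S\<^esub> y) = \<zero>}"
          using x y eq[of "x \<otimes>\<^bsub>S\<^esub> inv\<^bsub>S\<^esub> y"] by (simp add: S.Units_closed)
      qed
    qed (use y in \<open>auto simp: S.m_assoc S.Units_closed\<close>)
    then have "(\<Sum>x\<in>{x \<in> Units S. Tr x = Tr y}. chi x * cnj (chi y)) =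
        (\<Sum>z\<in>{z \<in> Units S. Tr ((z \<ominus>\<^bsub>S\<^esub> \<one>\<^bsub>S\<^esub>) \<otimes>\<^bsub>S\<^esub> y) = \<zero>}. chi (z \<otimes>\<^bsub>S\<^esub> y) * cnj (chi y))"
      by (rule sum.reindex_bij_betw[symmetric])
    also have "\<dots> = (\<Sum>z\<in>{z \<in> Units S. Tr ((z \<ominus>\<^bsub>S\<^esub> \<one>\<^bsub>S\<^esub>) \<otimes>\<^bsub>S\<^esub> y) = \<zero>}. chi z)"
    proof (intro sum.cong refl)
      fix z assume "z \<in> {z \<in> Units S. Tr ((z \<ominus>\<^bsub>S\<^esub> \<one>\<^bsub>S\<^esub>) \<otimes>\<^bsub>S\<^esub> y) = \<zero>}"
      moreover have "chi y * cnj (chi y) = 1" using complex_norm_square[of "chi y"] cmod_chi[OF y] by simp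
      ultimately show "chi (z \<otimes>\<^bsub>S\<^esub> y) * cnj (chi y) = chi z" using chi_mult y by (simp add: mult.assoc)
    qed
    finally show ?thesis .
  qed
  have U: "Units S = (\<Union>c\<in>carrier R. {y \<in> Units S. Tr y = c})" by (auto simp: S.Units_closed)
  have "(\<Sum>c\<in>carrier R. of_real ((cmod (E c))\<^sup>2)) =
      (\<Sum>c\<in>carrier R. \<Sum>y\<in>{y \<in> Units S. Tr y = c}. \<Sum>x\<in>{x \<in> Units S. Tr x = Tr y}. chi x * cnj (chi y))"
    unfolding norm by (intro sum.cong refl) auto
  also have "\<dots> = (\<Sum>y\<in>Units S. \<Sum>x\<in>{x \<in> Units S. Tr x = Tr y}. chi x * cnj (chi y))"
    by (subst (4) U, subst sum.UNION_disjoint) (use RC.finite_carrier finite_Units in auto)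
  also have "\<dots> = (\<Sum>y\<in>Units S. \<Sum>z\<in>{z \<in> Units S. Tr ((z \<ominus>\<^bsub>S\<^esub> \<one>\<^bsub>S\<^esub>) \<otimes>\<^bsub>S\<^esub> y) = \<zero>}. chi z)"
    by (rule sum.cong[OF refl inner])
  also have "\<dots> = (\<Sum>z\<in>Units S. \<Sum>y\<in>{y \<in> Units S. Tr ((z \<ominus>\<^bsub>S\<^esub> \<one>\<^bsub>S\<^esub>) \<otimes>\<^bsub>S\<^esub> y) = \<zero>}. chi z)"
    using finite_Units by (intro sum.swap_restrict)
  finally show ?thesis by (simp add: mult.commute)
qed

lemma second_moment:
  "real q * (\<Sum>c\<in>carrier R. (cmod (E c))\<^sup>2) = (real q - 1) * (real q ^ n) ^ l * (real q ^ (n - 1)) ^ (l - k)"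
proof -
  let ?w = "\<lambda>z. z \<ominus>\<^bsub>S\<^esub> \<one>\<^bsub>S\<^esub>"
  have "of_real (\<Sum>c\<in>carrier R. (cmod (E c))\<^sup>2) = (\<Sum>c\<in>carrier R. complex_of_real ((cmod (E c))\<^sup>2))"
    by (rule of_real_sum)
  also have "\<dots> = (\<Sum>z\<in>Units S. chi z * of_real (real (card {y \<in> Units S. Tr (?w z \<otimes>\<^bsub>S\<^esub> y) = \<zero>})))"
    unfolding second_moment_eq by simp
  also have "\<dots> = (\<Sum>z\<in>Units S. \<Sum>i\<le>l. if ?w z \<in> SC.Ip i then chi z * of_real (dN i) else 0)"
  proof (intro sum.cong refl)
    fix z assume "z \<in> Units S"
    then have "?w z \<in> carrier S" by (simp add: S.Units_closed)
    then show "chi z * of_real (real (card {y \<in> Units S. Tr (?w z \<otimes>\<^bsub>S\<^esub> y) = \<zero>})) =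
        (\<Sum>i\<le>l. if ?w z \<in> SC.Ip i then chi z * of_real (dN i) else 0)"
      by (simp only: card_Tr_zero of_real_sum sum_distrib_left) (auto intro!: sum.cong)
  qed
  \<comment> \<open>After the exchange each level i carries the sum of chi over 1 + (\<pi>^i), which
    vanishes for i < k.\<close>
  also have "\<dots> = (\<Sum>i\<le>l. \<Sum>z\<in>Units S. if ?w z \<in> SC.Ip i then chi z * of_real (dN i) else 0)"
    by (rule sum.swap)
  also have "\<dots> = (\<Sum>i\<le>l. of_real (dN i) * (\<Sum>z\<in>{z \<in> Units S. ?w z \<in> SC.Ip i}. chi z))"
    using finite_Units by (intro sum.cong refl) (auto simp: sum_distrib_left sum.inter_filter intro!: sum.cong)
  also have "\<dots> = (\<Sum>i\<le>l. if k \<le> i then of_real (dN i * (real q ^ n) ^ (l - i)) else 0)"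
    by (intro sum.cong refl) (simp add: sum_chi_principal_units)
  also have "\<dots> = (\<Sum>i\<in>{i \<in> {..l}. k \<le> i}. of_real (dN i * (real q ^ n) ^ (l - i)))"
    by (simp only: sum.inter_filter finite_atMost)
  also have "{i \<in> {..l}. k \<le> i} = {k..l}" by auto
  also have "(\<Sum>i\<in>{k..l}. complex_of_real (dN i * (real q ^ n) ^ (l - i))) = of_real (\<Sum>i=k..l. dN i * (real q ^ n) ^ (l - i))"
    by (rule of_real_sum[symmetric])
  finally have "(\<Sum>c\<in>carrier R. (cmod (E c))\<^sup>2) = (\<Sum>i=k..l. dN i * (real q ^ n) ^ (l - i))"
    by (simp only: of_real_eq_iff)
  then show ?thesis using dN_sum[of "l - k"] k_le_l k_pos by simp
qed

lemma norm_q_minus_1: "cmod (of_nat q - 1) = real q - 1"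
proof -
  have "complex_of_nat q - 1 = of_real (real q - 1)" by simp
  then show ?thesis using q_pos by (simp only: norm_of_real)
qed

section \<open>Vanishing of E and the absolute value of \<open>E \<one>\<close>\<close>

lemma E_Unit: "u \<in> Units R \<Longrightarrow> E u = chi (\<iota> u) * E \<one>"
  using E_mult_Unit[of u \<one>] by (simp add: R.Units_closed)

lemma E_zero_eq_0:
  assumes "r \<in> Units R" "chi (\<iota> r) \<noteq> 1"
  shows "E \<zero> = 0"
  using E_mult_Unit[OF assms(1), of \<zero>] assms by (simp add: R.Units_closed)

text \<open>For r = 1 + x with x in (\<pi>^(k-1)) and c in (\<pi>), the product x c lies in
  (\<pi>^k). So E(r c) = E(c), yet the scaling factor chi(r) is not 1.\<close>

lemma E_nonunit_eq_0:
  assumes r: "r \<in> principal_units R \<pi> (k - 1)" "chi (\<iota> r) \<noteq> 1" and c: "c \<in> RC.Ip 1"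
  shows "E c = 0"
proof -
  obtain x where x: "r \<in> Units R" "x \<in> RC.Ip (k - 1)" "r = \<one> \<oplus> x" using r(1) by (elim RC.principal_unitsE)
  have cl: "x \<in> carrier R" "c \<in> carrier R" using x c RC.Ip_closed by auto
  have "x \<otimes> c \<in> RC.Ip (k - 1 + 1)" using RC.Ip_mult_Ip x c by blast
  then have "x \<otimes> c \<in> RC.Ip k" using k_pos by simp
  moreover have "r \<otimes> c = c \<oplus> x \<otimes> c" using x cl by (simp add: R.l_distr)
  ultimately have "E (r \<otimes> c) = E c" using E_add_Ip cl by simp
  then show ?thesis using E_mult_Unit[OF x(1) cl(2)] r(2) by simp
qed

lemma q_pow_n: "(real q ^ n) ^ l = real q ^ l * (real q ^ (n - 1)) ^ l"
proof -
  have "real q ^ n = real q * real q ^ (n - 1)" using n_pos by (simp add: power_eq_if)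
  then show ?thesis by (simp add: power_mult_distrib)
qed

text \<open>Only units contribute to the second moment, all with the same absolute value; dividing
  by the number of units leaves the claim.\<close>

lemma cmod_E_one_sq:
  assumes r: "r \<in> principal_units R \<pi> (k - 1)" "chi (\<iota> r) \<noteq> 1"
  shows "(cmod (E \<one>))\<^sup>2 = (real q ^ (n - 1)) ^ l * (real q ^ (n - 1)) ^ (l - k)"
proof -
  have U: "carrier R = Units R \<union> RC.Ip 1" "Units R \<inter> RC.Ip 1 = {}"
    using RC.Units_eq RC.Ip_1 RC.Ip_closed[of _ 1] by auto
  have "(\<Sum>c\<in>carrier R. (cmod (E c))\<^sup>2) = (\<Sum>c\<in>Units R. (cmod (E c))\<^sup>2) + (\<Sum>c\<in>RC.Ip 1. (cmod (E c))\<^sup>2)"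
    unfolding U(1) by (rule sum.union_disjoint[OF finite_Units(2) RC.Ip_finite U(2)])
  also have "(\<Sum>c\<in>RC.Ip 1. (cmod (E c))\<^sup>2) = 0" using E_nonunit_eq_0[OF r] by simp
  also have "(\<Sum>c\<in>Units R. (cmod (E c))\<^sup>2) = (\<Sum>c\<in>Units R. (cmod (E \<one>))\<^sup>2)"
    by (rule sum.cong[OF refl]) (subst E_Unit, simp_all add: norm_mult iota_Unit cmod_chi)
  finally have "real q * real (card (Units R)) * (cmod (E \<one>))\<^sup>2 =
      (real q - 1) * (real q ^ n) ^ l * (real q ^ (n - 1)) ^ (l - k)"
    using second_moment by simp
  moreover have "real q * real (card (Units R)) = (real q - 1) * real q ^ l"
    using arg_cong[OF card_Units_R, of real] q_pos by (simp add: of_nat_diff)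
  ultimately have "((real q - 1) * real q ^ l) * (cmod (E \<one>))\<^sup>2 =
      ((real q - 1) * real q ^ l) * ((real q ^ (n - 1)) ^ l * (real q ^ (n - 1)) ^ (l - k))"
    by (simp add: q_pow_n mult.assoc)
  then show ?thesis using q_gt_1 by simp
qed

text \<open>On 1 + (\<pi>^i) all elements are units on which chi is trivial, so E is constant there,
  while its sum over this coset is zero. It serves a non-trivial restriction of smaller valuation as
  well as a trivial one with k \<ge> 2.\<close>

lemma E_one_eq_0:
  assumes i: "1 \<le> i" "i < k" and triv: "\<And>u. u \<in> principal_units R \<pi> i \<Longrightarrow> chi (\<iota> u) = 1"
  shows "E \<one> = 0"
proof -
  have "E (\<one> \<oplus> d) = E \<one>" if d: "d \<in> RC.Ip i" for d
  proof -
    have "\<one> \<oplus> d \<in> principal_units R \<pi> i" using RC.principal_unitsI[OF i(1) d] .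
    then show ?thesis using triv[of "\<one> \<oplus> d"] E_Unit[of "\<one> \<oplus> d"] by (auto simp: RC.principal_units_eq)
  qed
  then have "of_nat (card (RC.Ip i)) * E \<one> = 0"
    using sum_E_coset[OF R.one_closed i(2)] by simp
  moreover have "card (RC.Ip i) \<noteq> 0" using RC.Ip_finite RC.zero_in_Ip[of i] by (auto simp: card_eq_0_iff)
  ultimately show ?thesis by simp
qed

section \<open>Characters with trivial restriction\<close>

context
  assumes triv: "\<And>r. r \<in> Units R \<Longrightarrow> chi (\<iota> r) = 1"
begin

lemma E_layer:
  assumes i: "i < l" and c: "c \<in> RC.Ip i - RC.Ip (Suc i)"
  shows "E c = E (\<pi> [^] i)"
proof -
  have cc: "c \<in> carrier R" using c RC.Ip_closed by blast
  obtain j u where ju: "j \<le> l" "u \<in> Units R" "c = \<pi> [^] j \<otimes> u" using RC.pow_unit_decomp[OF cc] .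
  have "j = i"
    using c i ju RC.p_pow_Unit_mem_Ip[OF ju(2) _ ju(1), of i] RC.p_pow_Unit_mem_Ip[OF ju(2) _ ju(1), of "Suc i"] by simp
  then have "c = u \<otimes> \<pi> [^] i" using ju by (simp add: R.m_comm R.Units_closed)
  then show ?thesis using E_mult_Unit[OF ju(2), of "\<pi> [^] i"] triv[OF ju(2)] by simp
qed

lemma card_layer: "i < l \<Longrightarrow> card (RC.Ip i - RC.Ip (Suc i)) = (q - 1) * q ^ (l - Suc i)"
proof -
  assume i: "i < l"
  have "card (RC.Ip i - RC.Ip (Suc i)) = q ^ (l - i) - q ^ (l - Suc i)"
    using i card_RIp RC.Ip_antimono[of i "Suc i"] RC.Ip_finite by (simp add: card_Diff_subset)
  moreover have "l - i = Suc (l - Suc i)" using i by simp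
  ultimately show ?thesis by (simp add: diff_mult_distrib)
qed

text \<open>The codomain is left general because the lemma is applied to the complex values of E and
  to the real squares of their absolute values.\<close>

lemma sum_layer:
  fixes g :: "'a \<Rightarrow> 'g :: comm_semiring_1"
  assumes i: "i < l" and g: "\<And>c. c \<in> RC.Ip i - RC.Ip (Suc i) \<Longrightarrow> g c = z"
  shows "(\<Sum>c\<in>RC.Ip i. g c) = of_nat ((q - 1) * q ^ (l - Suc i)) * z + (\<Sum>c\<in>RC.Ip (Suc i). g c)"
proof -
  have "(\<Sum>c\<in>RC.Ip i. g c) = (\<Sum>c\<in>RC.Ip i - RC.Ip (Suc i). g c) + (\<Sum>c\<in>RC.Ip (Suc i). g c)"
    using RC.Ip_antimono[of i "Suc i"] RC.Ip_finite by (intro sum.subset_diff) auto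
  also have "(\<Sum>c\<in>RC.Ip i - RC.Ip (Suc i). g c) = of_nat ((q - 1) * q ^ (l - Suc i)) * z"
    using g card_layer[OF i] by (simp del: of_nat_mult)
  finally show ?thesis .
qed

text \<open>The sums over (\<pi>^i) and (\<pi>^(i+1)) both vanish, hence so does the sum over the
  layer between them, where E is constant.\<close>

lemma E_pow_eq_0:
  assumes i: "Suc i < k"
  shows "E (\<pi> [^] i) = 0"
proof -
  have il: "i < l" using i k_le_l by simp
  have "of_nat ((q - 1) * q ^ (l - Suc i)) * E (\<pi> [^] i) = 0"
    using sum_layer[OF il, of E, OF E_layer[OF il]] sum_E_Ip[of i] sum_E_Ip[OF i] i by simp
  then show ?thesis using q_gt_1 by simp
qed

lemma E_eq_E_zero: "c \<in> RC.Ip k \<Longrightarrow> E c = E \<zero>"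
  using E_add_Ip[of \<zero> c] RC.Ip_closed[of c k] by simp

text \<open>In the vanishing sum over (\<pi>^(k-1)), the top layer contributes (q - 1) q^(l-k) equal
  terms and (\<pi>^k) contributes q^(l-k) copies of E(0).\<close>

lemma E_zero_eq: "E \<zero> = - (of_nat q - 1) * E (\<pi> [^] (k - 1))"
proof -
  have kl: "k - 1 < l" "Suc (k - 1) = k" using k_le_l k_pos by auto
  have "of_nat ((q - 1) * q ^ (l - k)) * E (\<pi> [^] (k - 1)) + of_nat (q ^ (l - k)) * E \<zero> = 0"
    using sum_layer[OF kl(1), of E, OF E_layer[OF kl(1)]] sum_E_Ip[of "k - 1"] k_pos
    by (simp add: kl(2) E_eq_E_zero card_RIp[OF k_le_l])
  then have "of_nat (q ^ (l - k)) * ((of_nat q - 1) * E (\<pi> [^] (k - 1)) + E \<zero>) = 0"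
    using q_pos by (simp add: algebra_simps of_nat_diff)
  then have "(of_nat q - 1) * E (\<pi> [^] (k - 1)) + E \<zero> = 0" using q_pos by simp
  then have "E \<zero> = - ((of_nat q - 1) * E (\<pi> [^] (k - 1)))" by (simp only: add_eq_0_iff)
  then show ?thesis by (simp only: minus_mult_left)
qed

lemma E_eq_0_outside:
  assumes c: "c \<in> carrier R - RC.Ip (k - 1)"
  shows "E c = 0"
proof -
  obtain j u where ju: "j \<le> l" "u \<in> Units R" "c = \<pi> [^] j \<otimes> u" using RC.pow_unit_decomp c by blast
  have "\<not> k - 1 \<le> j"
    using c ju RC.p_pow_Unit_mem_Ip[OF ju(2) _ ju(1), of "k - 1"] k_le_l by simp
  then have "E (\<pi> [^] j) = 0" by (intro E_pow_eq_0) simp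
  moreover have "c = u \<otimes> \<pi> [^] j" using ju by (simp add: R.m_comm R.Units_closed)
  ultimately show ?thesis using E_mult_Unit[OF ju(2), of "\<pi> [^] j"] by simp
qed

text \<open>The second moment is supported on (\<pi>^(k-1)) and involves two values. Multiplying it
  by q - 1 and using |E(0)| = (q - 1) |E(\<pi>^(k-1))| eliminates the second one.\<close>

lemma cmod_E_zero_sq:
  "real q ^ 2 * real q ^ (l - k) * (cmod (E \<zero>))\<^sup>2 = (real q - 1)\<^sup>2 * (real q ^ n) ^ l * (real q ^ (n - 1)) ^ (l - k)"
proof -
  let ?e = "E (\<pi> [^] (k - 1))"
  have kl: "k - 1 < l" "Suc (k - 1) = k" using k_le_l k_pos by auto
  have "(\<Sum>c\<in>carrier R. (cmod (E c))\<^sup>2) = (\<Sum>c\<in>RC.Ip (k - 1). (cmod (E c))\<^sup>2)"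
    using RC.finite_carrier RC.Ip_closed E_eq_0_outside by (intro sum.mono_neutral_right) auto
  also have "\<dots> = real ((q - 1) * q ^ (l - k)) * (cmod ?e)\<^sup>2 + (\<Sum>c\<in>RC.Ip k. (cmod (E c))\<^sup>2)"
    using sum_layer[OF kl(1), of "\<lambda>c. (cmod (E c))\<^sup>2" "(cmod ?e)\<^sup>2"] E_layer[OF kl(1)] kl(2) by simp
  also have "(\<Sum>c\<in>RC.Ip k. (cmod (E c))\<^sup>2) = real q ^ (l - k) * (cmod (E \<zero>))\<^sup>2"
    by (simp add: E_eq_E_zero card_RIp[OF k_le_l])
  also have "real ((q - 1) * q ^ (l - k)) = (real q - 1) * real q ^ (l - k)" using q_pos by (simp add: of_nat_diff)
  finally have S: "(\<Sum>c\<in>carrier R. (cmod (E c))\<^sup>2) =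
    (real q - 1) * real q ^ (l - k) * (cmod ?e)\<^sup>2 + real q ^ (l - k) * (cmod (E \<zero>))\<^sup>2" .
  have "cmod (E \<zero>) = (real q - 1) * cmod ?e"
    unfolding E_zero_eq norm_mult norm_minus_cancel norm_q_minus_1 ..
  then have "(real q - 1) * (\<Sum>c\<in>carrier R. (cmod (E c))\<^sup>2) = real q * real q ^ (l - k) * (cmod (E \<zero>))\<^sup>2"
    unfolding S by (simp only:) (simp add: power2_eq_square algebra_simps)
  then have "real q ^ 2 * real q ^ (l - k) * (cmod (E \<zero>))\<^sup>2 = (real q - 1) * (real q * (\<Sum>c\<in>carrier R. (cmod (E c))\<^sup>2))"
    by (simp add: power2_eq_square algebra_simps)
  then show ?thesis unfolding second_moment by (simp add: power2_eq_square algebra_simps)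
qed

end

section \<open>Absolute values with half-integral exponents\<close>

lemma power_eq_powr_real: "(real q ^ (n - 1)) ^ j = real q powr ((real n - 1) * real j)"
proof -
  have "real (n - 1) = real n - 1" using n_pos by (simp add: of_nat_diff)
  then show ?thesis using q_pos by (simp add: powr_realpow[symmetric] powr_powr)
qed

lemma eq_powr_of_sq:
  assumes "x\<^sup>2 = real q powr (2 * e)" "0 \<le> x"
  shows "x = real q powr e"
proof -
  have "x\<^sup>2 = (real q powr e)\<^sup>2" using assms(1) by (simp add: power2_eq_square flip: powr_add)
  then show ?thesis using assms(2) by (simp add: power2_eq_iff_nonneg)
qed

lemma cmod_E_one:
  assumes "r \<in> principal_units R \<pi> (k - 1)" "chi (\<iota> r) \<noteq> 1"
  shows "cmod (E \<one>) = real q powr ((real n - 1) * (real l - real k / 2))"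
proof (rule eq_powr_of_sq)
  have "(cmod (E \<one>))\<^sup>2 = real q powr ((real n - 1) * real l) * real q powr ((real n - 1) * real (l - k))"
    unfolding cmod_E_one_sq[OF assms] power_eq_powr_real ..
  also have "\<dots> = real q powr ((real n - 1) * real l + (real n - 1) * (real l - real k))"
    using k_le_l by (simp add: powr_add of_nat_diff)
  also have "(real n - 1) * real l + (real n - 1) * (real l - real k) = 2 * ((real n - 1) * (real l - real k / 2))"
    by (simp add: field_simps)
  finally show "(cmod (E \<one>))\<^sup>2 = real q powr (2 * ((real n - 1) * (real l - real k / 2)))" .
qed simp

lemma cmod_E_zero:
  assumes triv: "\<And>r. r \<in> Units R \<Longrightarrow> chi (\<iota> r) = 1"
  shows "cmod (E \<zero>) = (1 - 1 / real q) * real q powr ((real n - 1) * real l - (real n / 2 - 1) * real k)"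
proof -
  let ?e = "(real n - 1) * real l - (real n / 2 - 1) * real k"
  have q1: "real q > 1" using q_gt_1 by simp
  have "real q ^ l * (real q ^ (n - 1)) ^ l * (real q ^ (n - 1)) ^ (l - k) = real q powr (real l + (real n - 1) * real l + (real n - 1) * (real l - real k))"
    using q_pos k_le_l unfolding power_eq_powr_real by (simp add: powr_add powr_realpow of_nat_diff)
  \<comment> \<open>Twice the target exponent plus l - k; the surplus matches the factor q^(l-k)
    beside |E(0)|^2 and cancels.\<close>
  also have "real l + (real n - 1) * real l + (real n - 1) * (real l - real k) = ?e + ?e + real (l - k)"
    using k_le_l by (simp add: field_simps of_nat_diff)
  also have "real q powr (?e + ?e + real (l - k)) = (real q powr ?e)\<^sup>2 * real q ^ (l - k)"
    using q_pos by (simp only: powr_add power2_eq_square) (simp add: powr_realpow)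
  finally have B: "real q ^ l * (real q ^ (n - 1)) ^ l * (real q ^ (n - 1)) ^ (l - k) = (real q powr ?e)\<^sup>2 * real q ^ (l - k)" .
  have "(real q * cmod (E \<zero>))\<^sup>2 * real q ^ (l - k) =
      (real q - 1)\<^sup>2 * (real q ^ l * (real q ^ (n - 1)) ^ l * (real q ^ (n - 1)) ^ (l - k))"
    using cmod_E_zero_sq[OF triv] unfolding q_pow_n by (simp add: power_mult_distrib mult_ac)
  then have "(real q * cmod (E \<zero>))\<^sup>2 * real q ^ (l - k) = ((real q - 1) * real q powr ?e)\<^sup>2 * real q ^ (l - k)"
    unfolding B by (simp only: power_mult_distrib mult.assoc)
  then have "(real q * cmod (E \<zero>))\<^sup>2 = ((real q - 1) * real q powr ?e)\<^sup>2"
    by (rule mult_right_cancel[THEN iffD1, rotated]) (use q_pos in simp)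
  then have "real q * cmod (E \<zero>) = (real q - 1) * real q powr ?e"
    using q1 by (subst (asm) power2_eq_iff_nonneg) auto
  then show ?thesis using q1 by (simp add: field_simps)
qed

theorem eisenstein_sums:
  defines "res \<equiv> \<lambda>r. chi (\<iota> r)"
  shows
    "(\<not> trivial_character R res \<longrightarrow>
        E \<zero> = 0 \<and>
        (char_valuation R \<pi> res = k \<longrightarrow>
          cmod (E \<one>) = real q powr ((real n - 1) * (real l - real k / 2))) \<and>
        (char_valuation R \<pi> res \<noteq> k \<longrightarrow> E \<one> = 0)) \<and>
     (trivial_character R res \<longrightarrow>
        (k = 1 \<longrightarrow> cmod (E \<one>) = real q powr ((real n - 1) * real l - real n / 2)) \<and>
        (k \<noteq> 1 \<longrightarrow> E \<one> = 0) \<and>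
        cmod (E \<zero>) = (1 - 1 / real q) * real q powr ((real n - 1) * real l - (real n / 2 - 1) * real k) \<and>
        (k = 1 \<longrightarrow> E \<zero> = - (of_nat q - 1) * E \<one>))"
proof (intro conjI impI)
  define P where "P i \<longleftrightarrow> (\<forall>u \<in> principal_units R \<pi> i. res u = 1)" for i
  have val: "char_valuation R \<pi> res = (LEAST i. P i)" by (simp add: char_valuation_def P_def)
  have Pk: "P k" unfolding P_def res_def using iota_principal_units chi_k by blast
  have vP: "P (char_valuation R \<pi> res)" unfolding val using Pk by (rule LeastI)
  have vk: "char_valuation R \<pi> res \<le> k" unfolding val using Pk by (rule Least_le)
  have vl: "\<not> P i" if "i < char_valuation R \<pi> res" for i using that unfolding val by (rule not_less_Least)
  {
    assume nt: "\<not> trivial_character R res"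
    then obtain r where "r \<in> Units R" "chi (\<iota> r) \<noteq> 1" by (auto simp: trivial_character_def res_def)
    then show "E \<zero> = 0" by (rule E_zero_eq_0)
    assume "char_valuation R \<pi> res = k"
    then have "\<not> P (k - 1)" using vl k_pos by simp
    then obtain r where "r \<in> principal_units R \<pi> (k - 1)" "chi (\<iota> r) \<noteq> 1" by (auto simp: P_def res_def)
    then show "cmod (E \<one>) = real q powr ((real n - 1) * (real l - real k / 2))" by (rule cmod_E_one)
  next
    assume nt: "\<not> trivial_character R res" and "char_valuation R \<pi> res \<noteq> k"
    \<comment> \<open>Valuation 0 would mean a trivial restriction, so the level handed to
      \<open>E_one_eq_0\<close> is at least 1.\<close>
    have "char_valuation R \<pi> res \<noteq> 0"
    proof
      assume "char_valuation R \<pi> res = 0"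
      then have "P 0" using vP by simp
      then show False using nt by (auto simp: P_def trivial_character_def principal_units_def)
    qed
    then show "E \<one> = 0"
    proof (intro E_one_eq_0[of "char_valuation R \<pi> res"])
      show "char_valuation R \<pi> res < k" using vk \<open>char_valuation R \<pi> res \<noteq> k\<close> by simp
      show "chi (\<iota> u) = 1" if "u \<in> principal_units R \<pi> (char_valuation R \<pi> res)" for u
        using vP that unfolding P_def res_def by blast
    qed simp
  next
    assume t: "trivial_character R res"
    then have triv: "\<And>r. r \<in> Units R \<Longrightarrow> chi (\<iota> r) = 1" by (auto simp: trivial_character_def res_def)
    show E0: "cmod (E \<zero>) = (1 - 1 / real q) * real q powr ((real n - 1) * real l - (real n / 2 - 1) * real k)"
      using triv by (rule cmod_E_zero)
    assume k1: "k = 1"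
    show E01: "E \<zero> = - (of_nat q - 1) * E \<one>" using E_zero_eq[OF triv] k1 by simp
    \<comment> \<open>For k = 1 the layer \<pi>^(k-1) is that of 1, so |E(1)| is obtained from
      |E(0)| by dividing by q - 1.\<close>
    have "cmod (E \<zero>) = (real q - 1) * cmod (E \<one>)"
      unfolding E01 norm_mult norm_minus_cancel norm_q_minus_1 ..
    then have "(real q - 1) * cmod (E \<one>) = (1 - 1 / real q) * real q powr (((real n - 1) * real l - real n / 2) + 1)"
      using E0 k1 by (simp add: algebra_simps)
    also have "\<dots> = (real q - 1) * real q powr ((real n - 1) * real l - real n / 2)"
    proof -
      have "(1 - 1 / real q) * real q = real q - 1" using q_pos by (simp add: field_simps)
      then show ?thesis using q_pos by (simp only: powr_add) (simp add: mult_ac)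
    qed
    finally show "cmod (E \<one>) = real q powr ((real n - 1) * real l - real n / 2)" using q_gt_1 by simp
  next
    assume t: "trivial_character R res" and "k \<noteq> 1"
    then show "E \<one> = 0" using k_pos
      by (intro E_one_eq_0[of 1]) (auto simp: trivial_character_def res_def RC.principal_units_eq)
  }
qed

end

section \<open>Standard extensions\<close>

context finite_valuation_ring
begin

text \<open>A non-unit generates a proper ideal; as R is finite, a largest proper ideal contains it,
  and by uniqueness that ideal is (\<pi>).\<close>

lemma Units_eq_Diff: "Units R = carrier R - PIdl \<pi>"
proof
  interpret M: maximalideal "PIdl \<pi>" R by (rule uniformizer_maximal)
  show "Units R \<subseteq> carrier R - PIdl \<pi>"
  proof
    fix u assume u: "u \<in> Units R"
    have "u \<notin> PIdl \<pi>"
    proof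
      assume "u \<in> PIdl \<pi>"
      then have "inv u \<otimes> u \<in> PIdl \<pi>" using u by (intro M.I_l_closed) auto
      then show False using u M.one_imp_carrier M.I_notcarr by simp
    qed
    then show "u \<in> carrier R - PIdl \<pi>" using u by (simp add: Units_closed)
  qed
  show "carrier R - PIdl \<pi> \<subseteq> Units R"
  proof
    fix x assume x: "x \<in> carrier R - PIdl \<pi>"
    show "x \<in> Units R"
    proof (rule ccontr)
      assume nu: "x \<notin> Units R"
      define J where "J = {I. ideal I R \<and> x \<in> I \<and> \<one> \<notin> I}"
      have "\<one> \<notin> PIdl x"
      proof
        assume "\<one> \<in> PIdl x"
        then obtain y where "y \<in> carrier R" "\<one> = y \<otimes> x" by (auto simp: cgenideal_mem_iff)
        then have "x \<in> Units R" using x m_comm[of x y] unfolding Units_def by auto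
        then show False using nu by blast
      qed
      then have ne: "PIdl x \<in> J" using x cgenideal_ideal cgenideal_self by (auto simp: J_def)
      have "J \<subseteq> Pow (carrier R)" by (auto simp: J_def dest: ideal.Icarr)
      then have fin: "finite J" using finite_carrier by (simp add: finite_subset)
      obtain M where M: "M \<in> J" "\<And>I. I \<in> J \<Longrightarrow> M \<subseteq> I \<Longrightarrow> M = I"
        using finite_has_maximal[OF fin] ne by blast
      have "maximalideal M R"
      proof (rule maximalidealI)
        show idM: "ideal M R" using M by (simp add: J_def)
        show "carrier R \<noteq> M" using M by (auto simp: J_def)
        fix I assume I: "ideal I R" "M \<subseteq> I" "I \<subseteq> carrier R"
        show "I = M \<or> I = carrier R"
        proof (cases "\<one> \<in> I")
          case True
          then show ?thesis using ideal.one_imp_carrier[OF I(1)] by blast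
        next
          case False
          then have "I \<in> J" using I M by (auto simp: J_def)
          then show ?thesis using M(2) I by blast
        qed
      qed
      then have "M = PIdl \<pi>" using local_ring uniformizer_maximal by blast
      then show False using M x by (auto simp: J_def)
    qed
  qed
qed

text \<open>By finiteness two powers \<pi>^i and \<pi>^j with i < j coincide. Since 1 - \<pi>^(j-i)
  is a unit annihilating \<pi>^i, the latter is zero.\<close>

lemma uniformizer_nilpotent: "\<exists>i. \<pi> [^] (i::nat) = \<zero>"
proof -
  interpret M: maximalideal "PIdl \<pi>" R by (rule uniformizer_maximal)
  have "\<not> inj (\<lambda>i::nat. \<pi> [^] i)"
  proof
    assume "inj (\<lambda>i::nat. \<pi> [^] i)"
    moreover have "finite (range (\<lambda>i::nat. \<pi> [^] i))"
      using finite_carrier uniformizer_closed by (auto intro: finite_subset[of _ "carrier R"])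
    ultimately show False using finite_imageD infinite_UNIV_nat by blast
  qed
  then obtain i j :: nat where ij: "i < j" "\<pi> [^] i = \<pi> [^] j"
    by (metis (mono_tags, lifting) injI linorder_neqE_nat)
  let ?w = "\<pi> [^] (j - i)"
  have wc: "?w \<in> carrier R" and ic: "\<pi> [^] i \<in> carrier R" using uniformizer_closed by auto
  obtain d where d: "j - i = Suc d" using ij by (metis Suc_diff_Suc)
  have w: "?w \<in> PIdl \<pi>" unfolding d using uniformizer_closed by (auto simp: cgenideal_mem_iff)
  have "\<one> \<ominus> ?w \<notin> PIdl \<pi>"
  proof
    assume "\<one> \<ominus> ?w \<in> PIdl \<pi>"
    then have "(\<one> \<ominus> ?w) \<oplus> ?w \<in> PIdl \<pi>" using w M.a_closed by blast
    moreover have "(\<one> \<ominus> ?w) \<oplus> ?w = \<one>" using wc by (simp add: a_minus_def a_assoc l_neg)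
    ultimately show False using M.one_imp_carrier M.I_notcarr by simp
  qed
  then have u: "\<one> \<ominus> ?w \<in> Units R" using Units_eq_Diff wc by simp
  have "\<pi> [^] j = \<pi> [^] i \<otimes> ?w" using ij(1) uniformizer_closed by (simp add: nat_pow_mult)
  then have "\<pi> [^] i \<otimes> (\<one> \<ominus> ?w) = \<zero>"
    using ij(2) wc ic by (simp add: a_minus_def r_distr r_minus r_neg)
  then have "\<pi> [^] i \<otimes> (\<one> \<ominus> ?w) \<otimes> inv (\<one> \<ominus> ?w) = \<zero>" using u by simp
  then have "\<pi> [^] i = \<zero>" using u ic by (simp add: m_assoc Units_closed)
  then show ?thesis ..
qed

lemma chain_ring: "chain_ring R \<pi> (nilpotency_degree R \<pi>)"
proof
  let ?l = "nilpotency_degree R \<pi>"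
  interpret M: maximalideal "PIdl \<pi>" R by (rule uniformizer_maximal)
  have one: "\<one> \<noteq> \<zero>" using M.one_imp_carrier M.I_notcarr M.zero_closed by metis
  obtain i where i: "\<pi> [^] (i::nat) = \<zero>" using uniformizer_nilpotent by blast
  then have "0 < i" using one by (metis gr0I nat_pow_0)
  then have ex: "0 < ?l \<and> \<pi> [^] ?l = \<zero>"
    unfolding nilpotency_degree_def using i by (intro LeastI[of "\<lambda>m. 0 < m \<and> \<pi> [^] m = \<zero>" i]) simp
  then show "\<pi> [^] ?l = \<zero>" "0 < ?l" by auto
  show "\<pi> [^] (?l - 1) \<noteq> \<zero>"
  proof (cases "?l - 1 = 0")
    case False
    moreover have "?l - 1 < ?l" using ex by simp
    ultimately show ?thesis
      unfolding nilpotency_degree_def using not_less_Least by blast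
  qed (simp add: one)
qed (use finite_carrier uniformizer_closed Units_eq_Diff in auto)

end

text \<open>Pseudo-division scales the dividend by a power of the leading coefficient, which over a
  field can be divided off. The purpose is that irreducible polynomials then generate maximal
  ideals.\<close>

lemma (in field) UP_euclidean_domain: "euclidean_domain (UP R) (deg R)"
proof -
  interpret P: UP_domain R "UP R" by unfold_locales simp
  show ?thesis
  proof (rule P.euclidean_domainI)
    fix a b assume a: "a \<in> carrier (UP R) - {\<zero>\<^bsub>UP R\<^esub>}" and b: "b \<in> carrier (UP R) - {\<zero>\<^bsub>UP R\<^esub>}"
    let ?lc = "coeff (UP R) b (deg R b)"
    obtain q r and j :: nat where qr: "q \<in> carrier (UP R)" "r \<in> carrier (UP R)"
        "(?lc [^] j) \<odot>\<^bsub>UP R\<^esub> a = b \<otimes>\<^bsub>UP R\<^esub> q \<oplus>\<^bsub>UP R\<^esub> r" "r = \<zero>\<^bsub>UP R\<^esub> \<or> deg R r < deg R b"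
      using P.long_div_theorem[of b a] a b by auto
    have "?lc \<noteq> \<zero>" "?lc \<in> carrier R" using b P.lcoeff_nonzero2 by auto
    then have "?lc \<in> Units R" using field_Units by simp
    then have u: "?lc [^] j \<in> Units R" by (rule Units_pow_closed)
    let ?v = "inv (?lc [^] j)"
    have v: "?v \<in> carrier R" "?v \<noteq> \<zero>" "?v \<otimes> (?lc [^] j) = \<one>" using u field_Units Units_inv_Units by auto
    have lc: "?lc [^] j \<in> carrier R" using u by (rule Units_closed)
    have "a = ?v \<odot>\<^bsub>UP R\<^esub> ((?lc [^] j) \<odot>\<^bsub>UP R\<^esub> a)"
      using v(1,3) lc a by (simp add: P.UP_smult_assoc1[symmetric])
    also have "\<dots> = b \<otimes>\<^bsub>UP R\<^esub> (?v \<odot>\<^bsub>UP R\<^esub> q) \<oplus>\<^bsub>UP R\<^esub> ?v \<odot>\<^bsub>UP R\<^esub> r"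
    proof -
      have "?v \<odot>\<^bsub>UP R\<^esub> (b \<otimes>\<^bsub>UP R\<^esub> q) = b \<otimes>\<^bsub>UP R\<^esub> (?v \<odot>\<^bsub>UP R\<^esub> q)"
        using v(1) b qr P.UP_smult_assoc2[of ?v q b] by (simp add: P.UP_m_comm)
      then show ?thesis using v(1) b qr by (simp add: P.UP_smult_r_distr)
    qed
    finally have "a = b \<otimes>\<^bsub>UP R\<^esub> (?v \<odot>\<^bsub>UP R\<^esub> q) \<oplus>\<^bsub>UP R\<^esub> ?v \<odot>\<^bsub>UP R\<^esub> r" .
    moreover have "?v \<odot>\<^bsub>UP R\<^esub> r = \<zero>\<^bsub>UP R\<^esub> \<or> deg R (?v \<odot>\<^bsub>UP R\<^esub> r) < deg R b"
    proof (cases "r = \<zero>\<^bsub>UP R\<^esub>")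
      case True
      then have "?v \<odot>\<^bsub>UP R\<^esub> r = \<zero>\<^bsub>UP R\<^esub>" using v(1) by (intro P.up_eqI) auto
      then show ?thesis ..
    next
      case False
      then show ?thesis using qr P.deg_smult_decr[OF v(1) qr(2)] by auto
    qed
    ultimately show "\<exists>q r. q \<in> carrier (UP R) \<and> r \<in> carrier (UP R) \<and> a = b \<otimes>\<^bsub>UP R\<^esub> q \<oplus>\<^bsub>UP R\<^esub> r
        \<and> (r = \<zero>\<^bsub>UP R\<^esub> \<or> deg R r < deg R b)"
      using v(1) qr by (intro exI[of _ "?v \<odot>\<^bsub>UP R\<^esub> q"] exI[of _ "?v \<odot>\<^bsub>UP R\<^esub> r"]) auto
  qed
qed

section \<open>Reduction of polynomial coefficients modulo an ideal\<close>

definition reduce :: "('a, 'b) ring_scheme \<Rightarrow> 'a set \<Rightarrow> (nat \<Rightarrow> 'a) \<Rightarrow> nat \<Rightarrow> 'a set"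
  where "reduce R I p = (\<lambda>i. I +>\<^bsub>R\<^esub> coeff (UP R) p i)"

locale coefficient_reduction = cring R + I: ideal I R for R (structure) and I
begin

abbreviation "F \<equiv> R Quot I"

sublocale P: UP_cring R "UP R" by unfold_locales simp

sublocale FP: UP_cring F "UP F"
  by (intro UP_cring.intro I.quotient_is_cring is_cring)

sublocale rc: ring_hom_cring R F "(+>) I"
  by (rule I.rcos_ring_hom_cring[OF is_cring])

lemma coset_zero: "x \<in> carrier R \<Longrightarrow> I +> x = \<zero>\<^bsub>F\<^esub> \<longleftrightarrow> x \<in> I"
  by (rule I.coset_eq_zero_iff)

lemma mem_UP_I:
  assumes "\<And>i. g i \<in> carrier R" "\<And>i. i > N \<Longrightarrow> g i = \<zero>"
  shows "g \<in> carrier (UP R)" "\<And>i. coeff (UP R) g i = g i"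
proof -
  have "g \<in> up R" using assms by (intro mem_upI exI[of _ N] bound.intro) auto
  then show "g \<in> carrier (UP R)" "\<And>i. coeff (UP R) g i = g i" by (auto simp: UP_def)
qed

lemma reduce_closed:
  assumes p: "p \<in> carrier (UP R)"
  shows "reduce R I p \<in> carrier (UP F)" "\<And>i. coeff (UP F) (reduce R I p) i = I +> coeff (UP R) p i"
proof -
  have "bound \<zero>\<^bsub>F\<^esub> (deg R p) (reduce R I p)"
  proof
    fix i assume "deg R p < i"
    then have "coeff (UP R) p i = \<zero>" using P.deg_aboveD p by blast
    then show "reduce R I p i = \<zero>\<^bsub>F\<^esub>" by (simp add: reduce_def)
  qed
  moreover have "reduce R I p i \<in> carrier F" for i
    unfolding reduce_def using p by (intro rc.hom_closed) auto
  ultimately have "reduce R I p \<in> up F" by (intro mem_upI) auto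
  then show "reduce R I p \<in> carrier (UP F)" "\<And>i. coeff (UP F) (reduce R I p) i = I +> coeff (UP R) p i"
    by (auto simp: UP_def reduce_def)
qed

lemma reduce_hom: "reduce R I \<in> ring_hom (UP R) (UP F)"
proof (rule ring_hom_memI)
  fix p q assume pq: "p \<in> carrier (UP R)" "q \<in> carrier (UP R)"
  show "reduce R I p \<in> carrier (UP F)" using reduce_closed pq by blast
  show "reduce R I (p \<otimes>\<^bsub>UP R\<^esub> q) = reduce R I p \<otimes>\<^bsub>UP F\<^esub> reduce R I q"
  proof (rule FP.up_eqI)
    fix m
    have "I +> (\<Oplus>i\<in>{..m}. coeff (UP R) p i \<otimes> coeff (UP R) q (m - i)) =
        (\<Oplus>\<^bsub>F\<^esub>i\<in>{..m}. (I +> coeff (UP R) p i) \<otimes>\<^bsub>F\<^esub> (I +> coeff (UP R) q (m - i)))"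
      using pq by (subst rc.hom_finsum) (auto intro!: FP.R.finsum_cong' simp: comp_def)
    then show "coeff (UP F) (reduce R I (p \<otimes>\<^bsub>UP R\<^esub> q)) m = coeff (UP F) (reduce R I p \<otimes>\<^bsub>UP F\<^esub> reduce R I q) m"
      using pq reduce_closed by simp
  qed (use pq reduce_closed in auto)
  show "reduce R I (p \<oplus>\<^bsub>UP R\<^esub> q) = reduce R I p \<oplus>\<^bsub>UP F\<^esub> reduce R I q"
    by (rule FP.up_eqI) (use pq reduce_closed in auto)
next
  show "reduce R I \<one>\<^bsub>UP R\<^esub> = \<one>\<^bsub>UP F\<^esub>"
    by (rule FP.up_eqI) (use reduce_closed[of "\<one>\<^bsub>UP R\<^esub>"] in auto)
qed

sublocale red: ring_hom_cring "UP R" "UP F" "reduce R I"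
  by (intro ring_hom_cring.intro ring_hom_cring_axioms.intro reduce_hom P.UP_cring FP.UP_cring)

text \<open>Coefficientwise lifting. Above the degree the representative is forced to be zero, since
  an arbitrary choice from the zero coset would not give a polynomial.\<close>

lemma reduce_surj:
  assumes g: "g \<in> carrier (UP F)"
  shows "\<exists>p \<in> carrier (UP R). reduce R I p = g"
proof -
  have "\<exists>x. x \<in> carrier R \<and> coeff (UP F) g i = I +> x \<and> (deg F g < i \<longrightarrow> x = \<zero>)" for i
  proof (cases "deg F g < i")
    case True
    then show ?thesis using FP.deg_aboveD g by (intro exI[of _ \<zero>]) auto
  next
    case False
    have "\<exists>x\<in>carrier R. coeff (UP F) g i = I +> x" using g by (intro I.Quot_carrier_coset) simp
    then show ?thesis using False by blast
  qed
  then obtain x where x: "\<And>i. x i \<in> carrier R" "\<And>i. coeff (UP F) g i = I +> x i" "\<And>i. deg F g < i \<Longrightarrow> x i = \<zero>"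
    by metis
  have xp: "x \<in> carrier (UP R)" "\<And>i. coeff (UP R) x i = x i" using mem_UP_I[of x "deg F g"] x by auto
  have "reduce R I x = g" by (rule FP.up_eqI) (use g xp x reduce_closed in auto)
  then show ?thesis using xp by blast
qed

lemma reduce_eq_zero:
  assumes p: "p \<in> carrier (UP R)" and I: "I = PIdl c" "c \<in> carrier R" and z: "reduce R I p = \<zero>\<^bsub>UP F\<^esub>"
  shows "\<exists>t \<in> carrier (UP R). p = monom (UP R) c 0 \<otimes>\<^bsub>UP R\<^esub> t"
proof -
  have "\<exists>x. x \<in> carrier R \<and> coeff (UP R) p i = c \<otimes> x \<and> (deg R p < i \<longrightarrow> x = \<zero>)" for i
  proof (cases "deg R p < i")
    case True
    then show ?thesis using P.deg_aboveD p I by (intro exI[of _ \<zero>]) auto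
  next
    case False
    have "I +> coeff (UP R) p i = \<zero>\<^bsub>F\<^esub>" using reduce_closed(2)[OF p, of i] z by simp
    then have "coeff (UP R) p i \<in> PIdl c" using coset_zero p I by simp
    then show ?thesis using False I m_comm by (auto simp: cgenideal_mem_iff)
  qed
  then obtain x where x: "\<And>i. x i \<in> carrier R" "\<And>i. coeff (UP R) p i = c \<otimes> x i" "\<And>i. deg R p < i \<Longrightarrow> x i = \<zero>"
    by metis
  have xp: "x \<in> carrier (UP R)" "\<And>i. coeff (UP R) x i = x i" using mem_UP_I[of x "deg R p"] x by auto
  have "p = monom (UP R) c 0 \<otimes>\<^bsub>UP R\<^esub> x"
    by (rule P.up_eqI) (use p xp x I in \<open>auto simp: P.monom_mult_is_smult\<close>)
  then show ?thesis using xp by blast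
qed

end

section \<open>The quotient ring S and its units\<close>

context standard_extension
begin

abbreviation S :: "(nat \<Rightarrow> 'a) set ring" where "S \<equiv> ext_ring R f"
abbreviation \<iota> :: "'a \<Rightarrow> (nat \<Rightarrow> 'a) set" where "\<iota> \<equiv> ext_incl R f"
abbreviation \<xi> :: "(nat \<Rightarrow> 'a) set" where "\<xi> \<equiv> ext_gen R f"
abbreviation cls :: "(nat \<Rightarrow> 'a) \<Rightarrow> (nat \<Rightarrow> 'a) set" where "cls \<equiv> (+>\<^bsub>UP R\<^esub>) (PIdl\<^bsub>UP R\<^esub> f)"

sublocale CR: coefficient_reduction R "PIdl \<pi>"
  by (intro coefficient_reduction.intro is_cring cgenideal_ideal uniformizer_closed)

lemma residue_ring_eq: "residue_ring_of R \<pi> = R Quot PIdl \<pi>"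
  by (simp add: residue_ring_of_def)

lemma residue_field: "field (R Quot PIdl \<pi>)"
  by (rule maximalideal.quotient_is_field[OF uniformizer_maximal is_cring])

lemma ideal_f: "ideal (PIdl\<^bsub>UP R\<^esub> f) (UP R)"
  by (rule CR.P.cgenideal_ideal[OF f_closed])

sublocale Q: ring_hom_cring "UP R" S cls
  unfolding ext_ring_def by (rule ideal.rcos_ring_hom_cring[OF ideal_f CR.P.UP_cring])

lemma cls_eq_zero: "p \<in> carrier (UP R) \<Longrightarrow> cls p = \<zero>\<^bsub>S\<^esub> \<longleftrightarrow> p \<in> PIdl\<^bsub>UP R\<^esub> f"
  unfolding ext_ring_def by (rule ideal.coset_eq_zero_iff[OF ideal_f])

lemma cls_surj: "s \<in> carrier S \<Longrightarrow> \<exists>p\<in>carrier (UP R). s = cls p"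
  unfolding ext_ring_def by (rule ideal.Quot_carrier_coset[OF ideal_f])

lemma cls_f: "cls f = \<zero>\<^bsub>S\<^esub>"
  using cls_eq_zero[OF f_closed] CR.P.cgenideal_self[OF f_closed] by simp

lemma incl_eq: "\<iota> r = cls (monom (UP R) r 0)"
  by (simp add: ext_incl_def)

sublocale inc: ring_hom_cring R S \<iota>
proof (intro ring_hom_cring.intro ring_hom_cring_axioms.intro is_cring Q.S.is_cring)
  show "\<iota> \<in> ring_hom R S"
    using ring_hom_trans[OF CR.P.const_ring_hom Q.homh] by (simp add: incl_eq[abs_def] comp_def)
qed

lemma xi_closed: "\<xi> \<in> carrier S"
  unfolding ext_gen_def by (intro Q.hom_closed CR.P.monom_closed) simp

lemma cls_monom:
  assumes r: "r \<in> carrier R"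
  shows "cls (monom (UP R) r i) = \<iota> r \<otimes>\<^bsub>S\<^esub> \<xi> [^]\<^bsub>S\<^esub> i"
proof -
  have "monom (UP R) r i = monom (UP R) r 0 \<otimes>\<^bsub>UP R\<^esub> monom (UP R) \<one> i"
    using CR.P.monom_mult[of r \<one> 0 i] r by simp
  also have "monom (UP R) \<one> i = monom (UP R) \<one> 1 [^]\<^bsub>UP R\<^esub> i"
    using CR.P.monom_pow[of \<one> 1 i] by simp
  finally have "cls (monom (UP R) r i) = cls (monom (UP R) r 0) \<otimes>\<^bsub>S\<^esub> cls (monom (UP R) \<one> 1) [^]\<^bsub>S\<^esub> i"
    using r by (simp del: CR.P.monom_mult)
  then show ?thesis by (simp only: ext_incl_def ext_gen_def)
qed

lemma cls_sum:
  assumes p: "p \<in> carrier (UP R)" and d: "deg R p \<le> d"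
  shows "cls p = (\<Oplus>\<^bsub>S\<^esub>i\<in>{..d}. \<iota> (coeff (UP R) p i) \<otimes>\<^bsub>S\<^esub> \<xi> [^]\<^bsub>S\<^esub> i)"
proof -
  have "cls p = cls (\<Oplus>\<^bsub>UP R\<^esub>i\<in>{..d}. monom (UP R) (coeff (UP R) p i) i)"
    using CR.P.up_repr_le[OF d p] by simp
  also have "\<dots> = (\<Oplus>\<^bsub>S\<^esub>i\<in>{..d}. cls (monom (UP R) (coeff (UP R) p i) i))"
    using p by (subst Q.hom_finsum) (auto simp: comp_def)
  also have "\<dots> = (\<Oplus>\<^bsub>S\<^esub>i\<in>{..d}. \<iota> (coeff (UP R) p i) \<otimes>\<^bsub>S\<^esub> \<xi> [^]\<^bsub>S\<^esub> i)"
    using p by (intro Q.S.finsum_cong') (auto simp: cls_monom xi_closed)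
  finally show ?thesis .
qed

text \<open>A monic polynomial of degree 0 is 1, a unit, and units are not irreducible.\<close>

lemma n_pos: "0 < n"
proof (rule ccontr)
  interpret F: field "R Quot PIdl \<pi>" by (rule residue_field)
  interpret FP: UP_domain "R Quot PIdl \<pi>" "UP (R Quot PIdl \<pi>)" by unfold_locales
  assume "\<not> 0 < n"
  then have n: "n = 0" by simp
  have "fbar = monom (UP (R Quot PIdl \<pi>)) (coeff (UP (R Quot PIdl \<pi>)) fbar 0) 0"
    using CR.FP.deg_zero_impl_monom[of fbar] fbar_closed fbar_deg n unfolding residue_ring_eq by simp
  then have "fbar = \<one>\<^bsub>UP (R Quot PIdl \<pi>)\<^esub>" using fbar_monic n unfolding residue_ring_eq by simp
  then have "fbar \<in> Units (UP (R Quot PIdl \<pi>))" by simp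
  then show False
    using FP.ring_irreducibleE(4)[of fbar] fbar_closed fbar_irreducible unfolding residue_ring_eq by blast
qed

lemma cls_sum_less:
  assumes p: "p \<in> carrier (UP R)" and z: "\<And>i. n \<le> i \<Longrightarrow> coeff (UP R) p i = \<zero>"
  shows "cls p = (\<Oplus>\<^bsub>S\<^esub>i\<in>{..<n}. \<iota> (coeff (UP R) p i) \<otimes>\<^bsub>S\<^esub> \<xi> [^]\<^bsub>S\<^esub> i)"
proof -
  have "deg R p \<le> n - 1" using p z by (intro CR.P.deg_aboveI) auto
  moreover have "{..n - 1} = {..<n}" using n_pos by auto
  ultimately show ?thesis using cls_sum[OF p, of "n - 1"] by simp
qed

text \<open>Because f is monic, the leading coefficient of g reappears unchanged in degree deg g +
  n, whatever zero divisors R has.\<close>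

lemma multiple_small_zero:
  assumes g: "g \<in> carrier (UP R)" and z: "\<And>i. n \<le> i \<Longrightarrow> coeff (UP R) (g \<otimes>\<^bsub>UP R\<^esub> f) i = \<zero>"
  shows "g \<otimes>\<^bsub>UP R\<^esub> f = \<zero>\<^bsub>UP R\<^esub>"
proof (cases "g = \<zero>\<^bsub>UP R\<^esub>")
  case True
  then show ?thesis using f_closed by simp
next
  case False
  let ?d = "deg R g"
  have "coeff (UP R) (g \<otimes>\<^bsub>UP R\<^esub> f) (?d + n) = (\<Oplus>i\<in>{..?d + n}. coeff (UP R) g i \<otimes> coeff (UP R) f (?d + n - i))"
    using g f_closed by simp
  also have "\<dots> = (\<Oplus>i\<in>{..?d + n}. if ?d = i then coeff (UP R) g i \<otimes> \<one> else \<zero>)"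
  proof (intro finsum_cong')
    fix i assume i: "i \<in> {..?d + n}"
    show "coeff (UP R) g i \<otimes> coeff (UP R) f (?d + n - i) = (if ?d = i then coeff (UP R) g i \<otimes> \<one> else \<zero>)"
    proof (cases "?d < i")
      case True
      then show ?thesis using CR.P.deg_aboveD[OF True g] f_closed by simp
    next
      case ge: False
      show ?thesis
      proof (cases "?d = i")
        case True
        then show ?thesis using f_monic by simp
      next
        case False
        then have "deg R f < ?d + n - i" using ge f_deg by simp
        then show ?thesis using CR.P.deg_aboveD[OF _ f_closed] False g by simp
      qed
    qed
  qed (use g in auto)
  also have "\<dots> = coeff (UP R) g ?d" using g by (subst finsum_singleton) auto
  finally have "coeff (UP R) g ?d = \<zero>" using z[of "?d + n"] by simp
  then show ?thesis using CR.P.lcoeff_nonzero2[OF g False] by simp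
qed

lemma unique_coords:
  assumes s: "s \<in> carrier S"
  shows "\<exists>!c. c \<in> {..<n} \<rightarrow>\<^sub>E carrier R \<and> s = (\<Oplus>\<^bsub>S\<^esub>i\<in>{..<n}. \<iota> (c i) \<otimes>\<^bsub>S\<^esub> \<xi> [^]\<^bsub>S\<^esub> i)"
proof (rule ex_ex1I)
  obtain p where p: "p \<in> carrier (UP R)" "s = cls p" using cls_surj[OF s] by blast
  have "\<one> \<noteq> \<zero>" by (rule chain_ring.one_not_zero[OF chain_ring])
  then have f0: "f \<noteq> \<zero>\<^bsub>UP R\<^esub>" using f_monic by auto
  obtain q r and j :: nat where qr: "q \<in> carrier (UP R)" "r \<in> carrier (UP R)"
      "(coeff (UP R) f (deg R f) [^] j) \<odot>\<^bsub>UP R\<^esub> p = f \<otimes>\<^bsub>UP R\<^esub> q \<oplus>\<^bsub>UP R\<^esub> r" "r = \<zero>\<^bsub>UP R\<^esub> \<or> deg R r < deg R f"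
    using CR.P.long_div_theorem[OF f_closed p(1) f0] by blast
  \<comment> \<open>The pseudo-division scales p by a power of the leading coefficient of f, which
    is 1.\<close>
  have "p = f \<otimes>\<^bsub>UP R\<^esub> q \<oplus>\<^bsub>UP R\<^esub> r" using qr(3) f_deg f_monic p by simp
  then have "s = cls r" using p qr f_closed cls_f by simp
  moreover have rz: "coeff (UP R) r i = \<zero>" if "n \<le> i" for i
    using qr(4)
  proof
    assume "deg R r < deg R f"
    then show ?thesis using that f_deg qr(2) by (intro CR.P.deg_aboveD) auto
  qed simp
  ultimately have "s = (\<Oplus>\<^bsub>S\<^esub>i\<in>{..<n}. \<iota> (coeff (UP R) r i) \<otimes>\<^bsub>S\<^esub> \<xi> [^]\<^bsub>S\<^esub> i)"
    using cls_sum_less[OF qr(2)] by simp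
  also have "\<dots> = (\<Oplus>\<^bsub>S\<^esub>i\<in>{..<n}. \<iota> (restrict (coeff (UP R) r) {..<n} i) \<otimes>\<^bsub>S\<^esub> \<xi> [^]\<^bsub>S\<^esub> i)"
    using qr(2) xi_closed by (intro Q.S.finsum_cong') auto
  finally show "\<exists>c. c \<in> {..<n} \<rightarrow>\<^sub>E carrier R \<and> s = (\<Oplus>\<^bsub>S\<^esub>i\<in>{..<n}. \<iota> (c i) \<otimes>\<^bsub>S\<^esub> \<xi> [^]\<^bsub>S\<^esub> i)"
    using qr(2) by (intro exI[of _ "restrict (coeff (UP R) r) {..<n}"]) auto
next
  fix c c'
  assume c: "c \<in> {..<n} \<rightarrow>\<^sub>E carrier R \<and> s = (\<Oplus>\<^bsub>S\<^esub>i\<in>{..<n}. \<iota> (c i) \<otimes>\<^bsub>S\<^esub> \<xi> [^]\<^bsub>S\<^esub> i)"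
    and c': "c' \<in> {..<n} \<rightarrow>\<^sub>E carrier R \<and> s = (\<Oplus>\<^bsub>S\<^esub>i\<in>{..<n}. \<iota> (c' i) \<otimes>\<^bsub>S\<^esub> \<xi> [^]\<^bsub>S\<^esub> i)"
  define pol where "pol c = (\<lambda>i. if i < n then c i else \<zero>)" for c :: "nat \<Rightarrow> 'a"
  have pol: "pol d \<in> carrier (UP R)" "\<And>i. coeff (UP R) (pol d) i = pol d i"
    if "d \<in> {..<n} \<rightarrow>\<^sub>E carrier R" for d
  proof -
    have "pol d i \<in> carrier R" for i using that by (auto simp: pol_def)
    moreover have "pol d i = \<zero>" if "i > n" for i using that by (simp add: pol_def)
    ultimately show "pol d \<in> carrier (UP R)" "\<And>i. coeff (UP R) (pol d) i = pol d i"
      using CR.mem_UP_I[of "pol d" n] by blast+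
  qed
  have cls_pol: "cls (pol d) = (\<Oplus>\<^bsub>S\<^esub>i\<in>{..<n}. \<iota> (d i) \<otimes>\<^bsub>S\<^esub> \<xi> [^]\<^bsub>S\<^esub> i)"
    if d: "d \<in> {..<n} \<rightarrow>\<^sub>E carrier R" for d
  proof -
    have "cls (pol d) = (\<Oplus>\<^bsub>S\<^esub>i\<in>{..<n}. \<iota> (pol d i) \<otimes>\<^bsub>S\<^esub> \<xi> [^]\<^bsub>S\<^esub> i)"
      using cls_sum_less[OF pol(1)[OF d]] pol(2)[OF d] by (simp add: pol_def)
    also have "\<dots> = (\<Oplus>\<^bsub>S\<^esub>i\<in>{..<n}. \<iota> (d i) \<otimes>\<^bsub>S\<^esub> \<xi> [^]\<^bsub>S\<^esub> i)"
      using d xi_closed by (intro Q.S.finsum_cong') (auto simp: pol_def)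
    finally show ?thesis .
  qed
  \<comment> \<open>Two coordinate families of the same element differ by a multiple of f without
    coefficients from n on, which must be zero.\<close>
  let ?w = "pol c \<ominus>\<^bsub>UP R\<^esub> pol c'"
  have pc: "pol c \<in> carrier (UP R)" "pol c' \<in> carrier (UP R)" using pol c c' by auto
  then have w: "?w \<in> carrier (UP R)" by simp
  have "cls (pol c) = cls (pol c')" using cls_pol c c' by simp
  then have "cls ?w = \<zero>\<^bsub>S\<^esub>" using pc by (simp add: a_minus_def Q.S.r_neg)
  then obtain g where g: "g \<in> carrier (UP R)" "?w = g \<otimes>\<^bsub>UP R\<^esub> f"
    using cls_eq_zero[OF w] by (auto simp: CR.P.cgenideal_mem_iff)
  have co: "coeff (UP R) ?w i = pol c i \<ominus> pol c' i" for i
    using pc pol(2) c c' CR.P.coeff_minus[OF pc] by simp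
  have "coeff (UP R) ?w i = \<zero>" if "n \<le> i" for i
    using that unfolding co by (simp add: pol_def a_minus_def)
  then have "?w = \<zero>\<^bsub>UP R\<^esub>" using multiple_small_zero[OF g(1)] g(2) by simp
  then have eq: "pol c i \<ominus> pol c' i = \<zero>" for i using co[of i] by simp
  show "c = c'"
  proof (rule PiE_ext)
    show "c \<in> {..<n} \<rightarrow>\<^sub>E carrier R" "c' \<in> {..<n} \<rightarrow>\<^sub>E carrier R" using c c' by auto
    fix i assume i: "i \<in> {..<n}"
    then have "c i \<in> carrier R" "c' i \<in> carrier R" using c c' by auto
    then show "c i = c' i" using eq[of i] i by (simp add: pol_def)
  qed
qed

lemma xi_relation:
  "\<xi> [^]\<^bsub>S\<^esub> n \<oplus>\<^bsub>S\<^esub> (\<Oplus>\<^bsub>S\<^esub>i\<in>{..<n}. \<iota> (coeff (UP R) f i) \<otimes>\<^bsub>S\<^esub> \<xi> [^]\<^bsub>S\<^esub> i) = \<zero>\<^bsub>S\<^esub>"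
proof -
  have "\<zero>\<^bsub>S\<^esub> = (\<Oplus>\<^bsub>S\<^esub>i\<in>{..n}. \<iota> (coeff (UP R) f i) \<otimes>\<^bsub>S\<^esub> \<xi> [^]\<^bsub>S\<^esub> i)"
    using cls_sum[OF f_closed, of n] cls_f f_deg by simp
  also have "{..n} = insert n {..<n}" by auto
  also have "(\<Oplus>\<^bsub>S\<^esub>i\<in>insert n {..<n}. \<iota> (coeff (UP R) f i) \<otimes>\<^bsub>S\<^esub> \<xi> [^]\<^bsub>S\<^esub> i) =
      \<iota> (coeff (UP R) f n) \<otimes>\<^bsub>S\<^esub> \<xi> [^]\<^bsub>S\<^esub> n \<oplus>\<^bsub>S\<^esub> (\<Oplus>\<^bsub>S\<^esub>i\<in>{..<n}. \<iota> (coeff (UP R) f i) \<otimes>\<^bsub>S\<^esub> \<xi> [^]\<^bsub>S\<^esub> i)"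
    using f_closed xi_closed by (intro Q.S.finsum_insert) auto
  finally show ?thesis using f_monic xi_closed by simp
qed

sublocale PB: power_basis R S \<iota> \<xi> n "coeff (UP R) f"
  using xi_closed n_pos f_closed xi_relation unique_coords
  by unfold_locales auto

lemma incl_inj: "r \<in> carrier R \<Longrightarrow> \<iota> r = \<zero>\<^bsub>S\<^esub> \<Longrightarrow> r = \<zero>"
  using PB.coords_monom[of r 0 0] PB.coords_zero[of 0] n_pos by simp

lemma ext_trace_eq: "ext_trace R f s = PB.Tr s"
  unfolding ext_trace_def PB.Tr_def mult_matrix_def ext_coords_def PB.coords_def f_deg ..

lemma reduce_f: "reduce R (PIdl \<pi>) f = fbar"
  by (rule CR.FP.up_eqI)
    (use CR.reduce_closed[OF f_closed] f_reduces fbar_closed in \<open>auto simp: residue_ring_eq\<close>)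

text \<open>If p reduces to h times fbar and v lifts h, then p - v f reduces to zero and so is a
  multiple of \<pi>. Hence the map from S to the polynomials over the residue field modulo fbar has
  kernel \<pi> S.\<close>

lemma lift_congruence:
  assumes p: "p \<in> carrier (UP R)" and "reduce R (PIdl \<pi>) p \<in> PIdl\<^bsub>UP (R Quot PIdl \<pi>)\<^esub> fbar"
  shows "\<exists>t\<in>carrier S. cls p = \<iota> \<pi> \<otimes>\<^bsub>S\<^esub> t"
proof -
  obtain h where h: "h \<in> carrier (UP (R Quot PIdl \<pi>))" "reduce R (PIdl \<pi>) p = h \<otimes>\<^bsub>UP (R Quot PIdl \<pi>)\<^esub> fbar"
    using assms(2) by (auto simp: CR.FP.cgenideal_mem_iff)
  obtain v where v: "v \<in> carrier (UP R)" "reduce R (PIdl \<pi>) v = h" using CR.reduce_surj[OF h(1)] by blast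
  let ?w = "p \<ominus>\<^bsub>UP R\<^esub> v \<otimes>\<^bsub>UP R\<^esub> f"
  have w: "?w \<in> carrier (UP R)" using p v f_closed by simp
  have "reduce R (PIdl \<pi>) ?w = \<zero>\<^bsub>UP (R Quot PIdl \<pi>)\<^esub>"
    using p v f_closed h CR.reduce_closed[OF p] by (simp add: a_minus_def reduce_f CR.FP.r_neg)
  then obtain t where t: "t \<in> carrier (UP R)" "?w = monom (UP R) \<pi> 0 \<otimes>\<^bsub>UP R\<^esub> t"
    using CR.reduce_eq_zero[OF w refl uniformizer_closed] by blast
  have "cls ?w = cls p" using p v f_closed cls_f by (simp add: a_minus_def)
  then have "cls p = \<iota> \<pi> \<otimes>\<^bsub>S\<^esub> cls t" using t uniformizer_closed by (simp add: incl_eq)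
  then show ?thesis using t by blast
qed

text \<open>Multiples of \<pi> are nilpotent, hence not units. Outside \<pi> S the reduction is
  non-zero in the field defined by the irreducible fbar; lifting an inverse gives s v = 1 + \<pi> t,
  a unit because \<pi> t is nilpotent.\<close>

lemma ext_Units_eq: "Units S = carrier S - PIdl\<^bsub>S\<^esub> (\<iota> \<pi>)"
proof
  let ?l = "nilpotency_degree R \<pi>"
  let ?F = "R Quot PIdl \<pi>"
  interpret RC: chain_ring R \<pi> ?l by (rule chain_ring)
  have \<pi>S: "\<iota> \<pi> \<in> carrier S" using uniformizer_closed by simp
  have nil: "\<iota> \<pi> [^]\<^bsub>S\<^esub> ?l = \<zero>\<^bsub>S\<^esub>"
    using uniformizer_closed RC.p_pow_m by (metis inc.hom_pow inc.hom_zero)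
  have nilm: "(\<iota> \<pi> \<otimes>\<^bsub>S\<^esub> t) [^]\<^bsub>S\<^esub> ?l = \<zero>\<^bsub>S\<^esub>" if "t \<in> carrier S" for t
    using that \<pi>S nil by (simp add: Q.S.nat_pow_distrib)
  show "Units S \<subseteq> carrier S - PIdl\<^bsub>S\<^esub> (\<iota> \<pi>)"
  proof
    fix u assume u: "u \<in> Units S"
    have "u \<notin> PIdl\<^bsub>S\<^esub> (\<iota> \<pi>)"
    proof
      assume "u \<in> PIdl\<^bsub>S\<^esub> (\<iota> \<pi>)"
      then obtain t where "t \<in> carrier S" "u = \<iota> \<pi> \<otimes>\<^bsub>S\<^esub> t"
        using Q.S.m_comm[OF \<pi>S] by (auto simp: Q.S.cgenideal_mem_iff)
      then have "u [^]\<^bsub>S\<^esub> ?l = \<zero>\<^bsub>S\<^esub>" using nilm by simp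
      then have "\<zero>\<^bsub>S\<^esub> \<in> Units S" using Q.S.Units_pow_closed[OF u, of ?l] by simp
      then have "\<one>\<^bsub>S\<^esub> = \<zero>\<^bsub>S\<^esub>" using Q.S.Units_r_inv_ex[of "\<zero>\<^bsub>S\<^esub>"] by auto
      then show False using incl_inj[of \<one>] RC.one_not_zero by simp
    qed
    then show "u \<in> carrier S - PIdl\<^bsub>S\<^esub> (\<iota> \<pi>)" using u by (simp add: Q.S.Units_closed)
  qed
  show "carrier S - PIdl\<^bsub>S\<^esub> (\<iota> \<pi>) \<subseteq> Units S"
  proof
    fix s assume s: "s \<in> carrier S - PIdl\<^bsub>S\<^esub> (\<iota> \<pi>)"
    obtain p where p: "p \<in> carrier (UP R)" "s = cls p" using cls_surj s by blast
    let ?g = "reduce R (PIdl \<pi>) p"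
    have gc: "?g \<in> carrier (UP ?F)" using CR.reduce_closed p by blast
    have "?g \<notin> PIdl\<^bsub>UP ?F\<^esub> fbar"
    proof
      assume "?g \<in> PIdl\<^bsub>UP ?F\<^esub> fbar"
      then obtain t where "t \<in> carrier S" "s = \<iota> \<pi> \<otimes>\<^bsub>S\<^esub> t" using lift_congruence p by blast
      then have "s \<in> PIdl\<^bsub>S\<^esub> (\<iota> \<pi>)" using Q.S.m_comm[OF \<pi>S] by (auto simp: Q.S.cgenideal_mem_iff)
      then show False using s by blast
    qed
    have fb: "fbar \<in> carrier (UP ?F)" "ring_irreducible\<^bsub>UP ?F\<^esub> fbar"
      using fbar_closed fbar_irreducible by (simp_all add: residue_ring_eq)
    interpret E: euclidean_domain "UP ?F" "deg ?F" by (rule field.UP_euclidean_domain[OF residue_field])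
    have mx: "maximalideal (PIdl\<^bsub>UP ?F\<^esub> fbar) (UP ?F)" by (rule E.irreducible_imp_maximalideal[OF fb])
    interpret M: maximalideal "PIdl\<^bsub>UP ?F\<^esub> fbar" "UP ?F" by (rule mx)
    have "\<exists>h\<in>carrier (UP ?F). ?g \<otimes>\<^bsub>UP ?F\<^esub> h \<ominus>\<^bsub>UP ?F\<^esub> \<one>\<^bsub>UP ?F\<^esub> \<in> PIdl\<^bsub>UP ?F\<^esub> fbar"
    proof -
      let ?K = "UP ?F Quot PIdl\<^bsub>UP ?F\<^esub> fbar"
      let ?c = "(+>\<^bsub>UP ?F\<^esub>) (PIdl\<^bsub>UP ?F\<^esub> fbar)"
      interpret K: field ?K by (rule M.quotient_is_field[OF CR.FP.UP_cring])
      have hom: "?c \<in> ring_hom (UP ?F) ?K" by (rule M.rcos_ring_hom)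
      have "?c ?g \<noteq> \<zero>\<^bsub>?K\<^esub>" using M.coset_eq_zero_iff[OF gc] \<open>?g \<notin> PIdl\<^bsub>UP ?F\<^esub> fbar\<close> by blast
      then have "?c ?g \<in> Units ?K" using K.field_Units ring_hom_closed[OF hom gc] by blast
      then obtain y where y: "y \<in> carrier ?K" "?c ?g \<otimes>\<^bsub>?K\<^esub> y = \<one>\<^bsub>?K\<^esub>" using K.Units_r_inv_ex by blast
      obtain h where h: "h \<in> carrier (UP ?F)" "y = ?c h" using M.Quot_carrier_coset[OF y(1)] by blast
      interpret c: ring_hom_cring "UP ?F" ?K ?c by (rule M.rcos_ring_hom_cring[OF CR.FP.UP_cring])
      have "?c (?g \<otimes>\<^bsub>UP ?F\<^esub> h \<ominus>\<^bsub>UP ?F\<^esub> \<one>\<^bsub>UP ?F\<^esub>) = ?c ?g \<otimes>\<^bsub>?K\<^esub> ?c h \<ominus>\<^bsub>?K\<^esub> \<one>\<^bsub>?K\<^esub>"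
        using gc h by (simp add: a_minus_def)
      also have "\<dots> = \<zero>\<^bsub>?K\<^esub>" using y h by (simp add: a_minus_def K.r_neg)
      finally show ?thesis
        using M.coset_eq_zero_iff[of "?g \<otimes>\<^bsub>UP ?F\<^esub> h \<ominus>\<^bsub>UP ?F\<^esub> \<one>\<^bsub>UP ?F\<^esub>"] gc h
        by (intro bexI[of _ h]) auto
    qed
    then obtain h where h: "h \<in> carrier (UP ?F)" "?g \<otimes>\<^bsub>UP ?F\<^esub> h \<ominus>\<^bsub>UP ?F\<^esub> \<one>\<^bsub>UP ?F\<^esub> \<in> PIdl\<^bsub>UP ?F\<^esub> fbar"
      by blast
    obtain v where v: "v \<in> carrier (UP R)" "reduce R (PIdl \<pi>) v = h" using CR.reduce_surj[OF h(1)] by blast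
    let ?w = "p \<otimes>\<^bsub>UP R\<^esub> v \<ominus>\<^bsub>UP R\<^esub> \<one>\<^bsub>UP R\<^esub>"
    have "reduce R (PIdl \<pi>) ?w = ?g \<otimes>\<^bsub>UP ?F\<^esub> h \<ominus>\<^bsub>UP ?F\<^esub> \<one>\<^bsub>UP ?F\<^esub>"
      using p v by (simp add: a_minus_def)
    then obtain t where t: "t \<in> carrier S" "cls ?w = \<iota> \<pi> \<otimes>\<^bsub>S\<^esub> t"
      using lift_congruence[of ?w] h p v by auto
    have vc: "cls v \<in> carrier S" "s \<in> carrier S" using v s by auto
    have "cls ?w = s \<otimes>\<^bsub>S\<^esub> cls v \<ominus>\<^bsub>S\<^esub> \<one>\<^bsub>S\<^esub>" using p v by (simp add: a_minus_def)
    then have "\<one>\<^bsub>S\<^esub> \<oplus>\<^bsub>S\<^esub> \<iota> \<pi> \<otimes>\<^bsub>S\<^esub> t = \<one>\<^bsub>S\<^esub> \<oplus>\<^bsub>S\<^esub> (s \<otimes>\<^bsub>S\<^esub> cls v \<ominus>\<^bsub>S\<^esub> \<one>\<^bsub>S\<^esub>)" using t by simp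
    also have "\<dots> = s \<otimes>\<^bsub>S\<^esub> cls v"
      using vc by (simp add: a_minus_def Q.S.a_lcomm[of "\<one>\<^bsub>S\<^esub>"] Q.S.r_neg)
    finally have "s \<otimes>\<^bsub>S\<^esub> cls v \<in> Units S"
      using Q.S.one_add_nilpotent_Unit[OF _ nilm[OF t(1)]] t \<pi>S by simp
    then show "s \<in> Units S" using Q.S.unit_factor vc by blast
  qed
qed

lemma ext_chain_ring: "chain_ring S (\<iota> \<pi>) (nilpotency_degree R \<pi>)"
proof -
  let ?l = "nilpotency_degree R \<pi>"
  interpret RC: chain_ring R \<pi> ?l by (rule chain_ring)
  have pow: "\<iota> \<pi> [^]\<^bsub>S\<^esub> i = \<iota> (\<pi> [^] i)" for i :: nat using uniformizer_closed by simp
  show ?thesis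
  proof
    have "carrier S \<subseteq> PB.comb ` ({..<n} \<rightarrow>\<^sub>E carrier R)" using PB.coords_comb by blast
    moreover have "finite ({..<n} \<rightarrow>\<^sub>E carrier R)" using finite_carrier by (intro finite_PiE) auto
    ultimately show "finite (carrier S)" using finite_surj by blast
    show "\<iota> \<pi> [^]\<^bsub>S\<^esub> ?l = \<zero>\<^bsub>S\<^esub>" unfolding pow RC.p_pow_m by simp
    show "\<iota> \<pi> [^]\<^bsub>S\<^esub> (?l - 1) \<noteq> \<zero>\<^bsub>S\<^esub>"
      unfolding pow using incl_inj[of "\<pi> [^] (?l - 1)"] RC.p_pow_less uniformizer_closed by auto
    show "0 < ?l" by (rule RC.m_pos)
  qed (use uniformizer_closed ext_Units_eq in auto)
qed

sublocale CE: chain_extension R S \<iota> \<xi> n "coeff (UP R) f" \<pi> "nilpotency_degree R \<pi>"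
  by (intro chain_extension.intro PB.power_basis_axioms chain_ring ext_chain_ring)

end

theorem theorem5p2:
  fixes R :: "('a, 'b) ring_scheme" and \<pi> :: 'a
    and fbar :: "nat \<Rightarrow> 'a set" and f :: "nat \<Rightarrow> 'a"
    and n q l k :: nat
    and chi :: "(nat \<Rightarrow> 'a) set \<Rightarrow> complex"
  assumes "standard_extension R \<pi> fbar f n"
    and "q = residue_size R \<pi>" and "odd q"
    and "l = nilpotency_degree R \<pi>"
    and "chi \<in> mult_characters (ext_ring R f)"
    and "\<not> trivial_character (ext_ring R f) chi"
    and "char_valuation (ext_ring R f) (ext_incl R f \<pi>) chi = k" and "k \<ge> 1"
  shows
    "(\<not> trivial_character R (char_res R f chi) \<longrightarrow>
        eisenstein_sum0 R f chi = 0 \<and>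
        (char_valuation R \<pi> (char_res R f chi) = k \<longrightarrow>
          cmod (eisenstein_sum R f chi)
            = real q powr ((real n - 1) * (real l - real k / 2))) \<and>
        (char_valuation R \<pi> (char_res R f chi) \<noteq> k \<longrightarrow>
          eisenstein_sum R f chi = 0)) \<and>
     (trivial_character R (char_res R f chi) \<longrightarrow>
        (k = 1 \<longrightarrow>
          cmod (eisenstein_sum R f chi)
            = real q powr ((real n - 1) * real l - real n / 2)) \<and>
        (k \<noteq> 1 \<longrightarrow> eisenstein_sum R f chi = 0) \<and>
        cmod (eisenstein_sum0 R f chi)
          = (1 - 1 / real q) * real q powr ((real n - 1) * real l - (real n / 2 - 1) * real k) \<and>
        (k = 1 \<longrightarrow>
          eisenstein_sum0 R f chi = - (of_nat q - 1) * eisenstein_sum R f chi))"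
proof -
  interpret SE: standard_extension R \<pi> fbar f n by fact
  let ?S = "ext_ring R f"
  let ?\<pi> = "ext_incl R f \<pi>"
  let ?triv = "\<lambda>i. \<forall>u \<in> principal_units ?S ?\<pi> i. chi u = 1"
  have k: "k = (LEAST i. ?triv i)" using assms(7) by (simp add: char_valuation_def)
  \<comment> \<open>At level l > 0 the group of principal units is trivial, so some level satisfies
    the condition and the least one is attained.\<close>
  have "principal_units ?S ?\<pi> l = {\<one>\<^bsub>?S\<^esub>}"
    using SE.CE.SC.m_pos SE.CE.SC.Ip_m assms(4) by (simp add: principal_units_def SE.CE.SC.Ip_def)
  moreover have "chi \<one>\<^bsub>?S\<^esub> = 1"
  proof -
    have "chi \<one>\<^bsub>?S\<^esub> \<noteq> 0" "chi (\<one>\<^bsub>?S\<^esub> \<otimes>\<^bsub>?S\<^esub> \<one>\<^bsub>?S\<^esub>) = chi \<one>\<^bsub>?S\<^esub> * chi \<one>\<^bsub>?S\<^esub>"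
      using assms(5) SE.Q.S.Units_one_closed unfolding mult_characters_def hom_def
      by (force simp: units_of_def complex_units_def)+
    then show ?thesis by simp
  qed
  ultimately have "?triv l" by simp
  then have triv_k: "?triv k" unfolding k by (rule LeastI)
  have less_k: "\<exists>u \<in> principal_units ?S ?\<pi> i. chi u \<noteq> 1" if "i < k" for i
    using not_less_Least[of i ?triv] that unfolding k by blast
  interpret E: eisenstein R ?S "ext_incl R f" "ext_gen R f" n "coeff (UP R) f" \<pi> l chi k q
  proof (intro eisenstein.intro eisenstein_axioms.intro)
    show "chain_extension R ?S (ext_incl R f) (ext_gen R f) n (coeff (UP R) f) \<pi> l"
      unfolding assms(4) by (rule SE.CE.chain_extension_axioms)
    show "q = card (carrier (R Quot PIdl\<^bsub>R\<^esub> \<pi>))"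
      unfolding assms(2) residue_size_def residue_ring_of_def ..
  qed (use assms(5,8) triv_k less_k in auto)
  have tr: "ext_trace R f = SE.PB.Tr" using SE.ext_trace_eq by blast
  have E0: "eisenstein_sum0 R f chi = E.E \<zero>\<^bsub>R\<^esub>"
    unfolding eisenstein_sum0_def E.E_def tr ..
  \<comment> \<open>A non-unit has its trace in (\<pi>), which does not contain 1; so for trace 1
    the sum over S is already the sum over units.\<close>
  have "y \<in> Units ?S" if y: "y \<in> carrier ?S" "SE.PB.Tr y = \<one>\<^bsub>R\<^esub>" for y
  proof (rule ccontr)
    assume "y \<notin> Units ?S"
    then have "y \<in> E.SC.Ip 1" using y E.SC.Units_eq E.SC.Ip_1 by simp
    then have "\<one>\<^bsub>R\<^esub> \<in> E.RC.Ip 1" using E.Tr_Ip y(2) by metis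
    then show False using E.RC.Units_eq E.RC.Ip_1 SE.Units_one_closed by auto
  qed
  then have "{y \<in> carrier ?S. SE.PB.Tr y = \<one>\<^bsub>R\<^esub>} = {y \<in> Units ?S. SE.PB.Tr y = \<one>\<^bsub>R\<^esub>}"
    using SE.Q.S.Units_closed by blast
  then have E1: "eisenstein_sum R f chi = E.E \<one>\<^bsub>R\<^esub>"
    unfolding eisenstein_sum_def E.E_def tr by simp
  show ?thesis
    using E.eisenstein_sums unfolding E0 E1 char_res_def[abs_def] .
qed

end
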